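(* Let $k$ be an algebraically closed field of characteristic zero and $n\ge 1$. Every (faithful) rational action $\varrho$ of a finite group $G$ on an $n$-dimensional irreducible variety, which has a fixed point, is obtained by a nontrivial base change from a (faithful) linear action of the group $G$ on an $n$-dimensional linear space.
   Context: Varieties are algebraic varieties over $k$. A (faithful) rational action of a finite group $G$ on an irreducible variety $X$ is an injective homomorphism $\varrho\colon G\hookrightarrow\mathrm{Bir}(X)$. A regularization of $\varrho$ is a regular action of $G$ (by automorphisms) on an irreducible smooth complete variety $Y$ such that there is a $G$-equivariant birational isomorphism $X\dashrightarrow Y$. We say that $\varrho$ has a fixed point if there is a regularization with $Y^G\ne\varnothing$. A rational action $\varrho_1\colon G\hookrightarrow\mathrm{Bir}(X_1)$ is obtained by a nontrivial base change from a rational action $\varrho_2\colon G\hookrightarrow\mathrm{Bir}(X_2)$ if there is a $G$-equivariant dominant rational map $\varphi\colon X_1\dashrightarrow X_2$ (i.e. $\varphi\circ\varrho_1(g)=\varrho_2(g)\circ\varphi$ for all $g\in G$; such a $\varphi$ is called a compression of $\varrho_1$ into $\varrho_2$) which is not a birational isomorphism. *)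

theory Defs
  imports
    "HOL-Analysis.Abstract_Topology"
    "HOL-Library.Extended_Nat"
    "HOL-Library.Function_Algebras"
    "HOL-Computational_Algebra.Polynomial"
    "HOL-Algebra.Group_Action"
    "Jordan_Normal_Form.Matrix"
begin

section \<open>Varieties as spaces with functions\<close>

text \<open>
  Varieties over an algebraically closed field are treated in the classical way (Serre, Springer):
  a topological space together with, for each open set \<open>U\<close>, the algebra of regular functions on
  \<open>U\<close>. Functions on \<open>U\<close> are extensional, i.e. \<open>undefined\<close> outside \<open>U\<close>. The value of \<open>reg\<close> on a
  set that is not open is irrelevant.
\<close>

record ('a, 'k) fspace =
  zar :: "'a topology"
  reg :: "'a set \<Rightarrow> ('a \<Rightarrow> 'k) set"

abbreviation points :: "('a, 'k, 'm) fspace_scheme \<Rightarrow> 'a set" where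
  "points X \<equiv> topspace (zar X)"

definition space_with_functions :: "('a, 'k::field) fspace \<Rightarrow> bool" where
  "space_with_functions X \<longleftrightarrow>
     (\<forall>U. openin (zar X) U \<longrightarrow>
        reg X U \<subseteq> extensional U \<and>
        (\<forall>c. (\<lambda>x\<in>U. c) \<in> reg X U) \<and>
        (\<forall>f\<in>reg X U. \<forall>g\<in>reg X U. (\<lambda>x\<in>U. f x + g x) \<in> reg X U \<and> (\<lambda>x\<in>U. f x * g x) \<in> reg X U) \<and>
        (\<forall>V f. openin (zar X) V \<and> V \<subseteq> U \<and> f \<in> reg X U \<longrightarrow> restrict f V \<in> reg X V) \<and>
        (\<forall>f\<in>extensional U.
           (\<forall>x\<in>U. \<exists>V. openin (zar X) V \<and> x \<in> V \<and> V \<subseteq> U \<and> restrict f V \<in> reg X V)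
           \<longrightarrow> f \<in> reg X U))"

definition open_subspace :: "('a, 'k) fspace \<Rightarrow> 'a set \<Rightarrow> ('a, 'k) fspace" where
  "open_subspace X U = \<lparr>zar = subtopology (zar X) U, reg = reg X\<rparr>"

definition morphism :: "('a, 'k) fspace \<Rightarrow> ('b, 'k) fspace \<Rightarrow> ('a \<Rightarrow> 'b) \<Rightarrow> bool" where
  "morphism X Y f \<longleftrightarrow>
     f \<in> extensional (points X) \<and> continuous_map (zar X) (zar Y) f \<and>
     (\<forall>V. openin (zar Y) V \<longrightarrow>
        (\<forall>h\<in>reg Y V. compose {x \<in> points X. f x \<in> V} h f \<in> reg X {x \<in> points X. f x \<in> V}))"

definition isomorphic :: "('a, 'k) fspace \<Rightarrow> ('b, 'k) fspace \<Rightarrow> bool" where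
  "isomorphic X Y \<longleftrightarrow>
     (\<exists>f g. morphism X Y f \<and> morphism Y X g \<and>
        (\<forall>x\<in>points X. g (f x) = x) \<and> (\<forall>y\<in>points Y. f (g y) = y))"

subsection \<open>Affine varieties\<close>

text \<open>Polynomial functions on \<open>k\<^sup>m\<close>; only their values on \<open>carrier_vec m\<close> matter.\<close>

inductive_set poly_fun :: "nat \<Rightarrow> ('k::field vec \<Rightarrow> 'k) set" for m where
  const: "(\<lambda>_. c) \<in> poly_fun m"
| coord: "i < m \<Longrightarrow> (\<lambda>v. v $ i) \<in> poly_fun m"
| add: "p \<in> poly_fun m \<Longrightarrow> q \<in> poly_fun m \<Longrightarrow> (\<lambda>v. p v + q v) \<in> poly_fun m"
| mult: "p \<in> poly_fun m \<Longrightarrow> q \<in> poly_fun m \<Longrightarrow> (\<lambda>v. p v * q v) \<in> poly_fun m"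

text \<open>The sets where a polynomial does not vanish form a basis of the Zariski topology, so its closed
  sets are the zero loci of sets of polynomials.\<close>

definition zariski :: "nat \<Rightarrow> 'k::field vec topology" where
  "zariski m = topology_generated_by {{v \<in> carrier_vec m. p v \<noteq> 0} | p. p \<in> poly_fun m}"

text \<open>The structure of an affine variety on a Zariski closed subset \<open>Z\<close> of \<open>k\<^sup>m\<close>: regular functions
  are locally quotients of polynomials.\<close>

definition affine_space_with :: "nat \<Rightarrow> 'k::field vec set \<Rightarrow> ('k vec, 'k) fspace" where
  "affine_space_with m Z =
     \<lparr>zar = subtopology (zariski m) Z,
      reg = (\<lambda>U. {f \<in> extensional U. \<forall>x\<in>U. \<exists>p\<in>poly_fun m. \<exists>q\<in>poly_fun m.
               q x \<noteq> 0 \<and> {y \<in> Z. q y \<noteq> 0} \<subseteq> U \<and> (\<forall>y\<in>Z. q y \<noteq> 0 \<longrightarrow> f y = p y / q y)})\<rparr>"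

definition affine_variety :: "('a, 'k::field) fspace \<Rightarrow> bool" where
  "affine_variety X \<longleftrightarrow>
     (\<exists>m Z. closedin (zariski m) Z \<and> isomorphic X (affine_space_with m Z))"

abbreviation affine_space :: "nat \<Rightarrow> ('k::field vec, 'k) fspace" where
  "affine_space n \<equiv> affine_space_with n (carrier_vec n)"

subsection \<open>Products and varieties\<close>

text \<open>The functions on \<open>U \<times> V\<close> coming from the tensor product of the algebras of \<open>U\<close> and \<open>V\<close>. Their
  nonvanishing loci generate the topology of the product, and regular functions on the product are
  locally quotients of such functions.\<close>

definition tensor_fun :: "('a, 'k::field) fspace \<Rightarrow> ('b, 'k) fspace \<Rightarrow> 'a set \<Rightarrow> 'b set \<Rightarrow> ('a \<times> 'b \<Rightarrow> 'k) set" where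
  "tensor_fun X Y U V =
     {(\<lambda>(x, y). \<Sum>i<N. f i x * g i y) | (N::nat) f g. \<forall>i<N. f i \<in> reg X U \<and> g i \<in> reg Y V}"

definition prod_space :: "('a, 'k::field) fspace \<Rightarrow> ('b, 'k) fspace \<Rightarrow> ('a \<times> 'b, 'k) fspace" where
  "prod_space X Y =
     \<lparr>zar = topology_generated_by
        {{z \<in> U \<times> V. t z \<noteq> 0} | U V t.
           openin (zar X) U \<and> openin (zar Y) V \<and> t \<in> tensor_fun X Y U V},
      reg = (\<lambda>W. {h \<in> extensional W. \<forall>z\<in>W. \<exists>U V. \<exists>s\<in>tensor_fun X Y U V. \<exists>t\<in>tensor_fun X Y U V.
               openin (zar X) U \<and> openin (zar Y) V \<and> z \<in> U \<times> V \<and> t z \<noteq> 0 \<and>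
               {w \<in> U \<times> V. t w \<noteq> 0} \<subseteq> W \<and> (\<forall>w\<in>U \<times> V. t w \<noteq> 0 \<longrightarrow> h w = s w / t w)})\<rparr>"

definition prevariety :: "('a, 'k::field) fspace \<Rightarrow> bool" where
  "prevariety X \<longleftrightarrow>
     space_with_functions X \<and>
     (\<exists>\<U>. finite \<U> \<and> \<Union>\<U> = points X \<and>
        (\<forall>U\<in>\<U>. openin (zar X) U \<and> affine_variety (open_subspace X U)))"

definition variety :: "('a, 'k::field) fspace \<Rightarrow> bool" where
  "variety X \<longleftrightarrow> prevariety X \<and> closedin (zar (prod_space X X)) (Id_on (points X))"

text \<open>In the definition of completeness it is no restriction that the test varieties have their
  points in the type \<open>'k vec\<close>: over an infinite field every variety, being covered by finitely many
  affine ones, has an isomorphic copy of this kind.\<close>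

definition complete_variety :: "('a, 'k::field) fspace \<Rightarrow> bool" where
  "complete_variety X \<longleftrightarrow>
     variety X \<and>
     (\<forall>Y :: ('k vec, 'k) fspace. variety Y \<longrightarrow> closed_map (zar (prod_space X Y)) (zar Y) snd)"

subsection \<open>Irreducibility, dimension, smoothness\<close>

definition irreducible_space :: "'a topology \<Rightarrow> bool" where
  "irreducible_space T \<longleftrightarrow>
     topspace T \<noteq> {} \<and>
     (\<forall>A B. closedin T A \<and> closedin T B \<and> A \<union> B = topspace T \<longrightarrow> A = topspace T \<or> B = topspace T)"

definition irreducible_variety :: "('a, 'k::field) fspace \<Rightarrow> bool" where
  "irreducible_variety X \<longleftrightarrow> variety X \<and> irreducible_space (zar X)"

definition krull_dim :: "'a topology \<Rightarrow> enat" where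
  "krull_dim T =
     Sup {enat N | N. \<exists>C :: nat \<Rightarrow> 'a set.
            (\<forall>i\<le>N. closedin T (C i) \<and> irreducible_space (subtopology T (C i))) \<and>
            (\<forall>i<N. C i \<subset> C (Suc i))}"

definition local_dim :: "'a topology \<Rightarrow> 'a \<Rightarrow> enat" where
  "local_dim T x = Inf {krull_dim (subtopology T U) | U. openin T U \<and> x \<in> U}"

definition local_functions :: "('a, 'k) fspace \<Rightarrow> 'a \<Rightarrow> ('a set \<times> ('a \<Rightarrow> 'k)) set" where
  "local_functions X x = {(U, f). openin (zar X) U \<and> x \<in> U \<and> f \<in> reg X U}"

text \<open>The Zariski tangent space at \<open>x\<close>: derivations with values in \<open>k\<close> of the local ring at \<open>x\<close>, seen
  as functions of a representative \<open>(U, f)\<close> of a germ (and zero on all other pairs).\<close>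

definition tangent_space :: "('a, 'k::field) fspace \<Rightarrow> 'a \<Rightarrow> ('a set \<times> ('a \<Rightarrow> 'k) \<Rightarrow> 'k) set" where
  "tangent_space X x =
     {D. (\<forall>p. p \<notin> local_functions X x \<longrightarrow> D p = 0) \<and>
         (\<forall>U V f. (U, f) \<in> local_functions X x \<and> openin (zar X) V \<and> x \<in> V \<and> V \<subseteq> U \<longrightarrow>
            D (V, restrict f V) = D (U, f)) \<and>
         (\<forall>U f g. (U, f) \<in> local_functions X x \<and> (U, g) \<in> local_functions X x \<longrightarrow>
            D (U, \<lambda>y\<in>U. f y + g y) = D (U, f) + D (U, g) \<and>
            D (U, \<lambda>y\<in>U. f y * g y) = f x * D (U, g) + g x * D (U, f)) \<and>
         (\<forall>U f c. (U, f) \<in> local_functions X x \<longrightarrow> D (U, \<lambda>y\<in>U. c * f y) = c * D (U, f))}"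

definition smooth_variety :: "('a, 'k::field) fspace \<Rightarrow> bool" where
  "smooth_variety X \<longleftrightarrow>
     variety X \<and>
     (\<forall>x\<in>points X.
        enat (vector_space.dim (\<lambda>c D p. c * D p) (tangent_space X x)) = local_dim (zar X) x)"

section \<open>Rational maps\<close>

text \<open>Rational maps from an irreducible variety are equivalence classes of morphisms defined on
  nonempty open subsets.\<close>

definition rat_reps :: "('a, 'k) fspace \<Rightarrow> ('b, 'k) fspace \<Rightarrow> ('a set \<times> ('a \<Rightarrow> 'b)) set" where
  "rat_reps X Y = {(U, f). openin (zar X) U \<and> U \<noteq> {} \<and> morphism (open_subspace X U) Y f}"

definition rat_eq :: "('a, 'k) fspace \<Rightarrow> ('b, 'k) fspace \<Rightarrow> ('a set \<times> ('a \<Rightarrow> 'b)) rel" where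
  "rat_eq X Y =
     {((U, f), (V, g)). (U, f) \<in> rat_reps X Y \<and> (V, g) \<in> rat_reps X Y \<and> (\<forall>x\<in>U \<inter> V. f x = g x)}"

definition rational_maps :: "('a, 'k) fspace \<Rightarrow> ('b, 'k) fspace \<Rightarrow> ('a set \<times> ('a \<Rightarrow> 'b)) set set" where
  "rational_maps X Y = rat_reps X Y // rat_eq X Y"

definition rat_of_morphism :: "('a, 'k) fspace \<Rightarrow> ('b, 'k) fspace \<Rightarrow> ('a \<Rightarrow> 'b) \<Rightarrow> ('a set \<times> ('a \<Rightarrow> 'b)) set" where
  "rat_of_morphism X Y f = rat_eq X Y `` {(points X, f)}"

definition rat_id :: "('a, 'k) fspace \<Rightarrow> ('a set \<times> ('a \<Rightarrow> 'a)) set" where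
  "rat_id X = rat_of_morphism X X (\<lambda>x\<in>points X. x)"

definition dominant :: "('a, 'k) fspace \<Rightarrow> ('b, 'k) fspace \<Rightarrow> ('a set \<times> ('a \<Rightarrow> 'b)) set \<Rightarrow> bool" where
  "dominant X Y \<Phi> \<longleftrightarrow>
     \<Phi> \<in> rational_maps X Y \<and> (\<exists>(U, f)\<in>\<Phi>. zar Y closure_of (f ` U) = points Y)"

text \<open>\<open>rat_comp X Y Z \<Psi> \<Phi>\<close> is \<open>\<Psi> \<circ> \<Phi>\<close>, meaningful for dominant \<open>\<Phi>\<close> between irreducible varieties.\<close>

definition rat_comp ::
  "('a, 'k) fspace \<Rightarrow> ('b, 'k) fspace \<Rightarrow> ('c, 'k) fspace \<Rightarrow>
   ('b set \<times> ('b \<Rightarrow> 'c)) set \<Rightarrow> ('a set \<times> ('a \<Rightarrow> 'b)) set \<Rightarrow> ('a set \<times> ('a \<Rightarrow> 'c)) set" where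
  "rat_comp X Y Z \<Psi> \<Phi> =
     (\<Union>(U, f)\<in>\<Phi>. \<Union>(V, g)\<in>\<Psi>. rat_eq X Z `` {({x \<in> U. f x \<in> V}, compose {x \<in> U. f x \<in> V} g f)})"

definition birational :: "('a, 'k) fspace \<Rightarrow> ('b, 'k) fspace \<Rightarrow> ('a set \<times> ('a \<Rightarrow> 'b)) set \<Rightarrow> bool" where
  "birational X Y \<Phi> \<longleftrightarrow>
     dominant X Y \<Phi> \<and>
     (\<exists>\<Psi>. dominant Y X \<Psi> \<and> rat_comp X Y X \<Psi> \<Phi> = rat_id X \<and> rat_comp Y X Y \<Phi> \<Psi> = rat_id Y)"

definition Bir :: "('a, 'k) fspace \<Rightarrow> ('a set \<times> ('a \<Rightarrow> 'a)) set monoid" where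
  "Bir X = \<lparr>carrier = {\<Phi>. birational X X \<Phi>}, monoid.mult = rat_comp X X X, one = rat_id X\<rparr>"

section \<open>Rational actions\<close>

definition rational_action ::
  "('g, 'm) monoid_scheme \<Rightarrow> ('a, 'k::field) fspace \<Rightarrow> ('g \<Rightarrow> ('a set \<times> ('a \<Rightarrow> 'a)) set) \<Rightarrow> bool" where
  "rational_action G X \<rho> \<longleftrightarrow>
     irreducible_variety X \<and> \<rho> \<in> hom G (Bir X) \<and> inj_on \<rho> (carrier G)"

definition equivariant ::
  "('g, 'm) monoid_scheme \<Rightarrow>
   ('a, 'k::field) fspace \<Rightarrow> ('g \<Rightarrow> ('a set \<times> ('a \<Rightarrow> 'a)) set) \<Rightarrow>
   ('b, 'k) fspace \<Rightarrow> ('g \<Rightarrow> ('b set \<times> ('b \<Rightarrow> 'b)) set) \<Rightarrow> ('a set \<times> ('a \<Rightarrow> 'b)) set \<Rightarrow> bool" where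
  "equivariant G X \<rho> Y \<sigma> \<Phi> \<longleftrightarrow>
     (\<forall>g\<in>carrier G. rat_comp X X Y \<Phi> (\<rho> g) = rat_comp X Y Y (\<sigma> g) \<Phi>)"

definition regular_action ::
  "('g, 'm) monoid_scheme \<Rightarrow> ('a, 'k::field) fspace \<Rightarrow> ('g \<Rightarrow> 'a \<Rightarrow> 'a) \<Rightarrow> bool" where
  "regular_action G Y \<sigma> \<longleftrightarrow>
     group_action G (points Y) \<sigma> \<and> (\<forall>g\<in>carrier G. morphism Y Y (\<sigma> g))"

definition regularization ::
  "('g, 'm) monoid_scheme \<Rightarrow>
   ('a, 'k::field) fspace \<Rightarrow> ('g \<Rightarrow> ('a set \<times> ('a \<Rightarrow> 'a)) set) \<Rightarrow>
   ('b, 'k) fspace \<Rightarrow> ('g \<Rightarrow> 'b \<Rightarrow> 'b) \<Rightarrow> bool" where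
  "regularization G X \<rho> Y \<sigma> \<longleftrightarrow>
     irreducible_variety Y \<and> smooth_variety Y \<and> complete_variety Y \<and> regular_action G Y \<sigma> \<and>
     (\<exists>\<Phi>. birational X Y \<Phi> \<and> equivariant G X \<rho> Y (\<lambda>g. rat_of_morphism Y Y (\<sigma> g)) \<Phi>)"

text \<open>The first argument only names the type \<open>'b\<close> of the points of the regularization; a hypothesis
  \<open>has_fixed_point TYPE('b) G X \<rho>\<close> with a free type variable \<open>'b\<close> does not restrict this type.\<close>

definition has_fixed_point ::
  "'b itself \<Rightarrow> ('g, 'm) monoid_scheme \<Rightarrow>
   ('a, 'k::field) fspace \<Rightarrow> ('g \<Rightarrow> ('a set \<times> ('a \<Rightarrow> 'a)) set) \<Rightarrow> bool" where
  "has_fixed_point _ G X \<rho> \<longleftrightarrow>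
     (\<exists>(Y :: ('b, 'k) fspace) \<sigma>. regularization G X \<rho> Y \<sigma> \<and>
        {y \<in> points Y. \<forall>g\<in>carrier G. \<sigma> g y = y} \<noteq> {})"

definition nontrivial_base_change ::
  "('g, 'm) monoid_scheme \<Rightarrow>
   ('a, 'k::field) fspace \<Rightarrow> ('g \<Rightarrow> ('a set \<times> ('a \<Rightarrow> 'a)) set) \<Rightarrow>
   ('b, 'k) fspace \<Rightarrow> ('g \<Rightarrow> ('b set \<times> ('b \<Rightarrow> 'b)) set) \<Rightarrow> bool" where
  "nontrivial_base_change G X\<^sub>1 \<rho>\<^sub>1 X\<^sub>2 \<rho>\<^sub>2 \<longleftrightarrow>
     rational_action G X\<^sub>1 \<rho>\<^sub>1 \<and> rational_action G X\<^sub>2 \<rho>\<^sub>2 \<and>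
     (\<exists>\<phi>. dominant X\<^sub>1 X\<^sub>2 \<phi> \<and> equivariant G X\<^sub>1 \<rho>\<^sub>1 X\<^sub>2 \<rho>\<^sub>2 \<phi> \<and> \<not> birational X\<^sub>1 X\<^sub>2 \<phi>)"

definition GL :: "nat \<Rightarrow> 'k::field mat monoid" where
  "GL n = units_of (ring_mat TYPE('k) n ())"

definition faithful_linear_action ::
  "('g, 'm) monoid_scheme \<Rightarrow> nat \<Rightarrow> ('g \<Rightarrow> 'k::field mat) \<Rightarrow> bool" where
  "faithful_linear_action G n \<alpha> \<longleftrightarrow> \<alpha> \<in> hom G (GL n) \<and> inj_on \<alpha> (carrier G)"

text \<open>A linear action on \<open>k\<^sup>n\<close>, seen as a rational action on the variety \<open>k\<^sup>n\<close>.\<close>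

definition rational_of_linear ::
  "nat \<Rightarrow> ('g \<Rightarrow> 'k::field mat) \<Rightarrow> 'g \<Rightarrow> ('k vec set \<times> ('k vec \<Rightarrow> 'k vec)) set" where
  "rational_of_linear n \<alpha> g =
     rat_of_morphism (affine_space n) (affine_space n) (\<lambda>v\<in>carrier_vec n. \<alpha> g *\<^sub>v v)"

end

theory Submission
  imports Defs "Jordan_Normal_Form.Determinant"
begin

text \<open>
  Let \<open>y\<close> be a fixed point on a regularization \<open>Y\<close>. Averaging functions dual to a basis of the tangent space
  at \<open>y\<close> over \<open>G\<close> gives functions \<open>w = (w\<^sub>1, \<dots>, w\<^sub>d)\<close> on an invariant neighbourhood of \<open>y\<close> on which \<open>G\<close>
  acts by the linear representation \<open>\<alpha>\<close> on the tangent space, and whose differentials at \<open>y\<close> form a basis.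
  Together with further coordinates they embed a neighbourhood of \<open>y\<close>, and there is a matrix of difference quotients
  \<open>H(x, z)\<close> with \<open>H(y, y) = 1\<close> that annihilates \<open>x - z\<close> whenever \<open>w(x) = w(z)\<close>. Where it is
  invertible, an element acting trivially on the tangent space acts trivially, so \<open>\<alpha>\<close> is faithful, and on the
  diagonal the differential of \<open>w\<close> is injective.

  By pseudo-division, the tangent space at a generic point is at least as large as any number of algebraically
  independent functions. Smoothness at \<open>y\<close> provides \<open>d\<close> of these, so the differential of \<open>w\<close> is generically
  bijective. The polynomials vanishing on the image of \<open>w\<close> are then closed under differentiation, hence zero in
  characteristic \<open>0\<close>: the map \<open>w\<close> is a dominant equivariant map to a linear representation, and smoothness at generic
  points gives \<open>d = n\<close>.

  The map \<open>w\<close> may well be birational, so it is composed with \<open>v \<mapsto> f(v) v\<close> for a nonzero invariant form \<open>f\<close>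
  of degree \<open>e \<ge> 1\<close>. This is equivariant and dominant but identifies \<open>v\<close> with \<open>\<zeta> v\<close> for a
  root of unity \<open>\<zeta> \<noteq> 1\<close> of order dividing \<open>e + 1\<close>.
\<close>

section \<open>Polynomial functions\<close>

text \<open>Dominance of \<open>w\<close> is a question about generic points, while the fixed point
  gives information at \<open>y\<close> only. Completions and transcendence degrees are avoided: the
  determinant of difference quotients carries injectivity of the differential from \<open>y\<close>
  to a neighbourhood, and dimension is tested by algebraically independent functions read off from
  chains of irreducible closed sets. The numbers \<open>d\<close> and \<open>n\<close> belong to
  different varieties and are compared in both directions through a birational map. Characteristic
  zero matters in particular for averaging, where \<open>card (carrier G)\<close> must be
  invertible, for Taylor expansion, which recovers a polynomial from its derivatives at one point,
  and for roots of unity other than 1. The form \<open>f\<close> is the norm of a coordinate, so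
  \<open>e = card (carrier G)\<close>. Multiplying \<open>v\<close> by an invariant scalar commutes
  with every matrix, which raising coordinates to powers would not do. The composite stays dominant
  because \<open>s ^ (e + 1) * f(c) = 1\<close> can be solved over an algebraically closed field,
  and then \<open>s c\<close> is mapped to \<open>c\<close>.\<close>

lemma poly_fun_uminus: "p \<in> poly_fun m \<Longrightarrow> (\<lambda>v. - p v) \<in> poly_fun m"
  using poly_fun.mult[OF poly_fun.const[of "-1"], of p m] by simp

lemma poly_fun_diff: "p \<in> poly_fun m \<Longrightarrow> q \<in> poly_fun m \<Longrightarrow> (\<lambda>v. p v - q v) \<in> poly_fun m"
  using poly_fun.add[OF _ poly_fun_uminus, of p m q] by simp

lemma poly_fun_sum: "(\<And>i. i \<in> I \<Longrightarrow> p i \<in> poly_fun m) \<Longrightarrow> (\<lambda>v. \<Sum>i\<in>I. p i v) \<in> poly_fun m"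
  by (induction I rule: infinite_finite_induct) (auto intro: poly_fun.intros)

lemma poly_fun_prod: "(\<And>i. i \<in> I \<Longrightarrow> p i \<in> poly_fun m) \<Longrightarrow> (\<lambda>v. \<Prod>i\<in>I. p i v) \<in> poly_fun m"
  by (induction I rule: infinite_finite_induct) (auto intro: poly_fun.intros)

lemma poly_fun_power: "p \<in> poly_fun m \<Longrightarrow> (\<lambda>v. p v ^ (i::nat)) \<in> poly_fun m"
  by (induction i) (auto intro: poly_fun.intros)

lemmas poly_fun_intros = poly_fun.intros poly_fun_uminus poly_fun_diff poly_fun_sum poly_fun_prod
  poly_fun_power

lemma poly_fun_mono: "p \<in> poly_fun j \<Longrightarrow> j \<le> m \<Longrightarrow> p \<in> poly_fun m"
  by (induction rule: poly_fun.induct) (auto intro: poly_fun.intros)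

text \<open>\<open>u\<close> and \<open>v\<close> may have different dimensions. A polynomial in the
  first \<open>m\<close> variables can thus be evaluated on longer vectors, and inclusions of
  polynomial rings cost nothing; elimination ideals and appended coordinates rely on this.\<close>

lemma poly_fun_cong: "p \<in> poly_fun m \<Longrightarrow> (\<And>i. i < m \<Longrightarrow> u $ i = v $ i) \<Longrightarrow> p u = p v"
  by (induction rule: poly_fun.induct) auto

lemma poly_fun_compose:
  assumes "p \<in> poly_fun n" and "\<And>i. i < n \<Longrightarrow> f i \<in> poly_fun m"
  shows "(\<lambda>v. p (vec n (\<lambda>i. f i v))) \<in> poly_fun m"
  using assms(1)
  by (induction rule: poly_fun.induct) (auto intro: poly_fun.intros assms(2))

lemma poly_fun_det:
  assumes "\<And>i j. i < n \<Longrightarrow> j < n \<Longrightarrow> f i j \<in> poly_fun m"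
  shows "(\<lambda>v. det (mat n n (\<lambda>(i, j). f i j v))) \<in> poly_fun m"
proof -
  have "(\<lambda>v. det (mat n n (\<lambda>(i, j). f i j v))) =
      (\<lambda>v. \<Sum>p | p permutes {0..<n}. signof p * (\<Prod>i = 0..<n. f i (p i) v))"
    by (intro ext) (auto simp: det_def intro!: sum.cong prod.cong)
  also have "\<dots> \<in> poly_fun m"
    by (intro poly_fun_intros) (auto intro!: assms)
  finally show ?thesis .
qed

text \<open>Lines reduce questions about several variables to one: nonvanishing, derivatives and
  Taylor expansions are all read off the univariate polynomial \<open>p\<close>.\<close>

lemma poly_fun_line:
  fixes F :: "'k::field vec \<Rightarrow> 'k"
  assumes "F \<in> poly_fun m" "x \<in> carrier_vec m" "v \<in> carrier_vec m"
  shows "\<exists>p. \<forall>t. poly p t = F (x + t \<cdot>\<^sub>v v)"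
  using assms(1)
proof (induction rule: poly_fun.induct)
  case (const c)
  show ?case by (intro exI[of _ "[:c:]"]) auto
next
  case (coord i)
  show ?case using assms coord by (intro exI[of _ "[:x $ i, v $ i:]"]) (auto simp: mult.commute)
next
  case (add F G)
  then obtain p q where "\<forall>t. poly p t = F (x + t \<cdot>\<^sub>v v)" "\<forall>t. poly q t = G (x + t \<cdot>\<^sub>v v)" by auto
  then show ?case by (intro exI[of _ "p + q"]) auto
next
  case (mult F G)
  then obtain p q where "\<forall>t. poly p t = F (x + t \<cdot>\<^sub>v v)" "\<forall>t. poly q t = G (x + t \<cdot>\<^sub>v v)" by auto
  then show ?case by (intro exI[of _ "p * q"]) auto
qed

text \<open>On the line through \<open>a\<close> and \<open>b\<close> both functions restrict to
  nonzero univariate polynomials, and their product has a nonroot because the field is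
  infinite.\<close>

lemma poly_fun_mult_nonzero:
  fixes p q :: "'k::field_char_0 vec \<Rightarrow> 'k"
  assumes p: "p \<in> poly_fun m" and q: "q \<in> poly_fun m"
    and a: "a \<in> carrier_vec m" "p a \<noteq> 0" and b: "b \<in> carrier_vec m" "q b \<noteq> 0"
  obtains c where "c \<in> carrier_vec m" "p c \<noteq> 0" "q c \<noteq> 0"
proof -
  obtain f where f: "poly f t = p (a + t \<cdot>\<^sub>v (b - a))" for t
    using poly_fun_line[OF p a(1), of "b - a"] a b by auto
  obtain g where g: "poly g t = q (a + t \<cdot>\<^sub>v (b - a))" for t
    using poly_fun_line[OF q a(1), of "b - a"] a b by auto
  have "a + 0 \<cdot>\<^sub>v (b - a) = a" "a + 1 \<cdot>\<^sub>v (b - a) = b" using a b by auto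
  with f[of 0] g[of 1] a b have "f \<noteq> 0" "g \<noteq> 0" by auto
  hence "f * g \<noteq> 0" by simp
  then obtain t where "poly (f * g) t \<noteq> 0" using poly_all_0_iff_0 by blast
  thus thesis using f g a b by (intro that[of "a + t \<cdot>\<^sub>v (b - a)"]) auto
qed

lemma poly_fun_nonzero_linear_prod:
  fixes p :: "'i \<Rightarrow> 'k::field_char_0 vec \<Rightarrow> 'k"
  assumes "finite I" and "\<And>i. i \<in> I \<Longrightarrow> p i \<in> poly_fun m"
    and "\<And>i. i \<in> I \<Longrightarrow> \<exists>a\<in>carrier_vec m. p i a \<noteq> 0"
  shows "\<exists>a\<in>carrier_vec m. (\<Prod>i\<in>I. p i a) \<noteq> 0"
  using assms
proof (induction I rule: finite_induct)
  case empty
  show ?case by (auto intro: exI[of _ "0\<^sub>v m"])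
next
  case (insert i I)
  then obtain b where "b \<in> carrier_vec m" "(\<Prod>i\<in>I. p i b) \<noteq> 0"
    by blast
  moreover from insert.prems(2) obtain a where "a \<in> carrier_vec m" "p i a \<noteq> 0" by blast
  ultimately obtain c where "c \<in> carrier_vec m" "p i c \<noteq> 0" "(\<Prod>i\<in>I. p i c) \<noteq> 0"
    using poly_fun_mult_nonzero[of "p i" m "\<lambda>v. \<Prod>i\<in>I. p i v" a b] poly_fun_prod[of I p m]
      insert.prems(1) by blast
  thus ?case using insert.hyps by (intro bexI[of _ c]) auto
qed

text \<open>Each coefficient ignores the coordinate \<open>j\<close>, and the equality holds on all
  vectors, longer ones included. Both the pseudo-division and the independence proof along a chain
  recurse on this expansion.\<close>

lemma poly_fun_last_var:
  assumes "F \<in> poly_fun (Suc j)"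
  shows "\<exists>n c. (\<forall>i. c i \<in> poly_fun j) \<and> F = (\<lambda>z. \<Sum>i\<le>n::nat. c i z * z $ j ^ i)"
  using assms
proof (induction rule: poly_fun.induct)
  case (const c)
  show ?case by (intro exI[of _ 0] exI[of _ "\<lambda>_ _. c"]) (auto intro: poly_fun.intros)
next
  case (coord i)
  show ?case
  proof (cases "i = j")
    case True
    thus ?thesis
      by (intro exI[of _ 1] exI[of _ "\<lambda>l _. if l = 1 then 1 else 0"]) (auto intro: poly_fun.intros)
  next
    case False
    thus ?thesis using coord
      by (intro exI[of _ 0] exI[of _ "\<lambda>_ z. z $ i"]) (auto intro: poly_fun.intros)
  qed
next
  case (add F G)
  then obtain n c n' c' where c: "\<And>i. c i \<in> poly_fun j" "F = (\<lambda>z. \<Sum>i\<le>n::nat. c i z * z $ j ^ i)"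
    and c': "\<And>i. c' i \<in> poly_fun j" "G = (\<lambda>z. \<Sum>i\<le>n'::nat. c' i z * z $ j ^ i)" by blast
  let ?e = "\<lambda>i z. (if i \<le> n then c i z else 0) + (if i \<le> n' then c' i z else 0)"
  have 1: "(\<Sum>i\<le>n. c i z * z $ j ^ i) = (\<Sum>i\<le>max n n'. (if i \<le> n then c i z else 0) * z $ j ^ i)" for z
    by (intro sum.mono_neutral_cong_left) auto
  have 2: "(\<Sum>i\<le>n'. c' i z * z $ j ^ i) = (\<Sum>i\<le>max n n'. (if i \<le> n' then c' i z else 0) * z $ j ^ i)" for z
    by (intro sum.mono_neutral_cong_left) auto
  have "(\<lambda>z. F z + G z) = (\<lambda>z. \<Sum>i\<le>max n n'. ?e i z * z $ j ^ i)"
    unfolding c(2) c'(2) 1 2 by (simp only: sum.distrib distrib_right)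
  moreover have "?e i \<in> poly_fun j" for i
    by (intro poly_fun.add; cases "i \<le> n"; cases "i \<le> n'") (auto simp: c c' intro: poly_fun.intros)
  ultimately show ?case by (intro exI[of _ "max n n'"] exI[of _ ?e] conjI allI)
next
  case (mult F G)
  then obtain n c n' c' where c: "\<And>i. c i \<in> poly_fun j" "F = (\<lambda>z. \<Sum>i\<le>n::nat. c i z * z $ j ^ i)"
    and c': "\<And>i. c' i \<in> poly_fun j" "G = (\<lambda>z. \<Sum>i\<le>n'::nat. c' i z * z $ j ^ i)" by blast
  let ?P = "\<lambda>i. {(a, b). a \<le> n \<and> b \<le> n' \<and> a + b = i}"
  let ?e = "\<lambda>i z. \<Sum>(a, b)\<in>?P i. c a z * c' b z"
  have fin: "finite (?P i)" for i
    by (rule finite_subset[of _ "{..n} \<times> {..n'}"]) auto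
  have "(\<Sum>i\<le>n + n'. ?e i z * z $ j ^ i) =
      (\<Sum>i\<le>n + n'. \<Sum>ab\<in>?P i. (c (fst ab) z * c' (snd ab) z) * z $ j ^ (fst ab + snd ab))" for z
    by (intro sum.cong refl) (auto simp: sum_distrib_right intro!: sum.cong)
  also have "\<dots> z = (\<Sum>ab\<in>(SIGMA i:{..n + n'}. ?P i). (c (fst (snd ab)) z * c' (snd (snd ab)) z) *
      z $ j ^ (fst (snd ab) + snd (snd ab)))" for z
    using fin by (subst sum.Sigma) (auto intro!: sum.cong)
  also have "\<dots> z = (\<Sum>ab\<in>{..n} \<times> {..n'}. (c (fst ab) z * c' (snd ab) z) * z $ j ^ (fst ab + snd ab))" for z
    by (rule sum.reindex_bij_witness[of _ "\<lambda>(a, b). (a + b, a, b)" snd]) auto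
  also have "\<dots> z = F z * G z" for z
    unfolding c(2) c'(2) sum_product sum.cartesian_product
    by (intro sum.cong) (auto simp: power_add)
  finally have "(\<lambda>z. F z * G z) = (\<lambda>z. \<Sum>i\<le>n + n'. ?e i z * z $ j ^ i)" by simp
  moreover have "?e i \<in> poly_fun j" for i
    unfolding case_prod_beta by (intro poly_fun_sum poly_fun.mult c c')
  ultimately show ?case by (intro exI[of _ "n + n'"] exI[of _ ?e] conjI allI)
qed

subsection \<open>Directional derivatives\<close>

text \<open>A polynomial function carries no expression to differentiate, so its restriction to a
  line is used. In characteristic zero the field is infinite, and \<open>THE\<close> picks out a
  unique polynomial; if \<open>F\<close> is not polynomial along the line, the value is
  arbitrary.\<close>

definition dd :: "('k::field_char_0 vec \<Rightarrow> 'k) \<Rightarrow> 'k vec \<Rightarrow> 'k vec \<Rightarrow> 'k" where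
  "dd F x v = poly (pderiv (THE p. \<forall>t. poly p t = F (x + t \<cdot>\<^sub>v v))) 0"

lemma dd_eqI:
  assumes "\<And>t. poly p t = F (x + t \<cdot>\<^sub>v v)"
  shows "dd F x v = poly (pderiv p) 0"
proof -
  have "(THE p. \<forall>t. poly p t = F (x + t \<cdot>\<^sub>v v)) = p"
    using assms by (intro the_equality) (auto simp flip: poly_eq_poly_eq_iff)
  thus ?thesis by (simp add: dd_def)
qed

lemma dd_const [simp]: "dd (\<lambda>_. c) x v = 0"
  by (subst dd_eqI[of "[:c:]"]) auto

lemma dd_coord:
  assumes "x \<in> carrier_vec m" "v \<in> carrier_vec m" "i < m"
  shows "dd (\<lambda>u. u $ i) x v = v $ i"
  using assms by (subst dd_eqI[of "[:x $ i, v $ i:]"]) (auto simp: mult.commute pderiv_pCons)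

lemma dd_add:
  assumes "F \<in> poly_fun m" "G \<in> poly_fun m" "x \<in> carrier_vec m" "v \<in> carrier_vec m"
  shows "dd (\<lambda>u. F u + G u) x v = dd F x v + dd G x v"
proof -
  obtain p q where "\<forall>t. poly p t = F (x + t \<cdot>\<^sub>v v)" "\<forall>t. poly q t = G (x + t \<cdot>\<^sub>v v)"
    using poly_fun_line assms by metis
  thus ?thesis using dd_eqI[of p F x v] dd_eqI[of q G x v] dd_eqI[of "p + q" "\<lambda>u. F u + G u" x v]
    by (simp add: pderiv_add)
qed

lemma dd_mult:
  assumes "F \<in> poly_fun m" "G \<in> poly_fun m" "x \<in> carrier_vec m" "v \<in> carrier_vec m"
  shows "dd (\<lambda>u. F u * G u) x v = F x * dd G x v + G x * dd F x v"
proof -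
  obtain p q where pq: "\<forall>t. poly p t = F (x + t \<cdot>\<^sub>v v)" "\<forall>t. poly q t = G (x + t \<cdot>\<^sub>v v)"
    using poly_fun_line assms by metis
  have "x + 0 \<cdot>\<^sub>v v = x" using assms by auto
  with pq have "poly p 0 = F x" "poly q 0 = G x" by auto
  thus ?thesis using pq dd_eqI[of p F x v] dd_eqI[of q G x v] dd_eqI[of "p * q" "\<lambda>u. F u * G u" x v]
    by (simp add: pderiv_mult)
qed

lemma dd_cmult:
  assumes "F \<in> poly_fun m" "x \<in> carrier_vec m" "v \<in> carrier_vec m"
  shows "dd (\<lambda>u. c * F u) x v = c * dd F x v"
  using dd_mult[OF poly_fun.const assms(1)] assms by simp

lemma dd_diff:
  assumes "F \<in> poly_fun m" "G \<in> poly_fun m" "x \<in> carrier_vec m" "v \<in> carrier_vec m"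
  shows "dd (\<lambda>u. F u - G u) x v = dd F x v - dd G x v"
  using dd_add[of F m "\<lambda>u. (-1) * G u" x v] dd_cmult[of G m x v "-1"] assms
  by (simp add: poly_fun_uminus)

lemma dd_sum:
  assumes "\<And>i. i \<in> I \<Longrightarrow> F i \<in> poly_fun m" "x \<in> carrier_vec m" "v \<in> carrier_vec m"
  shows "dd (\<lambda>u. \<Sum>i\<in>I. F i u) x v = (\<Sum>i\<in>I. dd (F i) x v)"
  using assms
  by (induction I rule: infinite_finite_induct) (auto simp: dd_add[of _ m] poly_fun_sum)

lemma append_vec_index_left: "x \<in> carrier_vec m \<Longrightarrow> i < m \<Longrightarrow> y \<in> carrier_vec n \<Longrightarrow> (x @\<^sub>v y) $ i = x $ i"
  by simp

lemma append_vec_index_right: "x \<in> carrier_vec m \<Longrightarrow> i < n \<Longrightarrow> y \<in> carrier_vec n \<Longrightarrow> (x @\<^sub>v y) $ (m + i) = y $ i"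
  by simp

lemma poly_fun_append_left:
  fixes F :: "'k::field vec \<Rightarrow> 'k"
  assumes "F \<in> poly_fun m"
  obtains F' where "F' \<in> poly_fun (m + n)"
    "\<And>x y. x \<in> carrier_vec m \<Longrightarrow> y \<in> carrier_vec n \<Longrightarrow> F' (x @\<^sub>v y) = F x"
proof
  show "F \<in> poly_fun (m + n)" using assms by (rule poly_fun_mono) simp
  show "F (x @\<^sub>v y) = F x" if "x \<in> carrier_vec m" "y \<in> carrier_vec n" for x y :: "'k vec"
    using that by (intro poly_fun_cong[OF assms]) auto
qed

lemma poly_fun_append_right:
  fixes F :: "'k::field vec \<Rightarrow> 'k"
  assumes "F \<in> poly_fun n"
  obtains F' where "F' \<in> poly_fun (m + n)"
    "\<And>x y. x \<in> carrier_vec m \<Longrightarrow> y \<in> carrier_vec n \<Longrightarrow> F' (x @\<^sub>v y) = F y"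
proof
  show "(\<lambda>u. F (vec n (\<lambda>i. u $ (m + i)))) \<in> poly_fun (m + n)"
    by (rule poly_fun_compose[OF assms]) (auto intro: poly_fun.intros)
  show "F (vec n (\<lambda>i. (x @\<^sub>v y) $ (m + i))) = F y"
    if "x \<in> carrier_vec m" "y \<in> carrier_vec n" for x y :: "'k vec"
    using that by (intro poly_fun_cong[OF assms]) auto
qed

text \<open>By induction, where products are split as \<open>F x * G x - F y * G y = F x * (G x - G
  y) + G y * (F x - F y)\<close>. The pair \<open>(x, y)\<close> is encoded as
  \<open>x @\<^sub>v y\<close>, so that difference quotients are polynomials in \<open>m + m\<close>
  variables; on the diagonal they are the partial derivatives.\<close>

lemma hadamard:
  fixes F :: "'k::field_char_0 vec \<Rightarrow> 'k"
  assumes "F \<in> poly_fun m"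
  obtains h where "\<And>l. l < m \<Longrightarrow> h l \<in> poly_fun (m + m)"
    "\<And>x y. x \<in> carrier_vec m \<Longrightarrow> y \<in> carrier_vec m \<Longrightarrow>
       F x - F y = (\<Sum>l<m. h l (x @\<^sub>v y) * (x $ l - y $ l))"
    "\<And>x v. x \<in> carrier_vec m \<Longrightarrow> v \<in> carrier_vec m \<Longrightarrow> dd F x v = (\<Sum>l<m. h l (x @\<^sub>v x) * v $ l)"
proof -
  have "\<exists>h. (\<forall>l<m. h l \<in> poly_fun (m + m)) \<and>
      (\<forall>x\<in>carrier_vec m. \<forall>y\<in>carrier_vec m. F x - F y = (\<Sum>l<m. h l (x @\<^sub>v y) * (x $ l - y $ l))) \<and>
      (\<forall>x\<in>carrier_vec m. \<forall>v\<in>carrier_vec m. dd F x v = (\<Sum>l<m. h l (x @\<^sub>v x) * v $ l))"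
    (is "\<exists>h. ?P F h")
    using assms
  proof (induction rule: poly_fun.induct)
    case (const c)
    show ?case by (intro exI[of _ "\<lambda>_ _. 0"]) (auto intro: poly_fun.intros)
  next
    case (coord i)
    have "(\<Sum>l<m. (if l = i then 1 else 0) * f l) = (f i :: 'k)" for f
      using coord by (subst sum.mono_neutral_right[of _ "{i}"]) auto
    with coord show ?case
      by (intro exI[of _ "\<lambda>l _. if l = i then 1 else 0"]) (auto simp: dd_coord intro: poly_fun.intros)
  next
    case (add F G)
    then obtain h h' where h: "?P F h" "?P G h'" by auto
    with h add.hyps show ?case
      by (intro exI[of _ "\<lambda>l u. h l u + h' l u"])
        (simp add: dd_add[of _ m] distrib_right sum.distrib poly_fun.intros add_diff_add)
  next
    case (mult F G)
    then obtain h h' where h: "?P F h" and h': "?P G h'" by auto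
    obtain F' where F': "F' \<in> poly_fun (m + m)"
      "\<And>x y. x \<in> carrier_vec m \<Longrightarrow> y \<in> carrier_vec m \<Longrightarrow> F' (x @\<^sub>v y) = F x"
      using poly_fun_append_left mult.hyps(1) by metis
    obtain G' where G': "G' \<in> poly_fun (m + m)"
      "\<And>x y. x \<in> carrier_vec m \<Longrightarrow> y \<in> carrier_vec m \<Longrightarrow> G' (x @\<^sub>v y) = G y"
      using poly_fun_append_right mult.hyps(2) by metis
    let ?h = "\<lambda>l u. F' u * h' l u + G' u * h l u"
    have "F x * G x - F y * G y = (\<Sum>l<m. ?h l (x @\<^sub>v y) * (x $ l - y $ l))"
      if "x \<in> carrier_vec m" "y \<in> carrier_vec m" for x y
    proof -
      have "F x * G x - F y * G y = F x * (G x - G y) + G y * (F x - F y)"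
        by (simp add: algebra_simps)
      also have "G x - G y = (\<Sum>l<m. h' l (x @\<^sub>v y) * (x $ l - y $ l))" using h' that by blast
      also have "F x - F y = (\<Sum>l<m. h l (x @\<^sub>v y) * (x $ l - y $ l))" using h that by blast
      finally show ?thesis
        using that by (simp add: F' G' sum_distrib_left distrib_right sum.distrib mult.assoc)
    qed
    moreover have "dd (\<lambda>u. F u * G u) x v = (\<Sum>l<m. ?h l (x @\<^sub>v x) * v $ l)"
      if "x \<in> carrier_vec m" "v \<in> carrier_vec m" for x v
      using mult.hyps that h h'
      by (simp add: dd_mult[of _ m] F' G' sum_distrib_left distrib_right sum.distrib mult.assoc)
    ultimately show ?case using F' G' h h'
      by (intro exI[of _ ?h]) (auto intro!: poly_fun.intros)
  qed
  thus thesis using that by blast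
qed

lemma dd_poly_fun:
  fixes F :: "'k::field_char_0 vec \<Rightarrow> 'k"
  assumes "F \<in> poly_fun m" "v \<in> carrier_vec m"
  obtains F' where "F' \<in> poly_fun m" "\<And>x. x \<in> carrier_vec m \<Longrightarrow> F' x = dd F x v"
proof -
  obtain h where h: "\<And>l. l < m \<Longrightarrow> h l \<in> poly_fun (m + m)"
    "\<And>x v. x \<in> carrier_vec m \<Longrightarrow> v \<in> carrier_vec m \<Longrightarrow> dd F x v = (\<Sum>l<m. h l (x @\<^sub>v x) * v $ l)"
    using hadamard[OF assms(1)] by metis
  \<comment> \<open>The pullback of \<open>h l\<close> along the diagonal
    \<open>x \<mapsto> x @\<^sub>v x\<close>, written as a polynomial substitution.\<close>
  let ?h = "\<lambda>l x. h l (vec (m + m) (\<lambda>i. if i < m then x $ i else x $ (i - m)))"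
  have "?h l \<in> poly_fun m" if "l < m" for l
    by (rule poly_fun_compose[OF h(1)[OF that]], case_tac "i < m") (auto intro: poly_fun.intros)
  moreover have "?h l x = h l (x @\<^sub>v x)" if "x \<in> carrier_vec m" "l < m" for l x
    using that by (intro poly_fun_cong[OF h(1)[OF that(2)]]) auto
  ultimately show thesis
    using h(2) assms(2)
    by (intro that[of "\<lambda>x. \<Sum>l<m. ?h l x * v $ l"]) (auto intro!: poly_fun_intros)
qed

text \<open>\<open>dd\<close> is defined one direction at a time; linearity in the direction is
  inherited from the formula of \<open>hadamard\<close>.\<close>

lemma dd_linear_combination:
  fixes F :: "'k::field_char_0 vec \<Rightarrow> 'k"
  assumes "F \<in> poly_fun m" "x \<in> carrier_vec m" "v \<in> carrier_vec m"
  shows "dd F x v = (\<Sum>l<m. dd F x (unit_vec m l) * v $ l)"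
proof -
  obtain h where h: 
    "\<And>x v. x \<in> carrier_vec m \<Longrightarrow> v \<in> carrier_vec m \<Longrightarrow> dd F x v = (\<Sum>l<m. h l (x @\<^sub>v x) * v $ l)"
    using hadamard[OF assms(1)] by metis
  have "dd F x (unit_vec m j) = h j (x @\<^sub>v x)" if "j < m" for j
    using that assms by (subst h, simp, simp, subst sum.mono_neutral_right[of _ "{j}"]) auto
  thus ?thesis using assms by (subst h) (auto intro!: sum.cong)
qed

text \<open>In characteristic zero only constants have derivative zero, and \<open>pderiv\<close>
  lowers a positive degree. So the induction hypothesis applies to \<open>pderiv p\<close> and makes
  \<open>p\<close> constant.\<close>

lemma poly_eq_0_if_higher_pderiv_0:
  fixes p :: "'k::field_char_0 poly"
  assumes "\<And>j. poly ((pderiv ^^ j) p) 0 = 0"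
  shows "p = 0"
  using assms
proof (induction "degree p" arbitrary: p rule: less_induct)
  case less
  show ?case
  proof (cases "degree p = 0")
    case True
    then obtain c where "p = [:c:]" by (meson degree_eq_zeroE)
    with less.prems[of 0] show ?thesis by simp
  next
    case False
    have "poly ((pderiv ^^ j) (pderiv p)) 0 = 0" for j
      using less.prems[of "Suc j"] by (simp del: funpow.simps add: funpow_Suc_right)
    with False have "pderiv p = 0" by (intro less.hyps) (auto simp: degree_pderiv)
    hence "degree p = 0" by (simp add: pderiv_eq_0_iff)
    with False show ?thesis by simp
  qed
qed

text \<open>Taylor expansion at \<open>a\<close> along the line to \<open>b\<close>: each derivative
  of the restriction is the restriction of another element of \<open>V\<close>, hence vanishes at
  \<open>a\<close>. The intended \<open>V\<close> is the set of relations between the coordinates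
  \<open>w\<close>, whose closure under derivatives comes from surjectivity of the differential at
  generic points.\<close>

lemma poly_fun_eq_0_if_dd_closed:
  fixes P :: "'k::field_char_0 vec \<Rightarrow> 'k"
  assumes V: "V \<subseteq> poly_fun m" and P: "P \<in> V"
    and a: "a \<in> carrier_vec m" "\<And>Q. Q \<in> V \<Longrightarrow> Q a = 0"
    and cl: "\<And>Q v. Q \<in> V \<Longrightarrow> v \<in> carrier_vec m \<Longrightarrow> \<exists>Q'\<in>V. \<forall>x\<in>carrier_vec m. Q' x = dd Q x v"
    and b: "b \<in> carrier_vec m"
  shows "P b = 0"
proof -
  define v where "v = b - a"
  have v: "v \<in> carrier_vec m" using a b by (auto simp: v_def)
  obtain p where p: "poly p t = P (a + t \<cdot>\<^sub>v v)" for t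
    using poly_fun_line[of P m a v] V P a v by auto
  have "\<exists>Q\<in>V. \<forall>t. poly ((pderiv ^^ j) p) t = Q (a + t \<cdot>\<^sub>v v)" for j
  proof (induction j)
    case 0
    thus ?case using p P by auto
  next
    case (Suc j)
    then obtain Q where Q: "Q \<in> V" "\<And>t. poly ((pderiv ^^ j) p) t = Q (a + t \<cdot>\<^sub>v v)" by auto
    obtain Q' where Q': "Q' \<in> V" "\<And>x. x \<in> carrier_vec m \<Longrightarrow> Q' x = dd Q x v"
      using cl[OF Q(1) v] by auto
    \<comment> \<open>\<open>dd\<close> differentiates at parameter 0 only; the substitution
      \<open>[:t, 1:]\<close> moves the base point from \<open>a\<close> to
      \<open>a + t v\<close>.\<close>
    have "dd Q (a + t \<cdot>\<^sub>v v) v = poly (pderiv (pcompose ((pderiv ^^ j) p) [:t, 1:])) 0" for t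
    proof (rule dd_eqI)
      fix s
      have "a + t \<cdot>\<^sub>v v + s \<cdot>\<^sub>v v = a + (t + s) \<cdot>\<^sub>v v"
        using a v by (auto simp: add_smult_distrib_vec assoc_add_vec[of _ m])
      thus "poly (pcompose ((pderiv ^^ j) p) [:t, 1:]) s = Q (a + t \<cdot>\<^sub>v v + s \<cdot>\<^sub>v v)"
        using Q(2) by (simp add: poly_pcompose)
    qed
    hence "Q' (a + t \<cdot>\<^sub>v v) = poly ((pderiv ^^ Suc j) p) t" for t
      using Q'(2)[of "a + t \<cdot>\<^sub>v v"] a v by (simp add: pderiv_pcompose poly_pcompose pderiv_pCons)
    thus ?case using Q'(1) by metis
  qed
  moreover have "a + 0 \<cdot>\<^sub>v v = a" using a v by auto
  ultimately have "poly ((pderiv ^^ j) p) 0 = 0" for j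
    using a(2) by metis
  hence "p = 0" by (rule poly_eq_0_if_higher_pderiv_0)
  moreover have "a + 1 \<cdot>\<^sub>v v = b" using a b by (auto simp: v_def)
  ultimately show ?thesis using p[of 1] by simp
qed

section \<open>Regular functions, morphisms and charts\<close>

lemma openin_zariski:
  "openin (zariski m) U \<longleftrightarrow>
     U \<subseteq> carrier_vec m \<and> (\<forall>x\<in>U. \<exists>p\<in>poly_fun m. p x \<noteq> 0 \<and> {v \<in> carrier_vec m. p v \<noteq> 0} \<subseteq> U)"
  (is "?L \<longleftrightarrow> ?R U")
proof
  let ?S = "{{v \<in> carrier_vec m. p v \<noteq> 0} | p. p \<in> poly_fun m} :: 'a vec set set"
  assume ?L
  hence "generate_topology_on ?S U"
    unfolding zariski_def by (rule openin_topology_generated_by)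
  thus "?R U"
  proof induction
    case (Int a b)
    show ?case
    proof (intro conjI ballI)
      show "a \<inter> b \<subseteq> carrier_vec m" using Int.IH by auto
      fix x assume x: "x \<in> a \<inter> b"
      with Int.IH obtain p q where pq: "p \<in> poly_fun m" "p x \<noteq> 0" "{v \<in> carrier_vec m. p v \<noteq> 0} \<subseteq> a"
        "q \<in> poly_fun m" "q x \<noteq> 0" "{v \<in> carrier_vec m. q v \<noteq> 0} \<subseteq> b" by blast
      thus "\<exists>p\<in>poly_fun m. p x \<noteq> 0 \<and> {v \<in> carrier_vec m. p v \<noteq> 0} \<subseteq> a \<inter> b"
        by (intro bexI[of _ "\<lambda>v. p v * q v"]) (auto intro: poly_fun.intros)
    qed
  next
    case (UN K)
    thus ?case by (meson Union_iff Sup_least Sup_upper subset_trans)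
  next
    case (Basis s)
    thus ?case by auto
  qed auto
next
  assume R: "?R U"
  have "\<exists>T. openin (zariski m) T \<and> x \<in> T \<and> T \<subseteq> U" if x: "x \<in> U" for x
  proof -
    obtain p where "p \<in> poly_fun m" "p x \<noteq> 0" "{v \<in> carrier_vec m. p v \<noteq> 0} \<subseteq> U"
      using R x by blast
    moreover from this have "openin (zariski m) {v \<in> carrier_vec m. p v \<noteq> 0}"
      unfolding zariski_def by (intro topology_generated_by_Basis) blast
    moreover have "x \<in> carrier_vec m" using conjunct1[OF R] that by (rule subsetD)
    ultimately show ?thesis by blast
  qed
  thus ?L using openin_subopen by blast
qed

lemma topspace_zariski [simp]: "topspace (zariski m) = carrier_vec m"
proof
  show "topspace (zariski m) \<subseteq> carrier_vec m"
    using openin_topspace[of "zariski m"] unfolding openin_zariski by blast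
  have "openin (zariski m) (carrier_vec m)"
    unfolding openin_zariski by (auto intro!: bexI[of _ "\<lambda>_. 1"] poly_fun.intros)
  thus "carrier_vec m \<subseteq> topspace (zariski m)" by (rule openin_subset)
qed

lemma openin_zariski_nonzero: "p \<in> poly_fun m \<Longrightarrow> openin (zariski m) {v \<in> carrier_vec m. p v \<noteq> 0}"
  unfolding openin_zariski by auto

text \<open>Openness is bundled with regularity, and values outside \<open>U\<close> are ignored, so
  that ordinary expressions can stand where \<open>reg\<close> demands extensional
  functions.\<close>

definition regular_on :: "('a, 'k::field) fspace \<Rightarrow> 'a set \<Rightarrow> ('a \<Rightarrow> 'k) \<Rightarrow> bool" where
  "regular_on X U f \<longleftrightarrow> openin (zar X) U \<and> restrict f U \<in> reg X U"

lemma regular_onD: "regular_on X U f \<Longrightarrow> openin (zar X) U"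
  by (simp add: regular_on_def)

lemma regular_on_cong: "(\<And>x. x \<in> U \<Longrightarrow> f x = g x) \<Longrightarrow> regular_on X U f \<longleftrightarrow> regular_on X U g"
  by (simp add: regular_on_def cong: restrict_cong)

lemma regular_on_eqI: "regular_on X U f \<Longrightarrow> (\<And>x. x \<in> U \<Longrightarrow> f x = g x) \<Longrightarrow> regular_on X U g"
  using regular_on_cong by metis

lemma prevariety_swf: "prevariety X \<Longrightarrow> space_with_functions X"
  by (simp add: prevariety_def)

lemma space_with_functionsD:
  assumes "space_with_functions X" "openin (zar X) U"
  shows "reg X U \<subseteq> extensional U"
    and "(\<lambda>x\<in>U. c) \<in> reg X U"
    and "f \<in> reg X U \<Longrightarrow> g \<in> reg X U \<Longrightarrow> (\<lambda>x\<in>U. f x + g x) \<in> reg X U"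
    and "f \<in> reg X U \<Longrightarrow> g \<in> reg X U \<Longrightarrow> (\<lambda>x\<in>U. f x * g x) \<in> reg X U"
    and "openin (zar X) V \<Longrightarrow> V \<subseteq> U \<Longrightarrow> f \<in> reg X U \<Longrightarrow> restrict f V \<in> reg X V"
    and "f \<in> extensional U \<Longrightarrow>
      (\<And>x. x \<in> U \<Longrightarrow> \<exists>V. openin (zar X) V \<and> x \<in> V \<and> V \<subseteq> U \<and> restrict f V \<in> reg X V) \<Longrightarrow> f \<in> reg X U"
proof -
  note * = mp[OF spec[OF assms(1)[unfolded space_with_functions_def]] assms(2)]
  show "reg X U \<subseteq> extensional U" "(\<lambda>x\<in>U. c) \<in> reg X U" using * by simp_all
  show "(\<lambda>x\<in>U. f x + g x) \<in> reg X U" "(\<lambda>x\<in>U. f x * g x) \<in> reg X U" if "f \<in> reg X U" "g \<in> reg X U"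
    using bspec[OF bspec[OF *[THEN conjunct2, THEN conjunct2, THEN conjunct1] that(1)] that(2)] by simp_all
  show "restrict f V \<in> reg X V" if "openin (zar X) V" "V \<subseteq> U" "f \<in> reg X U"
    using * that by (elim conjE) simp
  show "f \<in> reg X U" if "f \<in> extensional U"
    "\<And>x. x \<in> U \<Longrightarrow> \<exists>V. openin (zar X) V \<and> x \<in> V \<and> V \<subseteq> U \<and> restrict f V \<in> reg X V"
    using * that by (elim conjE) simp
qed

lemma regular_on_const: "space_with_functions X \<Longrightarrow> openin (zar X) U \<Longrightarrow> regular_on X U (\<lambda>_. c)"
  by (simp add: regular_on_def space_with_functionsD(2))

lemma regular_on_add:
  assumes "space_with_functions X" "regular_on X U f" "regular_on X U g"
  shows "regular_on X U (\<lambda>x. f x + g x)"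
proof -
  have "(\<lambda>x\<in>U. restrict f U x + restrict g U x) \<in> reg X U"
    using space_with_functionsD(3)[of X U "restrict f U" "restrict g U"] assms unfolding regular_on_def by blast
  moreover have eq: "(\<lambda>x\<in>U. restrict f U x + restrict g U x) = (\<lambda>x\<in>U. f x + g x)" by auto
  ultimately have "(\<lambda>x\<in>U. f x + g x) \<in> reg X U" unfolding eq by blast
  thus ?thesis using assms(2) unfolding regular_on_def by blast
qed

lemma regular_on_mult:
  assumes "space_with_functions X" "regular_on X U f" "regular_on X U g"
  shows "regular_on X U (\<lambda>x. f x * g x)"
proof -
  have "(\<lambda>x\<in>U. restrict f U x * restrict g U x) \<in> reg X U"
    using space_with_functionsD(4)[of X U "restrict f U" "restrict g U"] assms unfolding regular_on_def by blast
  moreover have eq: "(\<lambda>x\<in>U. restrict f U x * restrict g U x) = (\<lambda>x\<in>U. f x * g x)" by auto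
  ultimately have "(\<lambda>x\<in>U. f x * g x) \<in> reg X U" unfolding eq by blast
  thus ?thesis using assms(2) unfolding regular_on_def by blast
qed

lemma regular_on_subset:
  assumes X: "space_with_functions X" and f: "regular_on X U f" and V: "openin (zar X) V" "V \<subseteq> U"
  shows "regular_on X V f"
proof -
  have "restrict (restrict f U) V \<in> reg X V"
    using space_with_functionsD(5)[OF X _ V, of "restrict f U"] f unfolding regular_on_def by blast
  moreover have "restrict (restrict f U) V = restrict f V" using V(2) by (auto simp: fun_eq_iff)
  ultimately have "restrict f V \<in> reg X V" by metis
  thus ?thesis using V by (simp add: regular_on_def)
qed

lemma regular_on_local:
  assumes swf: "space_with_functions X" and U: "openin (zar X) U"
    and loc: "\<And>x. x \<in> U \<Longrightarrow> \<exists>V. x \<in> V \<and> regular_on X V f"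
  shows "regular_on X U f"
proof -
  have "\<exists>V. openin (zar X) V \<and> x \<in> V \<and> V \<subseteq> U \<and> restrict (restrict f U) V \<in> reg X V" if "x \<in> U" for x
  proof -
    obtain V where V: "x \<in> V" "regular_on X V f" using loc[OF \<open>x \<in> U\<close>] by blast
    have "regular_on X (V \<inter> U) f"
      using V U by (intro regular_on_subset[OF swf V(2)]) (auto simp: regular_on_def)
    moreover have "restrict (restrict f U) (V \<inter> U) = restrict f (V \<inter> U)" by (auto simp: fun_eq_iff)
    ultimately show ?thesis using V that by (intro exI[of _ "V \<inter> U"]) (auto simp: regular_on_def)
  qed
  hence "restrict f U \<in> reg X U"
    using space_with_functionsD(6)[OF swf U restrict_extensional] by blast
  thus ?thesis using U by (simp add: regular_on_def)
qed

lemma regular_on_poly: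
  assumes swf: "space_with_functions X" and "openin (zar X) U"
    and "p \<in> poly_fun m" and w: "\<And>i. i < m \<Longrightarrow> regular_on X U (\<lambda>x. w x $ i)"
  shows "regular_on X U (\<lambda>x. p (w x))"
  using assms(3)
  by (induction rule: poly_fun.induct)
    (auto intro: assms regular_on_const regular_on_add regular_on_mult)

text \<open>The same convention for morphisms on an open subset: there is no
  \<open>extensional\<close> condition and no \<open>open_subspace\<close>, so restriction and
  composition only change the domain. \<open>morph_on_iff\<close> gives the translation.\<close>

definition morph_on :: "('a, 'k::field) fspace \<Rightarrow> 'a set \<Rightarrow> ('b, 'k) fspace \<Rightarrow> ('a \<Rightarrow> 'b) \<Rightarrow> bool" where
  "morph_on X U Y f \<longleftrightarrow> openin (zar X) U \<and> f \<in> U \<rightarrow> points Y \<and>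
     (\<forall>V. openin (zar Y) V \<longrightarrow> openin (zar X) {x \<in> U. f x \<in> V}) \<and>
     (\<forall>V h. regular_on Y V h \<longrightarrow> regular_on X {x \<in> U. f x \<in> V} (\<lambda>x. h (f x)))"

lemma points_open_subspace: "openin (zar X) U \<Longrightarrow> points (open_subspace X U) = U"
  using openin_subset by (fastforce simp: open_subspace_def)

lemma openin_open_subspace:
  "openin (zar X) U \<Longrightarrow> openin (zar (open_subspace X U)) V \<longleftrightarrow> openin (zar X) V \<and> V \<subseteq> U"
  by (simp add: open_subspace_def openin_open_subtopology)

lemma regular_on_reg:
  assumes "space_with_functions Y" "openin (zar Y) V" "h \<in> reg Y V"
  shows "regular_on Y V h"
proof -
  have "h \<in> extensional V" using space_with_functionsD(1)[OF assms(1,2)] assms(3) by blast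
  thus ?thesis using assms by (simp add: regular_on_def extensional_restrict)
qed

lemma morph_on_iff:
  assumes U: "openin (zar X) U" and Y: "space_with_functions Y"
  shows "morphism (open_subspace X U) Y f \<longleftrightarrow> f \<in> extensional U \<and> morph_on X U Y f"
proof -
  let ?U = "\<lambda>V. {x \<in> U. f x \<in> V}"
  have 1: "continuous_map (zar (open_subspace X U)) (zar Y) f \<longleftrightarrow>
     f \<in> U \<rightarrow> points Y \<and> (\<forall>V. openin (zar Y) V \<longrightarrow> openin (zar X) (?U V))"
    using U by (auto simp: continuous_map_def points_open_subspace openin_open_subspace Pi_iff)
  have 2: "compose (?U V) h f = restrict (\<lambda>x. h (f x)) (?U V)" for V and h :: "_ \<Rightarrow> 'b"
    by (auto simp: compose_def)
  have 3: "reg (open_subspace X U) = reg X" by (simp add: open_subspace_def)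
  have 4: "(\<forall>V. openin (zar Y) V \<longrightarrow> (\<forall>h\<in>reg Y V. restrict (\<lambda>x. h (f x)) (?U V) \<in> reg X (?U V))) \<longleftrightarrow>
     (\<forall>V h. regular_on Y V h \<longrightarrow> regular_on X (?U V) (\<lambda>x. h (f x)))"
    if o: "\<forall>V. openin (zar Y) V \<longrightarrow> openin (zar X) (?U V)"
  proof (intro iffI allI impI ballI)
    fix V h
    assume L: "\<forall>V. openin (zar Y) V \<longrightarrow> (\<forall>h\<in>reg Y V. restrict (\<lambda>x. h (f x)) (?U V) \<in> reg X (?U V))"
      and h: "regular_on Y V h"
    have "restrict (\<lambda>x. restrict h V (f x)) (?U V) \<in> reg X (?U V)"
      using L h unfolding regular_on_def by blast
    hence "regular_on X (?U V) (\<lambda>x. restrict h V (f x))"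
      using o h by (auto simp: regular_on_def)
    thus "regular_on X (?U V) (\<lambda>x. h (f x))" by (rule regular_on_eqI) auto
  next
    fix V h
    assume R: "\<forall>V h. regular_on Y V h \<longrightarrow> regular_on X (?U V) (\<lambda>x. h (f x))"
      and h: "openin (zar Y) V" "h \<in> reg Y V"
    show "restrict (\<lambda>x. h (f x)) (?U V) \<in> reg X (?U V)"
      using R regular_on_reg[OF Y h] unfolding regular_on_def by blast
  qed
  let ?O = "\<forall>V. openin (zar Y) V \<longrightarrow> openin (zar X) (?U V)"
  show ?thesis
  proof (cases ?O)
    case True
    show ?thesis
      unfolding morphism_def morph_on_def 1 3 points_open_subspace[OF U] 2 4[OF True]
      by (simp only: True U simp_thms conj_assoc)
  next
    case False
    show ?thesis
      unfolding morphism_def morph_on_def 1 3 points_open_subspace[OF U] 2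
      by (simp only: False simp_thms)
  qed
qed

lemma open_subspace_points: "open_subspace X (points X) = X"
  by (simp add: open_subspace_def)

lemma morphism_iff:
  assumes Y: "space_with_functions Y"
  shows "morphism X Y f \<longleftrightarrow> f \<in> extensional (points X) \<and> morph_on X (points X) Y f"
proof -
  show ?thesis using morph_on_iff[OF _ Y, of X "points X" f] by (simp add: open_subspace_points)
qed

lemma morph_on_openin: "morph_on X U Y f \<Longrightarrow> openin (zar X) U"
  by (simp add: morph_on_def)

lemma morph_on_in: "morph_on X U Y f \<Longrightarrow> x \<in> U \<Longrightarrow> f x \<in> points Y"
  by (auto simp: morph_on_def)

lemma morph_on_vimage: "morph_on X U Y f \<Longrightarrow> openin (zar Y) V \<Longrightarrow> openin (zar X) {x \<in> U. f x \<in> V}"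
  by (simp add: morph_on_def)

lemma morph_on_pullback:
  "morph_on X U Y f \<Longrightarrow> regular_on Y V h \<Longrightarrow> regular_on X {x \<in> U. f x \<in> V} (\<lambda>x. h (f x))"
  by (simp add: morph_on_def)

lemma morph_on_eqI:
  assumes "morph_on X U Y f" "\<And>x. x \<in> U \<Longrightarrow> f x = g x"
  shows "morph_on X U Y g"
proof -
  have *: "{x \<in> U. g x \<in> V} = {x \<in> U. f x \<in> V}" for V using assms(2) by auto
  have "regular_on X {x \<in> U. f x \<in> V} (\<lambda>x. h (g x))" if "regular_on Y V h" for V h
    by (rule regular_on_eqI[OF morph_on_pullback[OF assms(1) that]]) (use assms(2) in auto)
  thus ?thesis using assms unfolding morph_on_def * by (auto simp: Pi_iff)
qed

lemma morph_on_subset: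
  assumes X: "space_with_functions X" and f: "morph_on X U Y f" and V: "openin (zar X) V" "V \<subseteq> U"
  shows "morph_on X V Y f"
proof -
  have *: "{x \<in> V. f x \<in> W} = {x \<in> U. f x \<in> W} \<inter> V" for W using V by auto
  have "regular_on X {x \<in> V. f x \<in> W} (\<lambda>x. h (f x))" if "regular_on Y W h" for W h
  proof (rule regular_on_subset[OF X morph_on_pullback[OF f that]])
    show "openin (zar X) {x \<in> V. f x \<in> W}"
      unfolding * using morph_on_vimage[OF f regular_onD[OF that]] V(1) by (rule openin_Int)
  qed (use V in auto)
  thus ?thesis using f V unfolding morph_on_def by (auto simp: *)
qed

lemma morph_on_compose:
  assumes f: "morph_on X U Y f" and g: "morph_on Y V Z g"
  shows "morph_on X {x \<in> U. f x \<in> V} Z (\<lambda>x. g (f x))"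
proof -
  have *: "{x \<in> {x \<in> U. f x \<in> V}. g (f x) \<in> W} = {x \<in> U. f x \<in> {y \<in> V. g y \<in> W}}" for W by auto
  show ?thesis
    unfolding morph_on_def *
  proof (intro conjI allI impI)
    show "openin (zar X) {x \<in> U. f x \<in> V}"
      using morph_on_vimage[OF f morph_on_openin[OF g]] .
    show "(\<lambda>x. g (f x)) \<in> {x \<in> U. f x \<in> V} \<rightarrow> points Z" using morph_on_in[OF g] by auto
    show "openin (zar X) {x \<in> U. f x \<in> {y \<in> V. g y \<in> W}}" if "openin (zar Z) W" for W
      using morph_on_vimage[OF f morph_on_vimage[OF g that]] .
    show "regular_on X {x \<in> U. f x \<in> {y \<in> V. g y \<in> W}} (\<lambda>x. h (g (f x)))" if "regular_on Z W h" for W h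
      using morph_on_pullback[OF f morph_on_pullback[OF g that]] .
  qed
qed

lemma morph_on_id:
  assumes X: "space_with_functions X" and U: "openin (zar X) U"
  shows "morph_on X U X (\<lambda>x. x)"
  unfolding morph_on_def
proof (intro conjI allI impI)
  show "openin (zar X) U" by (rule U)
  show "(\<lambda>x. x) \<in> U \<rightarrow> points X" using openin_subset[OF U] by auto
  have *: "{x \<in> U. x \<in> V} = U \<inter> V" for V by auto
  show "openin (zar X) {x \<in> U. x \<in> V}" if "openin (zar X) V" for V
    unfolding * using U that by auto
  show "regular_on X {x \<in> U. x \<in> V} h" if "regular_on X V h" for V h
    unfolding * by (rule regular_on_subset[OF X that]) (use U regular_onD[OF that] in auto)
qed

subsection \<open>Affine charts\<close>

definition chart :: "('a, 'k::field) fspace \<Rightarrow> 'a set \<Rightarrow> nat \<Rightarrow> ('a \<Rightarrow> 'k vec) \<Rightarrow> bool" where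
  "chart X V m \<xi> \<longleftrightarrow> openin (zar X) V \<and> \<xi> \<in> V \<rightarrow> carrier_vec m \<and> inj_on \<xi> V \<and>
     (\<forall>i<m. regular_on X V (\<lambda>x. \<xi> x $ i)) \<and>
     (\<forall>p\<in>poly_fun m. openin (zar X) {x \<in> V. p (\<xi> x) \<noteq> 0}) \<and>
     (\<forall>U f x. regular_on X U f \<and> x \<in> U \<and> x \<in> V \<longrightarrow>
        (\<exists>p\<in>poly_fun m. \<exists>q\<in>poly_fun m. q (\<xi> x) \<noteq> 0 \<and>
           (\<forall>z\<in>V. q (\<xi> z) \<noteq> 0 \<longrightarrow> z \<in> U \<and> f z = p (\<xi> z) / q (\<xi> z))))"

lemma chart_openin: "chart X V m \<xi> \<Longrightarrow> openin (zar X) V"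
  unfolding chart_def by (elim conjE)

lemma chart_carrier: "chart X V m \<xi> \<Longrightarrow> x \<in> V \<Longrightarrow> \<xi> x \<in> carrier_vec m"
  unfolding chart_def by (elim conjE) (rule funcset_mem)

lemma chart_inj: "chart X V m \<xi> \<Longrightarrow> inj_on \<xi> V"
  unfolding chart_def by (elim conjE)

lemma chart_coord: "chart X V m \<xi> \<Longrightarrow> i < m \<Longrightarrow> regular_on X V (\<lambda>x. \<xi> x $ i)"
  unfolding chart_def by (elim conjE) simp

lemma chart_nonzero_openin: "chart X V m \<xi> \<Longrightarrow> p \<in> poly_fun m \<Longrightarrow> openin (zar X) {x \<in> V. p (\<xi> x) \<noteq> 0}"
  unfolding chart_def by (elim conjE) (rule bspec[where P = "\<lambda>p. openin (zar X) {x \<in> V. p (\<xi> x) \<noteq> 0}"])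

lemma chart_fraction:
  assumes "chart X V m \<xi>" "regular_on X U f" "x \<in> U" "x \<in> V"
  obtains p q where "p \<in> poly_fun m" "q \<in> poly_fun m" "q (\<xi> x) \<noteq> 0"
    "\<And>z. z \<in> V \<Longrightarrow> q (\<xi> z) \<noteq> 0 \<Longrightarrow> z \<in> U" "\<And>z. z \<in> V \<Longrightarrow> q (\<xi> z) \<noteq> 0 \<Longrightarrow> f z = p (\<xi> z) / q (\<xi> z)"
proof -
  from assms(1) have "\<forall>U f x. regular_on X U f \<and> x \<in> U \<and> x \<in> V \<longrightarrow>
      (\<exists>p\<in>poly_fun m. \<exists>q\<in>poly_fun m. q (\<xi> x) \<noteq> 0 \<and>
         (\<forall>z\<in>V. q (\<xi> z) \<noteq> 0 \<longrightarrow> z \<in> U \<and> f z = p (\<xi> z) / q (\<xi> z)))"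
    unfolding chart_def by (elim conjE)
  with assms(2-4) have "\<exists>p\<in>poly_fun m. \<exists>q\<in>poly_fun m. q (\<xi> x) \<noteq> 0 \<and>
         (\<forall>z\<in>V. q (\<xi> z) \<noteq> 0 \<longrightarrow> z \<in> U \<and> f z = p (\<xi> z) / q (\<xi> z))" by blast
  thus thesis using that by blast
qed

lemma chart_poly:
  "space_with_functions X \<Longrightarrow> chart X V m \<xi> \<Longrightarrow> p \<in> poly_fun m \<Longrightarrow> regular_on X V (\<lambda>x. p (\<xi> x))"
  by (rule regular_on_poly) (auto simp: chart_coord chart_openin)

text \<open>A constant function is regular on \<open>U\<close>; from \<open>chart_fraction\<close>
  only the information about its domain is kept.\<close>

lemma chart_basis:
  assumes "space_with_functions X" "chart X V m \<xi>" "openin (zar X) U" "x \<in> U" "x \<in> V"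
  obtains q where "q \<in> poly_fun m" "q (\<xi> x) \<noteq> 0" "\<And>z. z \<in> V \<Longrightarrow> q (\<xi> z) \<noteq> 0 \<Longrightarrow> z \<in> U"
  using chart_fraction[OF assms(2) regular_on_const[OF assms(1,3), of 0] assms(4,5)] by metis

lemma chart_subset:
  assumes X: "space_with_functions X" and c: "chart X V m \<xi>" and W: "openin (zar X) W" "W \<subseteq> V"
  shows "chart X W m \<xi>"
proof -
  have *: "{x \<in> W. p (\<xi> x) \<noteq> 0} = {x \<in> V. p (\<xi> x) \<noteq> 0} \<inter> W" for p using W by auto
  show ?thesis unfolding chart_def
  proof (intro conjI allI impI ballI, goal_cases)
    case 1 thus ?case by (rule W)
  next
    case 2 thus ?case using chart_carrier[OF c] W by auto
  next
    case 3 thus ?case using chart_inj[OF c] W(2) by (rule inj_on_subset)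
  next
    case (4 i) thus ?case using chart_coord[OF c] W regular_on_subset[OF X] by blast
  next
    case (5 p) thus ?case using chart_nonzero_openin[OF c] W by (auto simp: *)
  next
    case (6 U f x) thus ?case using chart_fraction[OF c, of U f x] W(2)
      by (metis subsetD)
  qed
qed

lemma openin_affine_space_with:
  assumes "Z \<subseteq> carrier_vec m"
  shows "openin (zar (affine_space_with m Z)) U \<longleftrightarrow>
     U \<subseteq> Z \<and> (\<forall>x\<in>U. \<exists>p\<in>poly_fun m. p x \<noteq> 0 \<and> {v \<in> Z. p v \<noteq> 0} \<subseteq> U)" (is "?L \<longleftrightarrow> ?R")
proof
  assume ?L
  then obtain T where "openin (zariski m) T" "U = T \<inter> Z"
    by (auto simp: affine_space_with_def openin_subtopology)
  moreover have "\<exists>p\<in>poly_fun m. p x \<noteq> 0 \<and> {v \<in> Z. p v \<noteq> 0} \<subseteq> U" if x: "x \<in> U" for x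
  proof -
    obtain p where "p \<in> poly_fun m" "p x \<noteq> 0" "{v \<in> carrier_vec m. p v \<noteq> 0} \<subseteq> T"
      using \<open>openin (zariski m) T\<close> \<open>U = T \<inter> Z\<close> x unfolding openin_zariski by blast
    thus ?thesis using assms \<open>U = T \<inter> Z\<close> by (intro bexI[of _ p]) auto
  qed
  ultimately show ?R by blast
next
  assume R: ?R
  have "\<exists>T. openin (zar (affine_space_with m Z)) T \<and> x \<in> T \<and> T \<subseteq> U" if x: "x \<in> U" for x
  proof -
    obtain p where p: "p \<in> poly_fun m" "p x \<noteq> 0" "{v \<in> Z. p v \<noteq> 0} \<subseteq> U"
      using R x by blast
    have "openin (zar (affine_space_with m Z)) ({v \<in> carrier_vec m. p v \<noteq> 0} \<inter> Z)"
      using openin_zariski_nonzero[OF p(1)] by (auto simp: affine_space_with_def openin_subtopology)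
    moreover have "{v \<in> carrier_vec m. p v \<noteq> 0} \<inter> Z = {v \<in> Z. p v \<noteq> 0}" using assms by auto
    moreover have "x \<in> Z" using conjunct1[OF R] that by (rule subsetD)
    ultimately show ?thesis using p by auto
  qed
  thus ?L using openin_subopen by blast
qed

lemma points_affine_space_with: "Z \<subseteq> carrier_vec m \<Longrightarrow> points (affine_space_with m Z) = Z"
  by (auto simp: affine_space_with_def)

lemma exI2: "P a b \<Longrightarrow> \<exists>x y. P x y"
  by blast

lemma reg_affine_space_with:
  "reg (affine_space_with m Z) U = {f \<in> extensional U. \<forall>x\<in>U. \<exists>p q. p \<in> poly_fun m \<and> q \<in> poly_fun m \<and>
               q x \<noteq> 0 \<and> {y \<in> Z. q y \<noteq> 0} \<subseteq> U \<and> (\<forall>y\<in>Z. q y \<noteq> 0 \<longrightarrow> f y = p y / q y)}"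
  by (simp add: affine_space_with_def Bex_def)

text \<open>The affine model supplies one fact that \<open>chart\<close> omits, the regularity of
  quotients \<open>p / q\<close>. It is what makes quotients of regular functions regular in
  \<open>regular_on_divide\<close>, which \<open>space_with_functions\<close> does not
  postulate.\<close>

lemma prevariety_chart_fraction:
  fixes X :: "('a, 'k::field) fspace"
  assumes X: "prevariety X" and x: "x \<in> points X"
  obtains V m \<xi> where "chart X V m \<xi>" "x \<in> V"
    "\<And>p q. p \<in> poly_fun m \<Longrightarrow> q \<in> poly_fun m \<Longrightarrow> regular_on X {x \<in> V. q (\<xi> x) \<noteq> 0} (\<lambda>x. p (\<xi> x) / q (\<xi> x))"
proof -
  note swf = prevariety_swf[OF X]
  obtain V where V: "openin (zar X) V" "x \<in> V" "affine_variety (open_subspace X V)"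
    using X x unfolding prevariety_def by (metis UnionE)
  then obtain m and Z :: "'k vec set" and f g where Z: "closedin (zariski m) Z"
    and f: "morphism (open_subspace X V) (affine_space_with m Z) f"
    and g: "morphism (affine_space_with m Z) (open_subspace X V) g"
    and gf: "\<And>x. x \<in> V \<Longrightarrow> g (f x) = x"
    unfolding affine_variety_def isomorphic_def points_open_subspace[OF V(1)] by metis
  have Zc: "Z \<subseteq> carrier_vec m" using closedin_subset[OF Z] by simp
  let ?A = "affine_space_with m Z"
  have fZ: "f x \<in> Z" if "x \<in> V" for x
    using f that V(1) Zc unfolding morphism_def continuous_map_def
    by (auto simp: points_open_subspace points_affine_space_with)
  have frac: "regular_on X {x \<in> V. q (f x) \<noteq> 0} (\<lambda>x. p (f x) / q (f x))"
    if p: "p \<in> poly_fun m" and q: "q \<in> poly_fun m" for p q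
  proof -
    let ?W = "{z \<in> Z. q z \<noteq> 0}"
    have W: "openin (zar ?A) ?W" unfolding openin_affine_space_with[OF Zc] using q by auto
    have "(\<lambda>z\<in>?W. p z / q z) \<in> reg ?A ?W" unfolding reg_affine_space_with using p q by auto
    with f W have 1: "compose {x \<in> V. f x \<in> ?W} (\<lambda>z\<in>?W. p z / q z) f \<in> reg X {x \<in> V. f x \<in> ?W}"
      unfolding morphism_def points_open_subspace[OF V(1)]
      by (auto simp: open_subspace_def)
    have 2: "{x \<in> V. f x \<in> ?W} = {x \<in> V. q (f x) \<noteq> 0}" using fZ by auto
    have 3: "compose {x \<in> V. f x \<in> ?W} (\<lambda>z\<in>?W. p z / q z) f = (\<lambda>x\<in>{x \<in> V. q (f x) \<noteq> 0}. p (f x) / q (f x))"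
      using fZ by (auto simp: compose_def fun_eq_iff)
    have "openin (zar (open_subspace X V)) {x \<in> points (open_subspace X V). f x \<in> ?W}"
      using f W unfolding morphism_def continuous_map_def by blast
    hence "openin (zar X) {x \<in> V. f x \<in> ?W}"
      using V(1) by (simp add: points_open_subspace openin_open_subspace)
    thus ?thesis using 1 unfolding 3 unfolding 2 by (simp add: regular_on_def)
  qed
  have "chart X V m f" unfolding chart_def
  proof (intro conjI allI impI ballI, goal_cases)
    case 1 show ?case by (rule V)
  next
    case 2 show ?case using fZ Zc by auto
  next
    case 3 show ?case using gf by (rule inj_on_inverseI)
  next
    case (4 i) show ?case using frac[of "\<lambda>v. v $ i" "\<lambda>_. 1"] \<open>i < m\<close> by (auto intro: poly_fun.intros)
  next
    case (5 p) show ?case using frac[of p p] 5 by (auto dest: regular_onD)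
  next
    case (6 U h x)
    hence h: "regular_on X U h" and xU: "x \<in> U" and xV: "x \<in> V" by auto
    have "regular_on X (U \<inter> V) h"
      by (rule regular_on_subset[OF swf h]) (use V(1) regular_onD[OF h] in auto)
    hence r: "openin (zar (open_subspace X V)) (U \<inter> V)" "restrict h (U \<inter> V) \<in> reg (open_subspace X V) (U \<inter> V)"
      using V(1) by (auto simp: regular_on_def openin_open_subspace) (auto simp: open_subspace_def)
    let ?W = "{z \<in> Z. g z \<in> U \<inter> V}"
    have "compose ?W (restrict h (U \<inter> V)) g \<in> reg ?A ?W"
      using g r unfolding morphism_def points_affine_space_with[OF Zc] by blast
    moreover have "f x \<in> ?W" using xU xV fZ gf by auto
    ultimately obtain p q where pq: "p \<in> poly_fun m" "q \<in> poly_fun m" "q (f x) \<noteq> 0"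
      "{y \<in> Z. q y \<noteq> 0} \<subseteq> ?W" "\<forall>y\<in>Z. q y \<noteq> 0 \<longrightarrow> compose ?W (restrict h (U \<inter> V)) g y = p y / q y"
      unfolding reg_affine_space_with by blast
    have "z \<in> U \<and> h z = p (f z) / q (f z)" if "z \<in> V" "q (f z) \<noteq> 0" for z
    proof -
      have "f z \<in> ?W" using pq(4) that fZ by auto
      thus ?thesis using pq(5) that fZ gf by (auto simp: compose_def split: if_splits)
    qed
    thus ?case using pq by blast
  qed
  thus thesis using V(2) frac that by blast
qed

text \<open>Near a point \<open>f\<close> is a quotient \<open>p / q\<close> in a chart, and the
  locus where \<open>p * q\<close> is nonzero is open there. This openness is not among the axioms
  of \<open>space_with_functions\<close>.\<close>

lemma regular_on_nonzero_openin:
  assumes X: "prevariety X" and f: "regular_on X U f"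
  shows "openin (zar X) {x \<in> U. f x \<noteq> 0}"
proof (subst openin_subopen, rule ballI)
  fix x assume x: "x \<in> {x \<in> U. f x \<noteq> 0}"
  have "x \<in> points X" using x openin_subset[OF regular_onD[OF f]] by auto
  then obtain V m \<xi> where V: "chart X V m \<xi>" "x \<in> V" using prevariety_chart_fraction[OF X] by metis
  obtain p q where pq: "p \<in> poly_fun m" "q \<in> poly_fun m" "q (\<xi> x) \<noteq> 0"
    "\<And>z. z \<in> V \<Longrightarrow> q (\<xi> z) \<noteq> 0 \<Longrightarrow> z \<in> U" "\<And>z. z \<in> V \<Longrightarrow> q (\<xi> z) \<noteq> 0 \<Longrightarrow> f z = p (\<xi> z) / q (\<xi> z)"
    using chart_fraction[OF V(1) f _ V(2)] x by auto
  have "openin (zar X) {z \<in> V. p (\<xi> z) * q (\<xi> z) \<noteq> 0}"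
    by (rule chart_nonzero_openin[OF V(1)]) (intro poly_fun.intros pq)
  thus "\<exists>T. openin (zar X) T \<and> x \<in> T \<and> T \<subseteq> {x \<in> U. f x \<noteq> 0}"
    using x V pq by (intro exI[of _ "{z \<in> V. p (\<xi> z) * q (\<xi> z) \<noteq> 0}"]) auto
qed

lemma regular_on_divide:
  assumes X: "prevariety X" and f: "regular_on X U f" and g: "regular_on X U g"
    and g0: "\<And>x. x \<in> U \<Longrightarrow> g x \<noteq> 0"
  shows "regular_on X U (\<lambda>x. f x / g x)"
proof (rule regular_on_local[OF prevariety_swf[OF X] regular_onD[OF f]])
  fix x assume x: "x \<in> U"
  have "x \<in> points X" using x openin_subset[OF regular_onD[OF f]] by auto
  then obtain V m \<xi> where V: "chart X V m \<xi>" "x \<in> V" and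
    frac: "\<And>p q. p \<in> poly_fun m \<Longrightarrow> q \<in> poly_fun m \<Longrightarrow>
      regular_on X {x \<in> V. q (\<xi> x) \<noteq> 0} (\<lambda>x. p (\<xi> x) / q (\<xi> x))"
    by (rule prevariety_chart_fraction[OF X]) (rule that)
  obtain p q where pq: "p \<in> poly_fun m" "q \<in> poly_fun m" "q (\<xi> x) \<noteq> 0"
    "\<And>z. z \<in> V \<Longrightarrow> q (\<xi> z) \<noteq> 0 \<Longrightarrow> z \<in> U" "\<And>z. z \<in> V \<Longrightarrow> q (\<xi> z) \<noteq> 0 \<Longrightarrow> f z = p (\<xi> z) / q (\<xi> z)"
    using chart_fraction[OF V(1) f x V(2)] by metis
  obtain r s where rs: "r \<in> poly_fun m" "s \<in> poly_fun m" "s (\<xi> x) \<noteq> 0"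
    "\<And>z. z \<in> V \<Longrightarrow> s (\<xi> z) \<noteq> 0 \<Longrightarrow> z \<in> U" "\<And>z. z \<in> V \<Longrightarrow> s (\<xi> z) \<noteq> 0 \<Longrightarrow> g z = r (\<xi> z) / s (\<xi> z)"
    using chart_fraction[OF V(1) g x V(2)] by metis
  \<comment> \<open>The quotient of \<open>p / q\<close> by \<open>r / s\<close> is written with an
    additional factor \<open>s\<close>, so that its denominator \<open>q * (r * s)\<close> cuts out
    exactly the set where all three factors are nonzero.\<close>
  let ?W = "{z \<in> V. q (\<xi> z) * (r (\<xi> z) * s (\<xi> z)) \<noteq> 0}"
  have "regular_on X ?W (\<lambda>x. p (\<xi> x) * (s (\<xi> x) * s (\<xi> x)) / (q (\<xi> x) * (r (\<xi> x) * s (\<xi> x))))"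
    by (rule frac) (intro poly_fun.intros pq rs)+
  hence "regular_on X ?W (\<lambda>x. f x / g x)"
    by (rule regular_on_eqI) (auto simp: pq rs)
  moreover have "x \<in> ?W" using x V pq rs g0[OF x] by auto
  ultimately show "\<exists>V. x \<in> V \<and> regular_on X V (\<lambda>x. f x / g x)" by (intro exI[of _ ?W] conjI)
qed

text \<open>The old quotients still represent every regular function; they are merely read from the
  last \<open>m\<close> entries. Extended charts turn relations between \<open>w\<close> and
  \<open>\<xi>\<close> into polynomials vanishing on the chart, and the new coordinates come first,
  ready for elimination.\<close>

lemma chart_extend:
  fixes X :: "('a, 'k::field) fspace"
  assumes X: "prevariety X" and c: "chart X V m \<xi>" and w: "\<And>x. x \<in> V \<Longrightarrow> w x \<in> carrier_vec d"
    and r: "\<And>i. i < d \<Longrightarrow> regular_on X V (\<lambda>x. w x $ i)"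
  shows "chart X V (d + m) (\<lambda>x. w x @\<^sub>v \<xi> x)"
proof -
  note swf = prevariety_swf[OF X]
  have coord: "regular_on X V (\<lambda>x. (w x @\<^sub>v \<xi> x) $ i)" if "i < d + m" for i
  proof (cases "i < d")
    case True
    show ?thesis
      by (rule regular_on_eqI[OF r[OF True]]) (metis append_vec_index_left True w chart_carrier[OF c])
  next
    case False
    hence "regular_on X V (\<lambda>x. \<xi> x $ (i - d))" using that by (intro chart_coord[OF c]) auto
    thus ?thesis
    proof (rule regular_on_eqI)
      fix x assume x: "x \<in> V"
      have "(w x @\<^sub>v \<xi> x) $ (d + (i - d)) = \<xi> x $ (i - d)"
        using False that by (intro append_vec_index_right[OF w[OF x] _ chart_carrier[OF c x]]) auto
      thus "\<xi> x $ (i - d) = (w x @\<^sub>v \<xi> x) $ i" using False by simp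
    qed
  qed
  show ?thesis unfolding chart_def
  proof (intro conjI allI impI ballI, goal_cases)
    case 1 show ?case by (rule chart_openin[OF c])
  next
    case 2 show ?case using chart_carrier[OF c] w by auto
  next
    case 3 
    show ?case
    proof (rule inj_onI)
      fix x y assume xy: "x \<in> V" "y \<in> V" "w x @\<^sub>v \<xi> x = w y @\<^sub>v \<xi> y"
      hence "\<xi> x = \<xi> y" using w[of x] w[of y] by (metis append_vec_eq)
      thus "x = y" using xy chart_inj[OF c] by (auto dest: inj_onD)
    qed
  next
    case (4 i) thus ?case by (rule coord)
  next
    case (5 p) 
    show ?case
      by (rule regular_on_nonzero_openin[OF X])
        (rule regular_on_poly[OF swf chart_openin[OF c] \<open>p \<in> _\<close> coord])
  next
    case (6 U f x)
    then obtain p q where pq: "p \<in> poly_fun m" "q \<in> poly_fun m" "q (\<xi> x) \<noteq> 0"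
      "\<And>z. z \<in> V \<Longrightarrow> q (\<xi> z) \<noteq> 0 \<Longrightarrow> z \<in> U" "\<And>z. z \<in> V \<Longrightarrow> q (\<xi> z) \<noteq> 0 \<Longrightarrow> f z = p (\<xi> z) / q (\<xi> z)"
      using chart_fraction[OF c, of U f x] by metis
    obtain p' where p': "p' \<in> poly_fun (d + m)"
      "\<And>x y. x \<in> carrier_vec d \<Longrightarrow> y \<in> carrier_vec m \<Longrightarrow> p' (x @\<^sub>v y) = p y"
      using poly_fun_append_right[OF pq(1)] by metis
    obtain q' where q': "q' \<in> poly_fun (d + m)"
      "\<And>x y. x \<in> carrier_vec d \<Longrightarrow> y \<in> carrier_vec m \<Longrightarrow> q' (x @\<^sub>v y) = q y"
      using poly_fun_append_right[OF pq(2)] by metis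
    show ?case
      by (rule bexI[OF _ p'(1)], rule bexI[OF _ q'(1)])
        (use 6 pq p'(2) q'(2) w chart_carrier[OF c] in auto)
  qed
qed

subsection \<open>Morphisms into affine space and separatedness\<close>

lemma morph_on_affine:
  assumes X: "prevariety X" and U: "openin (zar X) U" and w: "\<And>x. x \<in> U \<Longrightarrow> w x \<in> carrier_vec n"
    and r: "\<And>i. i < n \<Longrightarrow> regular_on X U (\<lambda>x. w x $ i)"
  shows "morph_on X U (affine_space n) w"
  unfolding morph_on_def
proof (intro conjI allI impI)
  note swf = prevariety_swf[OF X]
  have poly: "regular_on X U (\<lambda>x. p (w x))" if "p \<in> poly_fun n" for p
    using regular_on_poly[OF swf U that r] .
  show "openin (zar X) U" by fact
  show "w \<in> U \<rightarrow> points (affine_space n)" using w by (auto simp: points_affine_space_with)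
  fix V :: "'b vec set"
  show op: "openin (zar X) {x \<in> U. w x \<in> V}" if V: "openin (zar (affine_space n)) V"
  proof (subst openin_subopen, rule ballI)
    fix x assume x: "x \<in> {x \<in> U. w x \<in> V}"
    then obtain p where p: "p \<in> poly_fun n" "p (w x) \<noteq> 0" "{v \<in> carrier_vec n. p v \<noteq> 0} \<subseteq> V"
      using V unfolding openin_affine_space_with[OF order_refl] by blast
    have "openin (zar X) {x \<in> U. p (w x) \<noteq> 0}"
      by (rule regular_on_nonzero_openin[OF X poly[OF p(1)]])
    thus "\<exists>T. openin (zar X) T \<and> x \<in> T \<and> T \<subseteq> {x \<in> U. w x \<in> V}"
      using p x w by (intro exI[of _ "{x \<in> U. p (w x) \<noteq> 0}"]) auto
  qed
  fix h assume h: "regular_on (affine_space n) V h"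
  show "regular_on X {x \<in> U. w x \<in> V} (\<lambda>x. h (w x))"
  proof (rule regular_on_local[OF swf op])
    show "openin (zar (affine_space n)) V" using h by (rule regular_onD)
    fix x assume x: "x \<in> {x \<in> U. w x \<in> V}"
    then obtain p q where pq: "p \<in> poly_fun n" "q \<in> poly_fun n" "q (w x) \<noteq> 0"
      "{y \<in> carrier_vec n. q y \<noteq> 0} \<subseteq> V" "\<forall>y\<in>carrier_vec n. q y \<noteq> 0 \<longrightarrow> restrict h V y = p y / q y"
      using h unfolding regular_on_def reg_affine_space_with by blast
    let ?W = "{x \<in> U. q (w x) \<noteq> 0}"
    have W: "openin (zar X) ?W" by (rule regular_on_nonzero_openin[OF X poly[OF pq(2)]])
    have "regular_on X ?W (\<lambda>x. p (w x) / q (w x))"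
      by (rule regular_on_divide[OF X]) (auto intro!: regular_on_subset[OF swf poly] pq W)
    hence "regular_on X ?W (\<lambda>x. h (w x))"
    proof (rule regular_on_eqI)
      fix x assume x: "x \<in> ?W"
      hence "w x \<in> V" using pq(4) w by auto
      thus "p (w x) / q (w x) = h (w x)" using pq(5) x w by auto
    qed
    thus "\<exists>V'. x \<in> V' \<and> regular_on X V' (\<lambda>x. h (w x))" using x pq by (intro exI[of _ ?W]) auto
  qed
qed

lemma regular_on_affine_poly:
  assumes "p \<in> poly_fun n"
  shows "regular_on (affine_space n) (carrier_vec n) p"
proof -
  have "openin (zar (affine_space n)) (carrier_vec n)"
    unfolding openin_affine_space_with[OF order_refl] by (auto intro!: bexI[of _ "\<lambda>_. 1"] poly_fun.intros)
  moreover have "restrict p (carrier_vec n) \<in> reg (affine_space n) (carrier_vec n)"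
    unfolding reg_affine_space_with
    by (intro CollectI conjI ballI exI2[of _ p "\<lambda>_. 1"] poly_fun.const assms) auto
  ultimately show ?thesis by (simp add: regular_on_def)
qed

lemma prevariety_affine_space: "prevariety (affine_space n :: ('k::field vec, 'k) fspace)"
proof -
  let ?A = "affine_space n :: ('k vec, 'k) fspace"
  note op = openin_affine_space_with[of "carrier_vec n" n, OF order_refl]
  have all: "openin (zar ?A) (carrier_vec n)"
    unfolding op by (auto intro!: bexI[of _ "\<lambda>_. 1"] poly_fun.intros)
  have basic: "\<exists>p\<in>poly_fun n. p x \<noteq> 0 \<and> {y \<in> carrier_vec n. p y \<noteq> 0} \<subseteq> U"
    if "openin (zar ?A) U" "x \<in> U" for U x
    using that unfolding op by blast
  have swf: "space_with_functions ?A"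
    unfolding space_with_functions_def
  proof (intro allI impI conjI ballI, goal_cases)
    case (1 U) show ?case by (auto simp: reg_affine_space_with)
  next
    case (2 U c)
    show ?case unfolding reg_affine_space_with
    proof (intro CollectI conjI ballI)
      fix x assume "x \<in> U"
      with basic[OF 2] obtain q where "q \<in> poly_fun n" "q x \<noteq> 0" "{y \<in> carrier_vec n. q y \<noteq> 0} \<subseteq> U" by blast
      \<comment> \<open>The constant is written as \<open>c * q / q\<close>, because the denominator
        must also cut out a neighbourhood inside \<open>U\<close>.\<close>
      thus "\<exists>p q. p \<in> poly_fun n \<and> q \<in> poly_fun n \<and> q x \<noteq> 0 \<and> {y \<in> carrier_vec n. q y \<noteq> 0} \<subseteq> U \<and>
          (\<forall>y\<in>carrier_vec n. q y \<noteq> 0 \<longrightarrow> (\<lambda>x\<in>U. c) y = p y / q y)"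
        by (intro exI2[of _ "\<lambda>v. c * q v" q]) (auto intro: poly_fun.intros)
    qed auto
  next
    case (3 U f g)
    show ?case unfolding reg_affine_space_with
    proof (intro CollectI conjI ballI)
      fix x assume "x \<in> U"
      with 3 obtain p q r s where "p \<in> poly_fun n" "q \<in> poly_fun n" "q x \<noteq> 0" "{y \<in> carrier_vec n. q y \<noteq> 0} \<subseteq> U"
        "\<forall>y\<in>carrier_vec n. q y \<noteq> 0 \<longrightarrow> f y = p y / q y"
        "r \<in> poly_fun n" "s \<in> poly_fun n" "s x \<noteq> 0" "{y \<in> carrier_vec n. s y \<noteq> 0} \<subseteq> U"
        "\<forall>y\<in>carrier_vec n. s y \<noteq> 0 \<longrightarrow> g y = r y / s y"
        unfolding reg_affine_space_with by blast
      thus "\<exists>p q. p \<in> poly_fun n \<and> q \<in> poly_fun n \<and> q x \<noteq> 0 \<and> {y \<in> carrier_vec n. q y \<noteq> 0} \<subseteq> U \<and>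
          (\<forall>y\<in>carrier_vec n. q y \<noteq> 0 \<longrightarrow> (\<lambda>x\<in>U. f x + g x) y = p y / q y)"
        by (intro exI2[of _ "\<lambda>v. p v * s v + r v * q v" "\<lambda>v. q v * s v"])
          (auto intro!: poly_fun.intros simp: add_frac_eq)
    qed auto
  next
    case (4 U f g)
    show ?case unfolding reg_affine_space_with
    proof (intro CollectI conjI ballI)
      fix x assume "x \<in> U"
      with 4 obtain p q r s where "p \<in> poly_fun n" "q \<in> poly_fun n" "q x \<noteq> 0" "{y \<in> carrier_vec n. q y \<noteq> 0} \<subseteq> U"
        "\<forall>y\<in>carrier_vec n. q y \<noteq> 0 \<longrightarrow> f y = p y / q y"
        "r \<in> poly_fun n" "s \<in> poly_fun n" "s x \<noteq> 0" "{y \<in> carrier_vec n. s y \<noteq> 0} \<subseteq> U"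
        "\<forall>y\<in>carrier_vec n. s y \<noteq> 0 \<longrightarrow> g y = r y / s y"
        unfolding reg_affine_space_with by blast
      thus "\<exists>p q. p \<in> poly_fun n \<and> q \<in> poly_fun n \<and> q x \<noteq> 0 \<and> {y \<in> carrier_vec n. q y \<noteq> 0} \<subseteq> U \<and>
          (\<forall>y\<in>carrier_vec n. q y \<noteq> 0 \<longrightarrow> (\<lambda>x\<in>U. f x * g x) y = p y / q y)"
        by (intro exI2[of _ "\<lambda>v. p v * r v" "\<lambda>v. q v * s v"])
          (auto intro!: poly_fun.intros)
    qed auto
  next
    case (5 U V f)
    show ?case unfolding reg_affine_space_with
    proof (intro CollectI conjI ballI)
      fix x assume "x \<in> V"
      \<comment> \<open>Multiplying numerator and denominator by \<open>s\<close> shrinks the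
        nonvanishing locus of the denominator into \<open>V\<close> without changing the
        quotient.\<close>
      moreover obtain s where "s \<in> poly_fun n" "s x \<noteq> 0" "{y \<in> carrier_vec n. s y \<noteq> 0} \<subseteq> V"
        using basic[of V x] 5 \<open>x \<in> V\<close> by blast
      moreover obtain p q where "p \<in> poly_fun n" "q \<in> poly_fun n" "q x \<noteq> 0" "{y \<in> carrier_vec n. q y \<noteq> 0} \<subseteq> U"
        "\<forall>y\<in>carrier_vec n. q y \<noteq> 0 \<longrightarrow> f y = p y / q y"
        using 5 \<open>x \<in> V\<close> unfolding reg_affine_space_with by blast
      ultimately show "\<exists>p q. p \<in> poly_fun n \<and> q \<in> poly_fun n \<and> q x \<noteq> 0 \<and> {y \<in> carrier_vec n. q y \<noteq> 0} \<subseteq> V \<and>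
          (\<forall>y\<in>carrier_vec n. q y \<noteq> 0 \<longrightarrow> restrict f V y = p y / q y)"
        by (intro exI2[of _ "\<lambda>v. p v * s v" "\<lambda>v. q v * s v"])
          (auto intro!: poly_fun.intros)
    qed auto
  next
    case (6 U f)
    show ?case unfolding reg_affine_space_with
    proof (intro CollectI conjI ballI)
      fix x assume "x \<in> U"
      then obtain V where V: "openin (zar ?A) V" "x \<in> V" "V \<subseteq> U" "restrict f V \<in> reg ?A V" using 6 by blast
      then obtain p q where "p \<in> poly_fun n" "q \<in> poly_fun n" "q x \<noteq> 0" "{y \<in> carrier_vec n. q y \<noteq> 0} \<subseteq> V"
        "\<forall>y\<in>carrier_vec n. q y \<noteq> 0 \<longrightarrow> restrict f V y = p y / q y"
        unfolding reg_affine_space_with by blast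
      moreover have "f y = p y / q y" if "y \<in> carrier_vec n" "q y \<noteq> 0" for y
        using calculation(4,5) that by (auto simp: subset_iff)
      ultimately show "\<exists>p q. p \<in> poly_fun n \<and> q \<in> poly_fun n \<and> q x \<noteq> 0 \<and> {y \<in> carrier_vec n. q y \<noteq> 0} \<subseteq> U \<and>
          (\<forall>y\<in>carrier_vec n. q y \<noteq> 0 \<longrightarrow> f y = p y / q y)"
        using V(3) by (intro exI2[of _ p q]) auto
    qed (use 6 in auto)
  qed
  have sub: "open_subspace ?A (carrier_vec n) = ?A"
    using open_subspace_points[of ?A] points_affine_space_with[OF order_refl, of n] by metis
  have "morphism ?A ?A (\<lambda>x\<in>carrier_vec n. x)"
    unfolding morphism_iff[OF swf] points_affine_space_with[OF order_refl]
    using morph_on_eqI[OF morph_on_id[OF swf all], of "\<lambda>x\<in>carrier_vec n. x"] by auto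
  hence "isomorphic ?A ?A"
    unfolding isomorphic_def points_affine_space_with[OF order_refl]
    by (intro exI[of _ "\<lambda>x\<in>carrier_vec n. x"]) auto
  moreover have "closedin (zariski n :: 'k vec topology) (carrier_vec n)"
    using closedin_topspace[of "zariski n"] by simp
  ultimately have "affine_variety ?A" unfolding affine_variety_def by blast
  thus ?thesis unfolding prevariety_def
    using swf all sub points_affine_space_with[OF order_refl, of n]
    by (intro conjI exI[of _ "{carrier_vec n}"]) auto
qed

section \<open>Products, the diagonal and separatedness\<close>

lemma tensor_funI:
  assumes "\<And>i. i < (N::nat) \<Longrightarrow> f i \<in> reg X U" "\<And>i. i < N \<Longrightarrow> g i \<in> reg Y V"
  shows "(\<lambda>(x, y). \<Sum>i<N. f i x * g i y) \<in> tensor_fun X Y U V"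
  unfolding tensor_fun_def using assms
  by (intro CollectI exI[of _ N] exI[of _ f] exI[of _ g]) auto

lemma openin_prod_space_generator:
  assumes "openin (zar X) U" "openin (zar Y) V" "t \<in> tensor_fun X Y U V"
  shows "openin (zar (prod_space X Y)) {z \<in> U \<times> V. t z \<noteq> 0}"
  using assms unfolding prod_space_def by (auto intro!: topology_generated_by_Basis)

lemma topspace_prod_space:
  assumes "space_with_functions X" "space_with_functions Y"
  shows "topspace (zar (prod_space X Y)) = points X \<times> points Y"
proof
  show "topspace (zar (prod_space X Y)) \<subseteq> points X \<times> points Y"
    unfolding prod_space_def by (auto simp: topology_generated_by_topspace dest: openin_subset)
  have "(\<lambda>x\<in>points X. 1) \<in> reg X (points X)" "(\<lambda>y\<in>points Y. 1) \<in> reg Y (points Y)"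
    using assms regular_on_const[of _ "points _" 1] by (auto simp: regular_on_def)
  hence t: "(\<lambda>(x, y). \<Sum>i<1::nat. (\<lambda>x\<in>points X. 1) x * (\<lambda>y\<in>points Y. 1) y) \<in> tensor_fun X Y (points X) (points Y)"
    by (rule tensor_funI)
  show "points X \<times> points Y \<subseteq> topspace (zar (prod_space X Y))"
    using openin_subset[OF openin_prod_space_generator[OF _ _ t]] by auto
qed

lemma variety_affine_space: "variety (affine_space n :: ('k::field vec, 'k) fspace)"
proof -
  let ?A = "affine_space n :: ('k vec, 'k) fspace"
  note swf = prevariety_swf[OF prevariety_affine_space[of n, where 'k='k]]
  note pts = points_affine_space_with[OF order_refl, of n]
  have "openin (zar (prod_space ?A ?A)) (carrier_vec n \<times> carrier_vec n - Id_on (carrier_vec n))"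
  proof (subst openin_subopen, rule ballI)
    fix z assume "z \<in> carrier_vec n \<times> carrier_vec n - Id_on (carrier_vec n :: 'k vec set)"
    then obtain x y where z: "z = (x, y)" "x \<in> carrier_vec n" "y \<in> carrier_vec n" "x \<noteq> y" by auto
    then obtain i where i: "i < n" "x $ i \<noteq> y $ i" by (metis carrier_vecD eq_vecI)
    let ?c = "\<lambda>p. restrict p (carrier_vec n)"
    \<comment> \<open>The tensor \<open>x $ i * 1 + 1 * (- y $ i)\<close> is nonzero at the given
      pair and zero on the diagonal.\<close>
    let ?f = "\<lambda>l::nat. if l = 0 then ?c (\<lambda>v. v $ i) else ?c (\<lambda>_. 1)"
    let ?g = "\<lambda>l::nat. if l = 0 then ?c (\<lambda>_. 1) else ?c (\<lambda>v. - v $ i)"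
    have c: "?c p \<in> reg ?A (carrier_vec n)" if "p \<in> poly_fun n" for p
      using regular_on_affine_poly[OF that] by (simp add: regular_on_def)
    have "?f l \<in> reg ?A (carrier_vec n)" "?g l \<in> reg ?A (carrier_vec n)" for l
      using i by (auto intro!: c poly_fun_intros)
    hence t: "(\<lambda>(x, y). \<Sum>l<2::nat. ?f l x * ?g l y) \<in> tensor_fun ?A ?A (carrier_vec n) (carrier_vec n)"
      by (rule tensor_funI)
    have all: "openin (zar ?A) (carrier_vec n)"
      using regular_onD[OF regular_on_affine_poly[OF poly_fun.const]] .
    show "\<exists>T. openin (zar (prod_space ?A ?A)) T \<and> z \<in> T \<and> T \<subseteq> carrier_vec n \<times> carrier_vec n - Id_on (carrier_vec n)"
      by (rule exI, rule conjI[OF openin_prod_space_generator[OF all all t]])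
        (use z i in \<open>auto simp: numeral_2_eq_2\<close>)
  qed
  thus ?thesis
    unfolding variety_def closedin_def topspace_prod_space[OF swf swf] pts
    using prevariety_affine_space by auto
qed

text \<open>Here separatedness is put to use: the set is the preimage of the complement of the
  diagonal under \<open>(f, g)\<close>. Continuity is checked on the generators of the product
  topology, where a tensor pulls back to a sum of products of regular functions.\<close>

lemma equalizer_openin:
  assumes X: "prevariety X" and Z: "variety Z" and f: "morph_on X U Z f" and g: "morph_on X U Z g"
  shows "openin (zar X) {x \<in> U. f x \<noteq> g x}"
proof -
  note swf = prevariety_swf[OF X]
  have Zs: "space_with_functions Z" using Z by (simp add: variety_def prevariety_def)
  note U = morph_on_openin[OF f]
  let ?P = "zar (prod_space Z Z)" and ?S = "{{z \<in> U \<times> V. t z \<noteq> 0} | U V t.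
           openin (zar Z) U \<and> openin (zar Z) V \<and> t \<in> tensor_fun Z Z U V}"
  have "continuous_map (subtopology (zar X) U) (topology_generated_by ?S) (\<lambda>x. (f x, g x))"
  proof (rule continuous_on_generated_topo)
    fix T assume "T \<in> ?S"
    then obtain A B N a b where T: "T = {z \<in> A \<times> B. (case z of (x, y) \<Rightarrow> \<Sum>i<N. a i x * b i y) \<noteq> 0}"
      and A: "openin (zar Z) A" and B: "openin (zar Z) B"
      and ab: "\<And>i. i < (N::nat) \<Longrightarrow> a i \<in> reg Z A" "\<And>i. i < N \<Longrightarrow> b i \<in> reg Z B"
      unfolding tensor_fun_def by blast
    let ?W = "{x \<in> U. f x \<in> A} \<inter> {x \<in> U. g x \<in> B}"
    have W: "openin (zar X) ?W" using morph_on_vimage[OF f A] morph_on_vimage[OF g B] by auto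
    have r: "regular_on X ?W (\<lambda>x. \<Sum>i<M. a i (f x) * b i (g x))" if "M \<le> N" for M
      using that
    proof (induction M)
      case 0
      thus ?case using regular_on_const[OF swf W, of 0] by simp
    next
      case (Suc M)
      have "regular_on X ?W (\<lambda>x. a M (f x))"
        using regular_on_subset[OF swf morph_on_pullback[OF f regular_on_reg[OF Zs A ab(1)]] W] Suc.prems by auto
      moreover have "regular_on X ?W (\<lambda>x. b M (g x))"
        using regular_on_subset[OF swf morph_on_pullback[OF g regular_on_reg[OF Zs B ab(2)]] W] Suc.prems by auto
      ultimately show ?case
        using Suc regular_on_add[OF swf Suc.IH regular_on_mult[OF swf]] by auto
    qed
    have "(\<lambda>x. (f x, g x)) -` T \<inter> topspace (subtopology (zar X) U) =
        {x \<in> ?W. (\<Sum>i<N. a i (f x) * b i (g x)) \<noteq> 0}"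
      using T openin_subset[OF U] by auto
    moreover have "openin (zar X) {x \<in> ?W. (\<Sum>i<N. a i (f x) * b i (g x)) \<noteq> 0}"
      by (rule regular_on_nonzero_openin[OF X r]) simp
    ultimately show "openin (subtopology (zar X) U) ((\<lambda>x. (f x, g x)) -` T \<inter> topspace (subtopology (zar X) U))"
      using U by (auto simp: openin_open_subtopology)
  next
    have "\<Union>?S = points Z \<times> points Z"
      using topspace_prod_space[OF Zs Zs] unfolding prod_space_def by (simp add: topology_generated_by_topspace)
    thus "(\<lambda>x. (f x, g x)) ` topspace (subtopology (zar X) U) \<subseteq> \<Union>?S"
      using morph_on_in[OF f] morph_on_in[OF g] by auto
  qed
  hence c: "continuous_map (subtopology (zar X) U) ?P (\<lambda>x. (f x, g x))"
    by (simp add: prod_space_def)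
  have "openin ?P (topspace ?P - Id_on (points Z))"
    using Z by (simp add: variety_def closedin_def)
  hence "openin (subtopology (zar X) U) {x \<in> topspace (subtopology (zar X) U). (f x, g x) \<in> topspace ?P - Id_on (points Z)}"
    using c unfolding continuous_map_def by blast
  moreover have "{x \<in> topspace (subtopology (zar X) U). (f x, g x) \<in> topspace ?P - Id_on (points Z)} = {x \<in> U. f x \<noteq> g x}"
    using openin_subset[OF U] morph_on_in[OF f] morph_on_in[OF g]
    unfolding topspace_prod_space[OF Zs Zs] by (auto simp: Id_on_def)
  ultimately show ?thesis using U by (auto simp: openin_open_subtopology)
qed

section \<open>Linear algebra of function spaces\<close>

abbreviation fun_subspace :: "('p \<Rightarrow> 'k::field) set \<Rightarrow> bool" where
  "fun_subspace \<equiv> module.subspace (\<lambda>c f p. c * f p)"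

abbreviation fun_dim :: "('p \<Rightarrow> 'k::field) set \<Rightarrow> nat" where
  "fun_dim \<equiv> vector_space.dim (\<lambda>c f p. c * f p)"

context
begin

interpretation fun_vs: vector_space "\<lambda>(c::'k::field) f p. c * f p"
  by unfold_locales (auto simp: fun_eq_iff algebra_simps)

interpretation fun_vs_pair: vector_space_pair "\<lambda>(c::'k::field) f p. c * f p" "\<lambda>(c::'k::field) f p. c * f p"
  by unfold_locales

interpretation fun_vs_functional: vector_space_pair "\<lambda>(c::'k::field) f p. c * f p" "(*) :: 'k \<Rightarrow> 'k \<Rightarrow> 'k"
  by unfold_locales (auto simp: algebra_simps)

lemma sum_fun_apply: "(\<Sum>i\<in>I. f i) p = (\<Sum>i\<in>I. f i p)"
  by (induction I rule: infinite_finite_induct) auto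

definition unit_fun :: "nat \<Rightarrow> nat \<Rightarrow> 'k::field" where
  "unit_fun l = (\<lambda>i. if i = l then 1 else 0)"

lemma fun_eq_sum_unit_fun:
  fixes f :: "nat \<Rightarrow> 'k::field"
  assumes "\<And>l. l \<ge> m \<Longrightarrow> f l = 0"
  shows "f = (\<Sum>l<m. (\<lambda>p. f l * unit_fun l p))"
proof
  fix p
  have "(\<Sum>l<m. f l * unit_fun l p) = (\<Sum>l\<in>{..<m} \<inter> {p}. f l * unit_fun l p)"
    by (intro sum.mono_neutral_right) (auto simp: unit_fun_def)
  also have "\<dots> = f p"
    using assms[of p] by (cases "p < m") (auto simp: unit_fun_def)
  finally show "f p = (\<Sum>l<m. (\<lambda>p. f l * unit_fun l p)) p" by (simp add: sum_fun_apply)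
qed

lemma functional_eq_sum:
  fixes g :: "(nat \<Rightarrow> 'k::field) \<Rightarrow> 'k"
  assumes g: "Vector_Spaces.linear (\<lambda>c f p. c * f p) (*) g" and f: "\<And>l. l \<ge> m \<Longrightarrow> f l = 0"
  shows "g f = (\<Sum>l<m. f l * g (unit_fun l))"
proof -
  interpret g: Vector_Spaces.linear "\<lambda>c f p. c * f p" "(*)" g by (rule g)
  have "g f = g (\<Sum>l<m. (\<lambda>p. f l * unit_fun l p))" using fun_eq_sum_unit_fun[of m f] f by simp
  also have "\<dots> = (\<Sum>l<m. f l * g (unit_fun l))" unfolding g.sum g.scale ..
  finally show ?thesis .
qed

text \<open>Evaluation at the points \<open>q l\<close> embeds \<open>S\<close> in a space of finite
  dimension, so a basis of \<open>S\<close> is finite and its coordinate functionals extend to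
  combinations \<open>\<psi> i\<close> of these evaluations. For a tangent space the points are the
  germs of the coordinates, and the combinations become functions on the variety.\<close>

lemma dual_basis:
  fixes S :: "('p \<Rightarrow> 'k::field) set" and q :: "nat \<Rightarrow> 'p"
  assumes S: "fun_subspace S" and inj: "\<And>D. D \<in> S \<Longrightarrow> (\<And>l. l < m \<Longrightarrow> D (q l) = 0) \<Longrightarrow> D = (\<lambda>_. 0)"
  obtains B \<psi> where "\<And>j. j < fun_dim S \<Longrightarrow> B j \<in> S"
    "\<And>D. D \<in> S \<Longrightarrow> \<exists>c. D = (\<lambda>p. \<Sum>j<fun_dim S. c j * B j p)"
    "\<And>i j. i < fun_dim S \<Longrightarrow> j < fun_dim S \<Longrightarrow> (\<Sum>l<m. \<psi> i l * B j (q l)) = (if i = j then 1 else 0)"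
proof -
  obtain C where C: "C \<subseteq> S" "fun_vs.independent C" "S \<subseteq> fun_vs.span C" "card C = fun_dim S"
    by (rule fun_vs.basis_exists)
  define R where "R = (\<lambda>(f :: 'p \<Rightarrow> 'k) l. if l < m then f (q l) else 0)"
  have R: "Vector_Spaces.linear (\<lambda>c f p. c * f p) (\<lambda>c f p. c * f p) R"
    by unfold_locales (auto simp: R_def fun_eq_iff)
  have spanC: "fun_vs.span C \<subseteq> S" by (rule fun_vs.span_minimal[OF C(1) S])
  have injR: "inj_on R (fun_vs.span C)"
  proof (rule inj_onI)
    fix f g assume fg: "f \<in> fun_vs.span C" "g \<in> fun_vs.span C" "R f = R g"
    have "f - g = (\<lambda>_. 0)"
    proof (rule inj)
      show "f - g \<in> S" using fun_vs.span_diff[OF fg(1,2)] spanC by blast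
      show "(f - g) (q l) = 0" if "l < m" for l
        using fun_cong[OF fg(3), of l] that by (simp add: R_def)
    qed
    thus "f = g" by (auto simp: fun_eq_iff)
  qed
  have ind: "fun_vs.independent (R ` C)"
    by (rule fun_vs_pair.linear_independent_injective_image[OF R C(2) injR])
  have "R f \<in> fun_vs.span (unit_fun ` {..<m})" for f
  proof (subst fun_eq_sum_unit_fun[of m "R f"])
    show "R f l = 0" if "l \<ge> m" for l using that by (simp add: R_def)
    show "(\<Sum>l<m. (\<lambda>p. R f l * unit_fun l p)) \<in> fun_vs.span (unit_fun ` {..<m})"
      by (rule fun_vs.span_sum, rule fun_vs.span_scale, rule fun_vs.span_base) auto
  qed
  hence "finite (R ` C)"
    using fun_vs.independent_span_bound[OF _ ind, of "unit_fun ` {..<m}"] by auto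
  moreover have "inj_on R C" using injR fun_vs.span_superset[of C] by (rule inj_on_subset)
  ultimately have finC: "finite C" by (rule finite_imageD)
  then obtain B where B: "bij_betw B {..<fun_dim S} C"
    using C(4) by (metis atLeast0LessThan ex_bij_betw_nat_finite)
  have "\<exists>g. Vector_Spaces.linear (\<lambda>c f p. c * f p) (*) g \<and> (\<forall>r\<in>R ` C. g r = (if r = R (B i) then 1 else 0))" for i
    by (rule fun_vs_functional.linear_independent_extend[OF ind])
  then obtain g where g: "\<And>i. Vector_Spaces.linear (\<lambda>c f p. c * f p) (*) (g i)"
    "\<And>i r. r \<in> R ` C \<Longrightarrow> g i r = (if r = R (B i) then 1 else 0)" by metis
  have BC: "B j \<in> C" if "j < fun_dim S" for j using B that by (auto simp: bij_betw_def)
  show thesis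
  proof (rule that[of B "\<lambda>i l. g i (unit_fun l)"])
    show "B j \<in> S" if "j < fun_dim S" for j using BC[OF that] C(1) by blast
    show "\<exists>c. D = (\<lambda>p. \<Sum>j<fun_dim S. c j * B j p)" if "D \<in> S" for D
    proof -
      have "D \<in> fun_vs.span C" using C(3) that by blast
      then obtain u where "D = (\<Sum>v\<in>C. (\<lambda>p. u v * v p))"
        using fun_vs.span_finite[OF finC] by auto
      also have "\<dots> = (\<Sum>j<fun_dim S. (\<lambda>p. u (B j) * B j p))"
        by (rule sum.reindex_bij_betw[OF B, symmetric])
      finally show ?thesis
        by (intro exI[of _ "\<lambda>j. u (B j)"]) (auto simp: fun_eq_iff sum_fun_apply)
    qed
    show "(\<Sum>l<m. g i (unit_fun l) * B j (q l)) = (if i = j then 1 else 0)"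
      if ij: "i < fun_dim S" "j < fun_dim S" for i j
    proof -
      have "(\<Sum>l<m. g i (unit_fun l) * B j (q l)) = (\<Sum>l<m. R (B j) l * g i (unit_fun l))"
        by (intro sum.cong) (auto simp: R_def)
      also have "\<dots> = g i (R (B j))"
        by (rule functional_eq_sum[OF g(1), symmetric]) (simp add: R_def)
      also have "\<dots> = (if R (B j) = R (B i) then 1 else 0)"
        using BC[OF ij(2)] by (intro g(2)) blast
      also have "R (B j) = R (B i) \<longleftrightarrow> i = j"
        using \<open>inj_on R C\<close> BC ij B by (metis bij_betw_imp_inj_on inj_onD lessThan_iff)
      finally show ?thesis .
    qed
  qed
qed

text \<open>Duality makes the family independent; it spans because \<open>inj\<close> annihilates
  the difference between an element and its expansion. Meant for computing the dimension of the
  tangent space at generic points.\<close>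

lemma dim_eqI:
  fixes S :: "('p \<Rightarrow> 'k::field) set" and q :: "nat \<Rightarrow> 'p"
  assumes S: "fun_subspace S" and B: "\<And>j. j < d \<Longrightarrow> B j \<in> S"
    and dual: "\<And>i j. i < d \<Longrightarrow> j < d \<Longrightarrow> B j (q i) = (if i = j then 1 else 0)"
    and inj: "\<And>D. D \<in> S \<Longrightarrow> (\<And>i. i < d \<Longrightarrow> D (q i) = 0) \<Longrightarrow> D = (\<lambda>_. 0)"
  shows "fun_dim S = d"
proof -
  have injB: "inj_on B {..<d}"
    by (rule inj_onI) (metis dual lessThan_iff one_neq_zero)
  have ev: "(\<Sum>j<d. c j * B j (q i)) = c i" if "i < d" for c i
  proof -
    have "(\<Sum>j<d. c j * B j (q i)) = (\<Sum>j\<in>{i}. c j * B j (q i))"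
      using that by (intro sum.mono_neutral_right) (auto simp: dual)
    thus ?thesis using that by (simp add: dual)
  qed
  have "fun_dim S = card (B ` {..<d})"
  proof (rule fun_vs.basis_card_eq_dim[symmetric])
    show "B ` {..<d} \<subseteq> S" using B by auto
    show "S \<subseteq> fun_vs.span (B ` {..<d})"
    proof
      fix D assume D: "D \<in> S"
      let ?E = "\<Sum>j<d. (\<lambda>p. D (q j) * B j p)"
      have E: "?E \<in> fun_vs.span (B ` {..<d})"
        by (rule fun_vs.span_sum, rule fun_vs.span_scale, rule fun_vs.span_base) auto
      have "?E \<in> S" by (rule fun_vs.subspace_sum[OF S], rule fun_vs.subspace_scale[OF S], rule B) auto
      hence "D - ?E \<in> S" using D by (intro fun_vs.subspace_diff[OF S])
      hence "D - ?E = (\<lambda>_. 0)"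
        by (rule inj) (simp add: sum_fun_apply ev)
      hence "D = ?E" unfolding zero_fun_def[symmetric] by (simp only: right_minus_eq)
      thus "D \<in> fun_vs.span (B ` {..<d})" using E by simp
    qed
    show "fun_vs.independent (B ` {..<d})"
    proof (rule fun_vs.independent_if_scalars_zero)
      fix u x assume s: "(\<Sum>x\<in>B ` {..<d}. (\<lambda>p. u x * x p)) = 0" and x: "x \<in> B ` {..<d}"
      then obtain i where i: "i < d" "x = B i" by auto
      have "(\<Sum>j<d. (\<lambda>p. u (B j) * B j p)) = 0" using s by (simp add: sum.reindex[OF injB])
      from fun_cong[OF this, of "q i"] have "(\<Sum>j<d. u (B j) * B j (q i)) = 0"
        by (simp add: sum_fun_apply)
      thus "u x = 0" using ev[OF i(1), of "\<lambda>j. u (B j)"] i by simp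
    qed auto
  qed
  thus ?thesis using card_image[OF injB] by simp
qed

text \<open>Double annihilator in dimension \<open>m\<close>: were the unit vector outside
  \<open>L\<close>, some functional would vanish on \<open>L\<close> but not on it, and the values
  of this functional on the unit vectors contradict \<open>ann\<close>.\<close>

lemma unit_fun_in_subspace:
  fixes L :: "(nat \<Rightarrow> 'k::field) set"
  assumes L: "fun_subspace L" and supp: "\<And>f l. f \<in> L \<Longrightarrow> l \<ge> m \<Longrightarrow> f l = 0"
    and ann: "\<And>v l. (\<And>f. f \<in> L \<Longrightarrow> (\<Sum>l<m. f l * v l) = 0) \<Longrightarrow> l < m \<Longrightarrow> v l = 0"
    and l: "l < m"
  shows "unit_fun l \<in> L"
proof (rule ccontr)
  assume nin: "unit_fun l \<notin> L"
  obtain C where C: "C \<subseteq> L" "fun_vs.independent C" "L \<subseteq> fun_vs.span C" "card C = fun_dim L"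
    by (rule fun_vs.basis_exists)
  have "fun_vs.span C \<subseteq> L" by (rule fun_vs.span_minimal[OF C(1) L])
  hence nin': "unit_fun l \<notin> fun_vs.span C" using nin by blast
  hence "fun_vs.independent (insert (unit_fun l) C)"
    using C(2) by (rule fun_vs.independent_insertI)
  from fun_vs_functional.linear_independent_extend[OF this, of "\<lambda>x. if x = unit_fun l then 1 else 0"]
  obtain g where g: "Vector_Spaces.linear (\<lambda>c f p. c * f p) (*) g"
    "\<forall>x\<in>insert (unit_fun l) C. g x = (if x = unit_fun l then 1 else 0)" by blast
  have gC: "g f = 0" if "f \<in> C" for f
    using g(2) that nin' fun_vs.span_base[of f C] by auto
  interpret g: Vector_Spaces.linear "\<lambda>c f p. c * f p" "(*)" g by (rule g(1))
  have "g f = 0" if "f \<in> fun_vs.span C" for f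
    using that
  proof (induction rule: fun_vs.span_induct_alt)
    case base
    show ?case by (rule g.zero)
  next
    case (step c x y)
    show ?case unfolding g.add g.scale using step gC by simp
  qed
  hence "(\<Sum>i<m. f i * g (unit_fun i)) = 0" if "f \<in> L" for f
    using functional_eq_sum[OF g(1), of m f] supp[OF that] C(3) that by auto
  hence "g (unit_fun l) = 0" using ann[of "\<lambda>i. g (unit_fun i)" l] l by blast
  thus False using g(2) by simp
qed

lemma fun_subspaceI:
  fixes S :: "('p \<Rightarrow> 'k::field) set"
  assumes "0 \<in> S" "\<And>f g. f \<in> S \<Longrightarrow> g \<in> S \<Longrightarrow> f + g \<in> S" "\<And>c f. f \<in> S \<Longrightarrow> (\<lambda>p. c * f p) \<in> S"
  shows "fun_subspace S"
  using assms by (rule fun_vs.subspaceI)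

end

lemma mat_mult_vec_solvable:
  fixes A :: "'k::field mat"
  assumes A: "A \<in> carrier_mat n n" and inj: "\<And>v. v \<in> carrier_vec n \<Longrightarrow> A *\<^sub>v v = 0\<^sub>v n \<Longrightarrow> v = 0\<^sub>v n"
    and b: "b \<in> carrier_vec n"
  obtains v where "v \<in> carrier_vec n" "A *\<^sub>v v = b"
proof -
  have "det A \<noteq> 0" using det_0_iff_vec_prod_zero_field[OF A] inj by auto
  from det_non_zero_imp_unit[OF A this, of "()"]
  obtain B where B: "A * B = 1\<^sub>m n" "B \<in> carrier_mat n n"
    unfolding Units_def ring_mat_def by auto
  have "A *\<^sub>v (B *\<^sub>v b) = b"
    using assoc_mult_mat_vec[OF A B(2) b] B(1) b by simp
  thus thesis using that[of "B *\<^sub>v b"] B(2) b by simp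
qed

lemma det_zero_row:
  fixes A :: "'k::field mat"
  assumes A: "A \<in> carrier_mat n n" and i: "i < n" "\<And>j. j < n \<Longrightarrow> A $$ (i, j) = 0"
  shows "\<exists>v. v \<in> carrier_vec n \<and> v \<noteq> 0\<^sub>v n \<and> A *\<^sub>v v = 0\<^sub>v n"
proof -
  have "det A = 0"
  proof -
    have "(\<Prod>j = 0..<n. A $$ (j, p j)) = 0" if "p permutes {0..<n}" for p
      using i permutes_in_image[OF that, of i] by (intro prod_zero bexI[of _ i]) auto
    thus ?thesis unfolding det_def'[OF A] by (intro sum.neutral) auto
  qed
  thus ?thesis using det_0_iff_vec_prod_zero_field[OF A] by simp
qed

section \<open>Tangent spaces\<close>

text \<open>Applies a derivation to a function that need not be extensional, in line with
  \<open>regular_on\<close>.\<close>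

definition der :: "('a set \<times> ('a \<Rightarrow> 'k) \<Rightarrow> 'k) \<Rightarrow> 'a set \<Rightarrow> ('a \<Rightarrow> 'k) \<Rightarrow> 'k" where
  "der D U f = D (U, restrict f U)"

lemma der_cong: "(\<And>x. x \<in> U \<Longrightarrow> f x = g x) \<Longrightarrow> der D U f = der D U g"
  by (simp add: der_def cong: restrict_cong)

lemma der_extensional: "f \<in> extensional U \<Longrightarrow> der D U f = D (U, f)"
  by (simp add: der_def extensional_restrict)

lemma der_plus: "der (D + E) U f = der D U f + der E U f"
  and der_scale: "der (\<lambda>p. c * D p) U f = c * der D U f"
  and der_zero: "der 0 U f = 0"
  by (simp_all add: der_def)

lemma local_functions_iff:
  assumes "space_with_functions X"
  shows "(U, f) \<in> local_functions X x \<longleftrightarrow> x \<in> U \<and> regular_on X U f \<and> f \<in> extensional U"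
proof -
  have "f \<in> extensional U" if "openin (zar X) U" "f \<in> reg X U"
    using space_with_functionsD(1)[OF assms that(1)] that(2) by blast
  thus ?thesis unfolding local_functions_def regular_on_def
    by (auto simp: extensional_restrict)
qed

lemma restrict_restrict_add:
  fixes f g :: "'a \<Rightarrow> 'k::field"
  shows "(\<lambda>y\<in>U. restrict f U y + restrict g U y) = (\<lambda>y\<in>U. f y + g y)"
    and "(\<lambda>y\<in>U. restrict f U y * restrict g U y) = (\<lambda>y\<in>U. f y * g y)"
    and "(\<lambda>y\<in>U. c * restrict f U y) = (\<lambda>y\<in>U. c * f y)"
    and "V \<subseteq> U \<Longrightarrow> restrict (restrict f U) V = restrict f V"
  by (auto simp: fun_eq_iff)

lemma tangent_spaceD:
  assumes swf: "space_with_functions X" and D: "D \<in> tangent_space X x"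
  shows "p \<notin> local_functions X x \<Longrightarrow> D p = 0"
    and "regular_on X U f \<Longrightarrow> x \<in> V \<Longrightarrow> openin (zar X) V \<Longrightarrow> V \<subseteq> U \<Longrightarrow> der D V f = der D U f"
    and "regular_on X U f \<Longrightarrow> regular_on X U g \<Longrightarrow> x \<in> U \<Longrightarrow> der D U (\<lambda>y. f y + g y) = der D U f + der D U g"
    and "regular_on X U f \<Longrightarrow> regular_on X U g \<Longrightarrow> x \<in> U \<Longrightarrow>
      der D U (\<lambda>y. f y * g y) = f x * der D U g + g x * der D U f"
    and "regular_on X U f \<Longrightarrow> x \<in> U \<Longrightarrow> der D U (\<lambda>y. c * f y) = c * der D U f"
proof -
  note D' = D[unfolded tangent_space_def mem_Collect_eq]
  note D1 = D'[THEN conjunct1]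
    and D2 = D'[THEN conjunct2, THEN conjunct1]
    and D3 = D'[THEN conjunct2, THEN conjunct2, THEN conjunct1]
    and D4 = D'[THEN conjunct2, THEN conjunct2, THEN conjunct2]
  have loc: "(U, restrict f U) \<in> local_functions X x" if "regular_on X U f" "x \<in> U" for U f
    using that unfolding local_functions_def regular_on_def by simp
  show "D p = 0" if "p \<notin> local_functions X x" using D1 that by blast
  show "der D V f = der D U f" if "regular_on X U f" "x \<in> V" "openin (zar X) V" "V \<subseteq> U"
  proof -
    have "x \<in> U" using that by blast
    have "D (V, restrict (restrict f U) V) = D (U, restrict f U)"
      using D2[rule_format, of U "restrict f U" V] loc[OF that(1) \<open>x \<in> U\<close>] that(2-4) by simp
    thus ?thesis unfolding der_def using restrict_restrict_add(4)[OF that(4), of f] by simp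
  qed
  show "der D U (\<lambda>y. f y + g y) = der D U f + der D U g"
    if "regular_on X U f" "regular_on X U g" "x \<in> U"
    unfolding der_def using D3[rule_format, of U "restrict f U" "restrict g U"] loc[OF that(1,3)] loc[OF that(2,3)]
    unfolding restrict_restrict_add by simp
  show "der D U (\<lambda>y. f y * g y) = f x * der D U g + g x * der D U f"
    if "regular_on X U f" "regular_on X U g" "x \<in> U"
    unfolding der_def using D3[rule_format, of U "restrict f U" "restrict g U"] loc[OF that(1,3)] loc[OF that(2,3)] that(3)
    unfolding restrict_restrict_add by simp
  show "der D U (\<lambda>y. c * f y) = c * der D U f" if "regular_on X U f" "x \<in> U"
    unfolding der_def using D4[rule_format, of U "restrict f U" c] loc[OF that]
    unfolding restrict_restrict_add by simp
qed

lemma tangent_spaceI: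
  assumes swf: "space_with_functions X"
    and 1: "\<And>p. p \<notin> local_functions X x \<Longrightarrow> D p = 0"
    and 2: "\<And>U V f. regular_on X U f \<Longrightarrow> x \<in> V \<Longrightarrow> openin (zar X) V \<Longrightarrow> V \<subseteq> U \<Longrightarrow> der D V f = der D U f"
    and 3: "\<And>U f g. regular_on X U f \<Longrightarrow> regular_on X U g \<Longrightarrow> x \<in> U \<Longrightarrow>
      der D U (\<lambda>y. f y + g y) = der D U f + der D U g"
    and 4: "\<And>U f g. regular_on X U f \<Longrightarrow> regular_on X U g \<Longrightarrow> x \<in> U \<Longrightarrow>
      der D U (\<lambda>y. f y * g y) = f x * der D U g + g x * der D U f"
    and 5: "\<And>U f c. regular_on X U f \<Longrightarrow> x \<in> U \<Longrightarrow> der D U (\<lambda>y. c * f y) = c * der D U f"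
  shows "D \<in> tangent_space X x"
  unfolding tangent_space_def mem_Collect_eq local_functions_iff[OF swf]
proof (intro conjI allI impI, goal_cases)
  case (1 p) thus ?case by (rule assms(2))
next
  case (2 U V f)
  hence "der D V f = der D U f" by (intro assms(3)) auto
  thus ?case using 2 by (simp add: der_def extensional_restrict)
next
  case (3 U f g)
  hence "der D U (\<lambda>y. f y + g y) = der D U f + der D U g" by (intro assms(4)) auto
  thus ?case using 3 by (simp add: der_def extensional_restrict)
next
  case (4 U f g)
  hence "der D U (\<lambda>y. f y * g y) = f x * der D U g + g x * der D U f" by (intro assms(5)) auto
  thus ?case using 4 by (simp add: der_def extensional_restrict)
next
  case (5 U f c)
  hence "der D U (\<lambda>y. c * f y) = c * der D U f" by (intro assms(6)) auto
  thus ?case using 5 by (simp add: der_def extensional_restrict)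
qed

lemma subspace_tangent_space:
  assumes swf: "space_with_functions X"
  shows "fun_subspace (tangent_space X x)"
proof (rule fun_subspaceI)
  show "0 \<in> tangent_space X x"
    by (rule tangent_spaceI[OF swf]) (simp_all add: der_zero)
  note TD = tangent_spaceD[OF swf]
  show "D + E \<in> tangent_space X x" if D: "D \<in> tangent_space X x" and E: "E \<in> tangent_space X x" for D E
  proof (rule tangent_spaceI[OF swf], goal_cases)
    case (1 p) thus ?case using TD(1)[OF D 1] TD(1)[OF E 1] by simp
  next
    case (2 U V f) thus ?case using TD(2)[OF D 2] TD(2)[OF E 2] by (simp only: der_plus)
  next
    case (3 U f g) thus ?case using TD(3)[OF D 3] TD(3)[OF E 3] by (simp only: der_plus add.assoc add.left_commute)
  next
    case (4 U f g) thus ?case using TD(4)[OF D 4] TD(4)[OF E 4]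
      by (simp only: der_plus distrib_left add.assoc add.left_commute)
  next
    case (5 U f c) thus ?case using TD(5)[OF D 5] TD(5)[OF E 5] by (simp only: der_plus distrib_left)
  qed
  show "(\<lambda>p. c * D p) \<in> tangent_space X x" if D: "D \<in> tangent_space X x" for c D
  proof (rule tangent_spaceI[OF swf], goal_cases)
    case (1 p) thus ?case using TD(1)[OF D 1] by simp
  next
    case (2 U V f) thus ?case using TD(2)[OF D 2] by (simp only: der_scale)
  next
    case (3 U f g) thus ?case using TD(3)[OF D 3] by (simp only: der_scale distrib_left)
  next
    case (4 U f g) thus ?case using TD(4)[OF D 4] by (simp only: der_scale distrib_left mult.left_commute)
  next
    case (5 U f c) thus ?case using TD(5)[OF D 5] by (simp only: der_scale mult.left_commute)
  qed
qed

text \<open>The Leibniz rule for \<open>1 * 1 = 1\<close> kills the derivative of 1; the rest is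
  homogeneity.\<close>

lemma tangent_const:
  assumes swf: "space_with_functions X" and D: "D \<in> tangent_space X x" and U: "openin (zar X) U" "x \<in> U"
  shows "der D U (\<lambda>_. c) = 0"
proof -
  note r = regular_on_const[OF swf U(1), of 1]
  have "der D U (\<lambda>_. 1) = 0"
    using tangent_spaceD(4)[OF swf D r r U(2)] by (metis add_cancel_right_right mult_1)
  thus ?thesis using tangent_spaceD(5)[OF swf D r U(2), of c] by simp
qed

lemma tangent_sum:
  assumes swf: "space_with_functions X" and D: "D \<in> tangent_space X x" and U: "openin (zar X) U" "x \<in> U"
    and f: "\<And>i. i \<in> I \<Longrightarrow> regular_on X U (f i)"
  shows "regular_on X U (\<lambda>y. \<Sum>i\<in>I. c i * f i y) \<and>
    der D U (\<lambda>y. \<Sum>i\<in>I. c i * f i y) = (\<Sum>i\<in>I. c i * der D U (f i))"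
  using f
proof (induction I rule: infinite_finite_induct)
  case (insert i I)
  have r: "regular_on X U (\<lambda>y. c i * f i y)"
    using insert.prems by (intro regular_on_mult[OF swf] regular_on_const[OF swf U(1)]) auto
  have IH: "regular_on X U (\<lambda>y. \<Sum>i\<in>I. c i * f i y)"
    "der D U (\<lambda>y. \<Sum>i\<in>I. c i * f i y) = (\<Sum>i\<in>I. c i * der D U (f i))" using insert by auto
  have "der D U (\<lambda>y. c i * f i y) = c i * der D U (f i)"
    using insert.prems by (intro tangent_spaceD(5)[OF swf D _ U(2)]) auto
  thus ?case
    using regular_on_add[OF swf r IH(1)] tangent_spaceD(3)[OF swf D r IH(1) U(2)] IH(2) insert.hyps
    by simp
qed (use tangent_const[OF swf D U, of 0] regular_on_const[OF swf U(1), of 0] in auto)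

lemma tangent_poly:
  fixes X :: "('a, 'k::field_char_0) fspace"
  assumes swf: "space_with_functions X" and V: "openin (zar X) V" "x \<in> V" and w: "w x \<in> carrier_vec m"
    and r: "\<And>i. i < m \<Longrightarrow> regular_on X V (\<lambda>z. w z $ i)"
    and D: "D \<in> tangent_space X x" and p: "p \<in> poly_fun m"
  shows "der D V (\<lambda>z. p (w z)) = dd p (w x) (vec m (\<lambda>i. der D V (\<lambda>z. w z $ i)))"
  using p
proof (induction rule: poly_fun.induct)
  case (const a)
  show ?case using tangent_const[OF swf D V] by simp
next
  case (coord i)
  thus ?case using w by (subst dd_coord[of _ m]) auto
next
  case (add p q)
  note reg = regular_on_poly[OF swf V(1) add.hyps(1) r] regular_on_poly[OF swf V(1) add.hyps(2) r]
  show ?case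
    using tangent_spaceD(3)[OF swf D reg V(2)] add w by (subst dd_add[of _ m]) auto
next
  case (mult p q)
  note reg = regular_on_poly[OF swf V(1) mult.hyps(1) r] regular_on_poly[OF swf V(1) mult.hyps(2) r]
  show ?case
    using tangent_spaceD(4)[OF swf D reg V(2)] mult w by (subst dd_mult[of _ m]) auto
qed

text \<open>\<open>m\<close> may be smaller than the dimension of the values of
  \<open>\<xi>\<close>; then this is the elimination ideal, the relations among the first
  \<open>m\<close> coordinates alone.\<close>

definition vanishing :: "'a set \<Rightarrow> nat \<Rightarrow> ('a \<Rightarrow> 'k::field vec) \<Rightarrow> ('k vec \<Rightarrow> 'k) set" where
  "vanishing V m \<xi> = {F \<in> poly_fun m. \<forall>z\<in>V. F (\<xi> z) = 0}"

text \<open>The extrinsic tangent space. For a chart it is identified with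
  \<open>tangent_space\<close> by \<open>tangent_coordinates\<close>, \<open>tangent_eq_0\<close>
  and \<open>tangent_vector_derivation\<close>; it is the form in which linear equations can be
  counted.\<close>

definition tangent_vectors :: "'a set \<Rightarrow> nat \<Rightarrow> ('a \<Rightarrow> 'k::field_char_0 vec) \<Rightarrow> 'a \<Rightarrow> 'k vec set" where
  "tangent_vectors V m \<xi> x = {v \<in> carrier_vec m. \<forall>F\<in>vanishing V m \<xi>. dd F (\<xi> x) v = 0}"

lemma vanishingI: "F \<in> poly_fun m \<Longrightarrow> (\<And>z. z \<in> V \<Longrightarrow> F (\<xi> z) = 0) \<Longrightarrow> F \<in> vanishing V m \<xi>"
  and vanishing_poly: "F \<in> vanishing V m \<xi> \<Longrightarrow> F \<in> poly_fun m"
  and vanishing_zero: "F \<in> vanishing V m \<xi> \<Longrightarrow> z \<in> V \<Longrightarrow> F (\<xi> z) = 0"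
  by (simp_all add: vanishing_def)

lemma tangent_vectors_carrier: "v \<in> tangent_vectors V m \<xi> x \<Longrightarrow> v \<in> carrier_vec m"
  and tangent_vectors_dd: "v \<in> tangent_vectors V m \<xi> x \<Longrightarrow> F \<in> vanishing V m \<xi> \<Longrightarrow> dd F (\<xi> x) v = 0"
  by (simp_all add: tangent_vectors_def)

lemma tangent_vectorsI:
  "v \<in> carrier_vec m \<Longrightarrow> (\<And>F. F \<in> vanishing V m \<xi> \<Longrightarrow> dd F (\<xi> x) v = 0) \<Longrightarrow> v \<in> tangent_vectors V m \<xi> x"
  by (simp add: tangent_vectors_def)

lemma tangent_coordinates:
  assumes swf: "space_with_functions X" and c: "chart X V m \<xi>" and x: "x \<in> V"
    and D: "D \<in> tangent_space X x"
  shows "vec m (\<lambda>i. der D V (\<lambda>z. \<xi> z $ i)) \<in> tangent_vectors V m \<xi> x"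
proof (rule tangent_vectorsI)
  fix F assume F: "F \<in> vanishing V m \<xi>"
  have "der D V (\<lambda>z. F (\<xi> z)) = der D V (\<lambda>_. 0)"
    using vanishing_zero[OF F] by (rule der_cong)
  hence "der D V (\<lambda>z. F (\<xi> z)) = 0"
    using tangent_const[OF swf D chart_openin[OF c] x] by simp
  thus "dd F (\<xi> x) (vec m (\<lambda>i. der D V (\<lambda>z. \<xi> z $ i))) = 0"
    using tangent_poly[OF swf chart_openin[OF c] x chart_carrier[OF c x] chart_coord[OF c] D vanishing_poly[OF F]] by simp
qed simp

text \<open>A germ is a quotient \<open>p / q\<close>, and the Leibniz rule for
  \<open>q * f = p\<close> determines its derivative from those of polynomials, hence from those of
  the coordinates.\<close>

lemma tangent_eq_0:
  fixes X :: "('a, 'k::field_char_0) fspace"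
  assumes swf: "space_with_functions X" and c: "chart X V m \<xi>" and x: "x \<in> V"
    and D: "D \<in> tangent_space X x" and D0: "\<And>i. i < m \<Longrightarrow> der D V (\<lambda>z. \<xi> z $ i) = 0"
  shows "D = (\<lambda>_. 0)"
proof
  fix P :: "'a set \<times> ('a \<Rightarrow> 'k)"
  obtain U f where P: "P = (U, f)" by (cases P)
  show "D P = 0"
  proof (cases "P \<in> local_functions X x")
    case False
    thus ?thesis by (rule tangent_spaceD(1)[OF swf D])
  next
    case True
    hence xU: "x \<in> U" and f: "regular_on X U f" and ext: "f \<in> extensional U"
      unfolding P local_functions_iff[OF swf] by auto
    obtain p q where pq: "p \<in> poly_fun m" "q \<in> poly_fun m" "q (\<xi> x) \<noteq> 0"
      "\<And>z. z \<in> V \<Longrightarrow> q (\<xi> z) \<noteq> 0 \<Longrightarrow> z \<in> U" "\<And>z. z \<in> V \<Longrightarrow> q (\<xi> z) \<noteq> 0 \<Longrightarrow> f z = p (\<xi> z) / q (\<xi> z)"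
      using chart_fraction[OF c f xU x] by metis
    let ?W = "{z \<in> V. q (\<xi> z) \<noteq> 0}"
    have W: "openin (zar X) ?W" "x \<in> ?W" "?W \<subseteq> V" "?W \<subseteq> U"
      using chart_nonzero_openin[OF c pq(2)] x pq by auto
    have "vec m (\<lambda>i. der D V (\<lambda>z. \<xi> z $ i)) = 0\<^sub>v m" using D0 by auto
    moreover have "dd r (\<xi> x) (0\<^sub>v m) = 0" if "r \<in> poly_fun m" for r
      using dd_linear_combination[OF that chart_carrier[OF c x], of "0\<^sub>v m"] by simp
    ultimately have r0: "der D V (\<lambda>z. r (\<xi> z)) = 0" if "r \<in> poly_fun m" for r
      using tangent_poly[OF swf chart_openin[OF c] x chart_carrier[OF c x] chart_coord[OF c] D that] that by simp
    have rW: "der D ?W (\<lambda>z. r (\<xi> z)) = 0" "regular_on X ?W (\<lambda>z. r (\<xi> z))" if "r \<in> poly_fun m" for r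
      using tangent_spaceD(2)[OF swf D chart_poly[OF swf c that] W(2,1,3)] r0[OF that]
        regular_on_subset[OF swf chart_poly[OF swf c that] W(1,3)] by auto
    have fW: "regular_on X ?W f" by (rule regular_on_subset[OF swf f W(1,4)])
    have "der D ?W (\<lambda>z. q (\<xi> z) * f z) = der D ?W (\<lambda>z. p (\<xi> z))"
      using pq(5) by (intro der_cong) auto
    hence "der D ?W (\<lambda>z. q (\<xi> z) * f z) = 0" using rW(1)[OF pq(1)] by simp
    hence "der D ?W f = 0"
      using tangent_spaceD(4)[OF swf D rW(2)[OF pq(2)] fW W(2)] rW(1)[OF pq(2)] pq(3) by simp
    hence "der D U f = 0" using tangent_spaceD(2)[OF swf D f W(2,1,4)] by simp
    thus ?thesis using ext by (simp add: P der_extensional)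
  qed
qed

text \<open>Here \<open>a\<close>, \<open>b\<close>, \<open>a'\<close>, \<open>b'\<close> stand for
  the derivatives of \<open>p\<close>, \<open>q\<close>, \<open>p'\<close>, \<open>q'\<close>, and
  \<open>e\<close> is the derivative of \<open>p * q' = p' * q\<close>. The outcome is that two
  representations of \<open>f\<close> as a quotient yield the same derivative.\<close>

lemma quotient_rule_cross:
  fixes a b a' b' p q p' q' f :: "'a::comm_ring"
  assumes e: "p * b' + q' * a = p' * b + q * a'" and f: "q * f = p" "q' * f = p'"
  shows "q' * (a - f * b) = q * (a' - f * b')"
proof -
  have "q' * (a - f * b) - q * (a' - f * b') = ((q * f) * b' + q' * a) - ((q' * f) * b + q * a')"
    by (simp add: algebra_simps)
  also have "\<dots> = 0" unfolding f e by simp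
  finally show ?thesis by simp
qed

lemma cross_cancel:
  fixes f p q p' q' :: "'a::comm_ring"
  assumes "q * f = p" "q' * f = p'"
  shows "p * q' - p' * q = 0"
proof -
  have "q * f * q' = q' * f * q" by (simp only: ac_simps)
  thus ?thesis unfolding assms by simp
qed

lemma quotient_rule_add:
  fixes a b a' b' p q p' q' f g :: "'a::field"
  assumes "q \<noteq> 0" "q' \<noteq> 0" and f: "q * f = p" "q' * g = p'"
  shows "((p * b' + q' * a) + (p' * b + q * a') - (f + g) * (q * b' + q' * b)) / (q * q') =
     (a - f * b) / q + (a' - g * b') / q'"
proof -
  have "((q * f) * b' + q' * a) + ((q' * g) * b + q * a') - (f + g) * (q * b' + q' * b) =
      (a - f * b) * q' + (a' - g * b') * q"
    by (simp add: algebra_simps)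
  thus ?thesis unfolding f add_frac_eq[OF assms(1,2)] by (simp only:)
qed

lemma quotient_rule_mult:
  fixes a b a' b' p q p' q' f g :: "'a::field"
  assumes "q \<noteq> 0" "q' \<noteq> 0" and f: "q * f = p" "q' * g = p'"
  shows "((p * a' + p' * a) - (f * g) * (q * b' + q' * b)) / (q * q') =
     f * ((a' - g * b') / q') + g * ((a - f * b) / q)"
proof -
  have "((q * f) * a' + (q' * g) * a) - (f * g) * (q * b' + q' * b) =
      (g * (a - f * b)) * q' + (f * (a' - g * b')) * q"
    by (simp add: algebra_simps)
  thus ?thesis
    unfolding f times_divide_eq_right add.commute[of "f * (a' - g * b') / q'"] add_frac_eq[OF assms(1,2)]
    by (simp only:)
qed

text \<open>The derivation is forced by the quotient rule along \<open>v\<close>; the point is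
  independence of the representing quotient. Two quotients for one germ yield a relation on the
  chart, and \<open>v\<close> kills the differentials of relations.\<close>

lemma tangent_vector_derivation:
  fixes X :: "('a, 'k::field_char_0) fspace"
  assumes swf: "space_with_functions X" and c: "chart X V m \<xi>" and x: "x \<in> V"
    and v: "v \<in> tangent_vectors V m \<xi> x"
  obtains D where "D \<in> tangent_space X x" "\<And>i. i < m \<Longrightarrow> der D V (\<lambda>z. \<xi> z $ i) = v $ i"
proof -
  note vc = tangent_vectors_carrier[OF v] and xc = chart_carrier[OF c x]
  \<comment> \<open>\<open>p / q\<close> represents \<open>f\<close> where \<open>s\<close> is
    nonzero. The factor \<open>s\<close> records a neighbourhood inside \<open>U\<close>, and
    writing \<open>q * f = p\<close> avoids divisions when representatives are combined.\<close>
  define rep where "rep U f p q s \<longleftrightarrow> p \<in> poly_fun m \<and> q \<in> poly_fun m \<and> s \<in> poly_fun m \<and>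
     q (\<xi> x) \<noteq> 0 \<and> s (\<xi> x) \<noteq> 0 \<and> (\<forall>z\<in>V. s (\<xi> z) \<noteq> 0 \<longrightarrow> z \<in> U \<and> q (\<xi> z) * f z = p (\<xi> z))"
    for U :: "'a set" and f p q s
  define val where "val f p q = (dd p (\<xi> x) v - f x * dd q (\<xi> x) v) / q (\<xi> x)"
    for f :: "'a \<Rightarrow> 'k" and p q
  have repD: "p \<in> poly_fun m" "q \<in> poly_fun m" "s \<in> poly_fun m" "q (\<xi> x) \<noteq> 0" "s (\<xi> x) \<noteq> 0"
    "\<And>z. z \<in> V \<Longrightarrow> s (\<xi> z) \<noteq> 0 \<Longrightarrow> z \<in> U" "\<And>z. z \<in> V \<Longrightarrow> s (\<xi> z) \<noteq> 0 \<Longrightarrow> q (\<xi> z) * f z = p (\<xi> z)"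
    if "rep U f p q s" for U f p q s
    using that unfolding rep_def by blast+
  have repI: "rep U f p q s"
    if "p \<in> poly_fun m" "q \<in> poly_fun m" "s \<in> poly_fun m" "q (\<xi> x) \<noteq> 0" "s (\<xi> x) \<noteq> 0"
    "\<And>z. z \<in> V \<Longrightarrow> s (\<xi> z) \<noteq> 0 \<Longrightarrow> z \<in> U" "\<And>z. z \<in> V \<Longrightarrow> s (\<xi> z) \<noteq> 0 \<Longrightarrow> q (\<xi> z) * f z = p (\<xi> z)"
    for U f p q s
    using that unfolding rep_def by blast
  have uniq: "val f p q = val f' p' q'"
    if r: "rep U f p q s" and r': "rep U' f' p' q' s'" and eq: "\<And>z. z \<in> U \<Longrightarrow> z \<in> U' \<Longrightarrow> f z = f' z"
    for U U' f f' p q s p' q' s'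
  proof -
    note R = repD[OF r] and R' = repD[OF r']
    \<comment> \<open>The cross difference \<open>?H\<close> is known to vanish only where
      \<open>?t\<close> is nonzero, so the relation is their product. At \<open>\<xi> x\<close> the
      factor \<open>?H\<close> is zero and \<open>?t\<close> is not, hence the Leibniz rule still
      isolates the differential of \<open>?H\<close>.\<close>
    let ?H = "\<lambda>u. p u * q' u - p' u * q u" and ?t = "\<lambda>u. s u * s' u"
    have H: "?H \<in> poly_fun m" "?t \<in> poly_fun m" by (intro poly_fun_intros R R')+
    have Hz: "?t (\<xi> z) * ?H (\<xi> z) = 0" if z: "z \<in> V" for z
    proof (cases "s (\<xi> z) = 0 \<or> s' (\<xi> z) = 0")
      case False
      hence *: "q (\<xi> z) * f' z = p (\<xi> z)" "q' (\<xi> z) * f' z = p' (\<xi> z)"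
        using R(6,7)[OF z] R'(6,7)[OF z] eq[of z] by auto
      show ?thesis using cross_cancel[OF *] by simp
    qed auto
    have "(\<lambda>u. ?t u * ?H u) \<in> vanishing V m \<xi>"
      by (rule vanishingI[OF poly_fun.mult[OF H(2,1)]]) (rule Hz)
    from tangent_vectors_dd[OF v this]
    have "?t (\<xi> x) * dd ?H (\<xi> x) v + ?H (\<xi> x) * dd ?t (\<xi> x) v = 0"
      using dd_mult[OF H(2,1) xc vc] by simp
    moreover have "?H (\<xi> x) = 0" using Hz[OF x] R R' by auto
    ultimately have "dd ?H (\<xi> x) v = 0" using R R' by auto
    hence e: "p (\<xi> x) * dd q' (\<xi> x) v + q' (\<xi> x) * dd p (\<xi> x) v = p' (\<xi> x) * dd q (\<xi> x) v + q (\<xi> x) * dd p' (\<xi> x) v"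
      using dd_diff[OF poly_fun.mult[OF R(1) R'(2)] poly_fun.mult[OF R'(1) R(2)] xc vc]
        dd_mult[OF R(1) R'(2) xc vc] dd_mult[OF R'(1) R(2) xc vc] by simp
    have f: "f x = f' x" "q (\<xi> x) * f x = p (\<xi> x)" "q' (\<xi> x) * f' x = p' (\<xi> x)"
      using R R' eq x by blast+
    have "q' (\<xi> x) * (dd p (\<xi> x) v - f x * dd q (\<xi> x) v) = q (\<xi> x) * (dd p' (\<xi> x) v - f' x * dd q' (\<xi> x) v)"
      using quotient_rule_cross[OF e f(2)] f(1,3) by simp
    thus ?thesis unfolding val_def using R(4) R'(4) by (simp add: frac_eq_eq mult.commute)
  qed
  have ex: "\<exists>p q s. rep U f p q s" if f: "regular_on X U f" "x \<in> U" for U f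
  proof -
    obtain p q where pq: "p \<in> poly_fun m" "q \<in> poly_fun m" "q (\<xi> x) \<noteq> 0"
      "\<And>z. z \<in> V \<Longrightarrow> q (\<xi> z) \<noteq> 0 \<Longrightarrow> z \<in> U" "\<And>z. z \<in> V \<Longrightarrow> q (\<xi> z) \<noteq> 0 \<Longrightarrow> f z = p (\<xi> z) / q (\<xi> z)"
      using chart_fraction[OF c f x] by metis
    have "rep U f p q q" by (rule repI) (use pq in auto)
    thus ?thesis by (intro exI)
  qed
  \<comment> \<open>\<open>uniq\<close> makes the choice harmless. As it compares representatives on
    different open sets, it also yields compatibility with restriction.\<close>
  define D where "D = (\<lambda>(U, f). if (U, f) \<in> local_functions X x
      then val f (fst (SOME r. rep U f (fst r) (fst (snd r)) (snd (snd r))))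
        (fst (snd (SOME r. rep U f (fst r) (fst (snd r)) (snd (snd r))))) else 0)"
  have D: "der D U f = val f p q" if f: "regular_on X U f" "x \<in> U" and r: "rep U f p q s" for U f p q s
  proof -
    let ?r = "SOME r. rep U (restrict f U) (fst r) (fst (snd r)) (snd (snd r))"
    have "regular_on X U (restrict f U)" by (rule regular_on_eqI[OF f(1)]) simp
    from ex[OF this f(2)] have "rep U (restrict f U) (fst ?r) (fst (snd ?r)) (snd (snd ?r))"
      by (intro someI_ex[of "\<lambda>r. rep U (restrict f U) (fst r) (fst (snd r)) (snd (snd r))"]) auto
    from uniq[OF this r] have "val (restrict f U) (fst ?r) (fst (snd ?r)) = val f p q" by simp
    moreover have "(U, restrict f U) \<in> local_functions X x"
      using f by (simp add: local_functions_def regular_on_def)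
    ultimately show ?thesis by (simp add: D_def der_def)
  qed
  have "D \<in> tangent_space X x"
  proof (rule tangent_spaceI[OF swf])
    show "D p = 0" if "p \<notin> local_functions X x" for p
      using that by (cases p) (simp add: D_def)
    show "der D W f = der D U f" if f: "regular_on X U f" and W: "x \<in> W" "openin (zar X) W" "W \<subseteq> U" for U W f
    proof -
      have fW: "regular_on X W f" by (rule regular_on_subset[OF swf f W(2,3)])
      have xU: "x \<in> U" using W by blast
      obtain p q s where r: "rep U f p q s" using ex[OF f xU] by blast
      obtain p' q' s' where r': "rep W f p' q' s'" using ex[OF fW W(1)] by blast
      show ?thesis using D[OF f xU r] D[OF fW W(1) r'] uniq[OF r r'] by simp
    qed
    fix U f g assume f: "regular_on X U f" and g: "regular_on X U g" and xU: "x \<in> U"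
    obtain p q s where r: "rep U f p q s" using ex[OF f xU] by blast
    obtain p' q' s' where r': "rep U g p' q' s'" using ex[OF g xU] by blast
    note R = repD[OF r] and R' = repD[OF r']
    have fx: "q (\<xi> x) * f x = p (\<xi> x)" "q' (\<xi> x) * g x = p' (\<xi> x)" using R R' x by blast+
    have "rep U (\<lambda>y. f y + g y) (\<lambda>u. p u * q' u + p' u * q u) (\<lambda>u. q u * q' u) (\<lambda>u. s u * s' u)"
    proof (rule repI)
      fix z assume z: "z \<in> V" "s (\<xi> z) * s' (\<xi> z) \<noteq> 0"
      hence "q (\<xi> z) * f z = p (\<xi> z)" "q' (\<xi> z) * g z = p' (\<xi> z)" using R R' by auto
      moreover have "q (\<xi> z) * q' (\<xi> z) * (f z + g z) =
          (q (\<xi> z) * f z) * q' (\<xi> z) + (q' (\<xi> z) * g z) * q (\<xi> z)"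
        by (simp only: distrib_left ac_simps)
      ultimately show "q (\<xi> z) * q' (\<xi> z) * (f z + g z) = p (\<xi> z) * q' (\<xi> z) + p' (\<xi> z) * q (\<xi> z)"
        by simp
    qed (use R R' in \<open>auto intro!: poly_fun.intros\<close>)
    from D[OF regular_on_add[OF swf f g] xU this]
    show "der D U (\<lambda>y. f y + g y) = der D U f + der D U g"
      unfolding D[OF f xU r] D[OF g xU r'] val_def
        dd_add[OF poly_fun.mult[OF R(1) R'(2)] poly_fun.mult[OF R'(1) R(2)] xc vc]
        dd_mult[OF R(1) R'(2) xc vc] dd_mult[OF R'(1) R(2) xc vc] dd_mult[OF R(2) R'(2) xc vc]
        quotient_rule_add[OF R(4) R'(4) fx] .
    have "rep U (\<lambda>y. f y * g y) (\<lambda>u. p u * p' u) (\<lambda>u. q u * q' u) (\<lambda>u. s u * s' u)"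
    proof (rule repI)
      fix z assume z: "z \<in> V" "s (\<xi> z) * s' (\<xi> z) \<noteq> 0"
      hence "q (\<xi> z) * f z = p (\<xi> z)" "q' (\<xi> z) * g z = p' (\<xi> z)" using R R' by auto
      moreover have "q (\<xi> z) * q' (\<xi> z) * (f z * g z) = (q (\<xi> z) * f z) * (q' (\<xi> z) * g z)"
        by (simp only: ac_simps)
      ultimately show "q (\<xi> z) * q' (\<xi> z) * (f z * g z) = p (\<xi> z) * p' (\<xi> z)" by simp
    qed (use R R' in \<open>auto intro!: poly_fun.intros\<close>)
    from D[OF regular_on_mult[OF swf f g] xU this]
    show "der D U (\<lambda>y. f y * g y) = f x * der D U g + g x * der D U f"
      unfolding D[OF f xU r] D[OF g xU r'] val_def
        dd_mult[OF R(1) R'(1) xc vc] dd_mult[OF R(2) R'(2) xc vc]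
        quotient_rule_mult[OF R(4) R'(4) fx] .
  next
    fix U f and a :: 'k assume f: "regular_on X U f" and xU: "x \<in> U"
    obtain p q s where r: "rep U f p q s" using ex[OF f xU] by blast
    note R = repD[OF r]
    have "rep U (\<lambda>y. a * f y) (\<lambda>u. a * p u) q s"
    proof (rule repI)
      fix z assume z: "z \<in> V" "s (\<xi> z) \<noteq> 0"
      thus "q (\<xi> z) * (a * f z) = a * p (\<xi> z)" using R(7) by (metis mult.left_commute)
    qed (use R in \<open>auto intro!: poly_fun.intros\<close>)
    from D[OF regular_on_mult[OF swf regular_on_const[OF swf regular_onD[OF f]] f] xU this]
    show "der D U (\<lambda>y. a * f y) = a * der D U f"
      unfolding D[OF f xU r] val_def dd_cmult[OF R(1) xc vc, of a] times_divide_eq_right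
        right_diff_distrib mult.assoc .
  qed
  moreover have "der D V (\<lambda>z. \<xi> z $ i) = v $ i" if i: "i < m" for i
  proof -
    have "rep V (\<lambda>z. \<xi> z $ i) (\<lambda>u. u $ i) (\<lambda>_. 1) (\<lambda>_. 1)"
      by (rule repI) (use i in \<open>auto intro: poly_fun.intros\<close>)
    from D[OF chart_coord[OF c i] x this] show ?thesis
      using dd_coord[OF xc vc i] by (simp add: val_def)
  qed
  ultimately show thesis by (rule that)
qed

section \<open>Tangent spaces at generic points\<close>

lemma dd_eq_0_if_vanishing:
  fixes F :: "'k::field_char_0 vec \<Rightarrow> 'k"
  assumes "\<And>u. u \<in> carrier_vec m \<Longrightarrow> F u = 0" "x \<in> carrier_vec m" "v \<in> carrier_vec m"
  shows "dd F x v = 0"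
proof -
  have "dd F x v = poly (pderiv 0) 0"
    by (rule dd_eqI) (use assms in auto)
  thus ?thesis by simp
qed

text \<open>Raises a polynomial of formal degree \<open>e\<close> to formal degree \<open>n\<close>,
  for cancelling a leading term in the pseudo-division.\<close>

lemma sum_shift_coefficients:
  fixes b :: "nat \<Rightarrow> 'a::comm_ring_1"
  assumes "e \<le> n"
  shows "X ^ (n - e) * (\<Sum>i<Suc e. b i * X ^ i) =
    (\<Sum>i<Suc n. (if n - e \<le> i then b (i - (n - e)) else 0) * X ^ i)"
proof -
  have "(\<Sum>i<Suc n. (if n - e \<le> i then b (i - (n - e)) else 0) * X ^ i) =
      (\<Sum>i\<in>{n - e..<Suc n}. b (i - (n - e)) * X ^ i)"
    by (rule sum.mono_neutral_cong_right) auto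
  also have "\<dots> = (\<Sum>i<Suc e. b i * X ^ (i + (n - e)))"
    by (rule sum.reindex_bij_witness[of _ "\<lambda>i. i + (n - e)" "\<lambda>i. i - (n - e)"]) (use assms in auto)
  also have "\<dots> = X ^ (n - e) * (\<Sum>i<Suc e. b i * X ^ i)"
    unfolding sum_distrib_left by (intro sum.cong) (auto simp: power_add ac_simps)
  finally show ?thesis by simp
qed

text \<open>Pseudo-division by a relation \<open>Q\<close> of minimal degree in the last coordinate: one new coordinate
  needs at most one new equation for the tangent vectors.\<close>

lemma one_more_equation:
  fixes \<xi> :: "'a \<Rightarrow> 'k::field_char_0 vec"
  assumes Pi: "\<xi> \<in> V \<rightarrow> carrier_vec M" and J: "J < M" and ne: "V \<noteq> {}"
  obtains Q a where "Q \<in> vanishing V (Suc J) \<xi>" "a \<in> poly_fun J" "\<exists>z\<in>V. a (\<xi> z) \<noteq> 0"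
    "\<And>F x v. F \<in> vanishing V (Suc J) \<xi> \<Longrightarrow> x \<in> V \<Longrightarrow> a (\<xi> x) \<noteq> 0 \<Longrightarrow> v \<in> carrier_vec M \<Longrightarrow>
       dd Q (\<xi> x) v = 0 \<Longrightarrow> (\<And>r. r \<in> vanishing V J \<xi> \<Longrightarrow> dd r (\<xi> x) v = 0) \<Longrightarrow> dd F (\<xi> x) v = 0"
proof -
  note carr = funcset_mem[OF Pi]
  let ?S = "\<lambda>n c z. \<Sum>i<n. c i z * (z::'k vec) $ J ^ i"
  \<comment> \<open>Relations of formal degree \<open>e\<close> in the last coordinate whose leading
    coefficient is not zero on all of \<open>V\<close>.\<close>
  define E where "E e c \<longleftrightarrow> (\<forall>i. c i \<in> poly_fun J) \<and> ?S (Suc e) c \<in> vanishing V (Suc J) \<xi> \<and> c e \<notin> vanishing V J \<xi>"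
    for e :: nat and c
  have S_poly: "?S n c \<in> poly_fun (Suc J)" if "\<And>i. c i \<in> poly_fun J" for n c
    by (rule poly_fun_sum) (auto intro!: poly_fun.mult poly_fun_power poly_fun.coord poly_fun_mono[OF that])
  have mono: "F \<in> poly_fun M" if "F \<in> poly_fun J \<or> F \<in> poly_fun (Suc J)" for F :: "'k vec \<Rightarrow> 'k"
    using that J poly_fun_mono[of F J M] poly_fun_mono[of F "Suc J" M] by auto
  have coordM: "(\<lambda>z. z $ J ^ i) \<in> poly_fun M" for i :: nat
    using J by (intro poly_fun_power poly_fun.coord)
  have "\<exists>Q a. Q \<in> vanishing V (Suc J) \<xi> \<and> a \<in> poly_fun J \<and> (\<exists>z\<in>V. a (\<xi> z) \<noteq> 0) \<and>
      (\<forall>n c. E n c \<longrightarrow> (\<exists>e b. e \<le> n \<and> Q = ?S (Suc e) b \<and> (\<forall>i. b i \<in> poly_fun J) \<and> a = b e))"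
  proof (cases "\<exists>e c. E e c")
    case False
    \<comment> \<open>Without such a relation \<open>Q = 0\<close> and \<open>a = 1\<close> will do:
      the clause about \<open>E\<close> is vacuous, and in the recursion below every leading
      coefficient vanishes on \<open>V\<close>.\<close>
    thus ?thesis using ne
      by (intro exI[of _ "\<lambda>_. 0"] exI[of _ "\<lambda>_. 1"]) (auto simp: vanishing_def intro: poly_fun.const)
  next
    case True
    define e where "e = (LEAST e. \<exists>c. E e c)"
    have "\<exists>c. E e c" unfolding e_def by (rule LeastI_ex[OF True])
    then obtain b where b: "E e b" by blast
    have "e \<le> n" if "E n c" for n c unfolding e_def using that by (intro Least_le) blast
    moreover have "\<exists>z\<in>V. b e (\<xi> z) \<noteq> 0"
      using b unfolding E_def vanishing_def by blast
    ultimately show ?thesis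
      using b by (intro exI[of _ "?S (Suc e) b"] exI[of _ "b e"]) (auto simp: E_def)
  qed
  then obtain Q a where Q: "Q \<in> vanishing V (Suc J) \<xi>" and a: "a \<in> poly_fun J" "\<exists>z\<in>V. a (\<xi> z) \<noteq> 0"
    and E: "\<And>n c. E n c \<Longrightarrow> \<exists>e b. e \<le> n \<and> Q = ?S (Suc e) b \<and> (\<forall>i. b i \<in> poly_fun J) \<and> a = b e"
    by blast
  have main: "dd (?S n c) (\<xi> x) v = 0"
    if x: "x \<in> V" "a (\<xi> x) \<noteq> 0" and v: "v \<in> carrier_vec M" and dQ: "dd Q (\<xi> x) v = 0"
      and dr: "\<And>r. r \<in> vanishing V J \<xi> \<Longrightarrow> dd r (\<xi> x) v = 0"
      and c: "\<And>i. c i \<in> poly_fun J" "?S n c \<in> vanishing V (Suc J) \<xi>" for x v n c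
    using c
  proof (induction n arbitrary: c)
    case 0
    show ?case by simp
  next
    case (Suc n)
    note xM = carr[OF x(1)]
    have cM: "c k \<in> poly_fun M" for k by (rule mono[OF disjI1[OF Suc.prems(1)]])
    have SM: "?S k c \<in> poly_fun M" for k by (rule mono[OF disjI2[OF S_poly[OF Suc.prems(1)]]])
    note S0 = vanishing_zero[OF Suc.prems(2)]
    show ?case
    proof (cases "c n \<in> vanishing V J \<xi>")
      case True
      have "?S n c \<in> vanishing V (Suc J) \<xi>"
        by (rule vanishingI[OF S_poly[OF Suc.prems(1)]]) (use S0 vanishing_zero[OF True] in auto)
      from Suc.IH[OF Suc.prems(1) this] have "dd (?S n c) (\<xi> x) v = 0" .
      moreover have "dd (\<lambda>z. c n z * z $ J ^ n) (\<xi> x) v = 0"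
        using dd_mult[OF cM coordM xM v] vanishing_zero[OF True x(1)] dr[OF True] by simp
      ultimately show ?thesis
        using dd_add[OF SM[of n] poly_fun.mult[OF cM[of n] coordM[of n]] xM v] by simp
    next
      case False
      hence "E n c" using Suc.prems by (simp add: E_def)
      then obtain e b where e: "e \<le> n" and Qb: "Q = ?S (Suc e) b" and b: "\<And>i. b i \<in> poly_fun J" and ab: "a = b e"
        using E by blast
      \<comment> \<open>Pseudo-remainder: subtracting \<open>c n\<close> times the shifted
        \<open>Q\<close> from \<open>a\<close> times the polynomial cancels the coefficient of
        degree \<open>n\<close>, so that \<open>n\<close> terms remain.\<close>
      define c' where "c' i = (\<lambda>z. a z * c i z - c n z * (if n - e \<le> i then b (i - (n - e)) z else 0))" for i
      have c': "c' i \<in> poly_fun J" for i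
        unfolding c'_def by (cases "n - e \<le> i") (auto intro!: poly_fun_intros a Suc.prems b)
      have eq: "?S n c' z = a z * ?S (Suc n) c z - c n z * (z $ J ^ (n - e) * Q z)" for z
      proof -
        have "?S n c' z = ?S (Suc n) c' z" using e by (simp add: c'_def ab)
        also have "\<dots> = (\<Sum>i<Suc n. a z * (c i z * z $ J ^ i) -
            c n z * ((if n - e \<le> i then b (i - (n - e)) z else 0) * z $ J ^ i))"
          by (intro sum.cong refl) (simp add: c'_def algebra_simps)
        also have "\<dots> = a z * ?S (Suc n) c z -
            c n z * (\<Sum>i<Suc n. (if n - e \<le> i then b (i - (n - e)) z else 0) * z $ J ^ i)"
          by (simp only: sum_subtractf sum_distrib_left)
        also have "(\<Sum>i<Suc n. (if n - e \<le> i then b (i - (n - e)) z else 0) * z $ J ^ i) = z $ J ^ (n - e) * Q z"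
          unfolding Qb by (rule sum_shift_coefficients[OF e, symmetric])
        finally show ?thesis .
      qed
      have "?S n c' \<in> vanishing V (Suc J) \<xi>"
        by (rule vanishingI[OF S_poly[OF c']]) (simp only: eq S0 vanishing_zero[OF Q] mult_zero_right diff_self)
      from Suc.IH[OF c' this] have "dd (?S n c') (\<xi> x) v = 0" .
      \<comment> \<open>The polynomial and \<open>Q\<close> vanish at \<open>\<xi> x\<close>, and so
        does the differential of \<open>Q\<close> along \<open>v\<close>. Of all Leibniz terms only
        \<open>a\<close> times the wanted differential survives, and \<open>a\<close> is nonzero at
        \<open>\<xi> x\<close>.\<close>
      moreover have "dd (?S n c') (\<xi> x) v = a (\<xi> x) * dd (?S (Suc n) c) (\<xi> x) v"
      proof -
        have QM: "Q \<in> poly_fun M" "a \<in> poly_fun M" using mono vanishing_poly[OF Q] a(1) by auto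
        have 1: "dd (\<lambda>z. a z * ?S (Suc n) c z) (\<xi> x) v = a (\<xi> x) * dd (?S (Suc n) c) (\<xi> x) v"
          using dd_mult[OF QM(2) SM[of "Suc n"] xM v] S0[OF x(1)] by simp
        have q: "(\<lambda>z. z $ J ^ (n - e) * Q z) \<in> poly_fun M" by (intro poly_fun.mult coordM QM)
        have "dd (\<lambda>z. z $ J ^ (n - e) * Q z) (\<xi> x) v = 0"
          using dd_mult[OF coordM QM(1) xM v] vanishing_zero[OF Q x(1)] dQ by simp
        hence 2: "dd (\<lambda>z. c n z * (z $ J ^ (n - e) * Q z)) (\<xi> x) v = 0"
          using dd_mult[OF cM q xM v] vanishing_zero[OF Q x(1)] by simp
        have "?S n c' = (\<lambda>z. a z * ?S (Suc n) c z - c n z * (z $ J ^ (n - e) * Q z))"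
          using eq by (rule ext)
        thus ?thesis
          using dd_diff[OF poly_fun.mult[OF QM(2) SM[of "Suc n"]] poly_fun.mult[OF cM[of n] q] xM v] 1 2
          by (simp only: diff_zero)
      qed
      ultimately show ?thesis using x(2) by simp
    qed
  qed
  show thesis
  proof (rule that[OF Q a])
    fix F x v assume F: "F \<in> vanishing V (Suc J) \<xi>" and H: "x \<in> V" "a (\<xi> x) \<noteq> 0" "v \<in> carrier_vec M"
      "dd Q (\<xi> x) v = 0" "\<And>r. r \<in> vanishing V J \<xi> \<Longrightarrow> dd r (\<xi> x) v = 0"
    obtain n c where c: "\<And>i. c i \<in> poly_fun J" "F = (\<lambda>z. \<Sum>i\<le>n::nat. c i z * z $ J ^ i)"
      using poly_fun_last_var[OF vanishing_poly[OF F]] by blast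
    have eq: "F = ?S (Suc n) c" unfolding c(2) lessThan_Suc_atMost ..
    show "dd F (\<xi> x) v = 0" using main[OF H c(1) F[unfolded eq]] unfolding eq .
  qed
qed

definition alg_independent :: "'a set \<Rightarrow> nat \<Rightarrow> ('a \<Rightarrow> 'k::field vec) \<Rightarrow> bool" where
  "alg_independent V N w \<longleftrightarrow> (\<forall>P\<in>poly_fun N. (\<forall>z\<in>V. P (w z) = 0) \<longrightarrow> (\<forall>v\<in>carrier_vec N. P v = 0))"

text \<open>Independence leaves only zero among the relations of the first \<open>N\<close>
  coordinates, and each further coordinate costs one equation by \<open>one_more_equation\<close>.
  The hypothesis \<open>prime\<close> keeps \<open>h\<close>, the product of the successive leading
  coefficients, from vanishing identically.\<close>

lemma generic_tangent_equations:
  fixes \<xi> :: "'a \<Rightarrow> 'k::field_char_0 vec"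
  assumes carr: "\<And>z. z \<in> V \<Longrightarrow> \<xi> z \<in> carrier_vec M" and ne: "V \<noteq> {}"
    and prime: "\<And>p q. p \<in> poly_fun M \<Longrightarrow> q \<in> poly_fun M \<Longrightarrow> \<exists>z\<in>V. p (\<xi> z) \<noteq> 0 \<Longrightarrow> \<exists>z\<in>V. q (\<xi> z) \<noteq> 0 \<Longrightarrow>
      \<exists>z\<in>V. p (\<xi> z) * q (\<xi> z) \<noteq> 0"
    and ind: "alg_independent V N \<xi>" and NM: "N + j \<le> M"
  shows "\<exists>G h. h \<in> poly_fun M \<and> (\<exists>z\<in>V. h (\<xi> z) \<noteq> 0) \<and> (\<forall>i<j. G i \<in> vanishing V (N + j) \<xi>) \<and>
    (\<forall>x\<in>V. \<forall>v\<in>carrier_vec M. h (\<xi> x) \<noteq> 0 \<and> (\<forall>i<j. dd (G i) (\<xi> x) v = 0) \<longrightarrow>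
       (\<forall>F\<in>vanishing V (N + j) \<xi>. dd F (\<xi> x) v = 0))"
  using NM
proof (induction j)
  case 0
  have "dd F (\<xi> x) v = 0" if F: "F \<in> vanishing V N \<xi>" and x: "x \<in> V" and v: "v \<in> carrier_vec M" for F x v
  proof (rule dd_eq_0_if_vanishing[OF _ carr[OF x] v])
    fix u :: "'k vec" assume u: "u \<in> carrier_vec M"
    have "F (vec N (\<lambda>i. u $ i)) = 0"
      using ind vanishing_poly[OF F] vanishing_zero[OF F] unfolding alg_independent_def by (metis vec_carrier)
    moreover have "F u = F (vec N (\<lambda>i. u $ i))"
      by (rule poly_fun_cong[OF vanishing_poly[OF F]]) simp
    ultimately show "F u = 0" by simp
  qed
  thus ?case using ne by (intro exI[of _ "\<lambda>_ _. 0"] exI[of _ "\<lambda>_. 1"]) (auto intro: poly_fun.const)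
next
  case (Suc j)
  hence "N + j \<le> M" by simp
  from Suc.IH[OF this] obtain G h where h: "h \<in> poly_fun M" "\<exists>z\<in>V. h (\<xi> z) \<noteq> 0"
    and G': "\<forall>i<j. G i \<in> vanishing V (N + j) \<xi>"
    and Gh': "\<forall>x\<in>V. \<forall>v\<in>carrier_vec M. h (\<xi> x) \<noteq> 0 \<and> (\<forall>i<j. dd (G i) (\<xi> x) v = 0) \<longrightarrow>
       (\<forall>F\<in>vanishing V (N + j) \<xi>. dd F (\<xi> x) v = 0)"
    by (elim exE conjE)
  have G: "G i \<in> vanishing V (N + j) \<xi>" if "i < j" for i using G' that by blast
  have Gh: "dd F (\<xi> x) v = 0" if "x \<in> V" "v \<in> carrier_vec M" "h (\<xi> x) \<noteq> 0"
    "\<And>i. i < j \<Longrightarrow> dd (G i) (\<xi> x) v = 0" "F \<in> vanishing V (N + j) \<xi>" for x v F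
    using Gh' that by blast
  obtain Q a where Q: "Q \<in> vanishing V (Suc (N + j)) \<xi>" and a: "a \<in> poly_fun (N + j)" "\<exists>z\<in>V. a (\<xi> z) \<noteq> 0"
    and Qa: "\<And>F x v. F \<in> vanishing V (Suc (N + j)) \<xi> \<Longrightarrow> x \<in> V \<Longrightarrow> a (\<xi> x) \<noteq> 0 \<Longrightarrow> v \<in> carrier_vec M \<Longrightarrow>
       dd Q (\<xi> x) v = 0 \<Longrightarrow> (\<And>r. r \<in> vanishing V (N + j) \<xi> \<Longrightarrow> dd r (\<xi> x) v = 0) \<Longrightarrow> dd F (\<xi> x) v = 0"
    by (rule one_more_equation[OF _ _ ne, of \<xi> M "N + j"]) (use carr Suc.prems in auto)
  have aM: "a \<in> poly_fun M" using a(1) Suc.prems by (auto intro: poly_fun_mono)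
  define G' where "G' = (\<lambda>i. if i < j then G i else Q)"
  define h' where "h' = (\<lambda>z. h z * a z)"
  have "h' \<in> poly_fun M" unfolding h'_def by (intro poly_fun.mult h aM)
  moreover have "\<exists>z\<in>V. h' (\<xi> z) \<noteq> 0" unfolding h'_def by (rule prime[OF h(1) aM h(2) a(2)])
  moreover have "G' i \<in> vanishing V (N + Suc j) \<xi>" if "i < Suc j" for i
  proof (cases "i < j")
    case True
    from G[OF this] show ?thesis using True by (auto simp: G'_def vanishing_def intro: poly_fun_mono)
  qed (use Q in \<open>simp add: G'_def\<close>)
  moreover have "dd F (\<xi> x) v = 0"
    if x: "x \<in> V" and v: "v \<in> carrier_vec M" and hx: "h' (\<xi> x) \<noteq> 0"
      and dG: "\<And>i. i < Suc j \<Longrightarrow> dd (G' i) (\<xi> x) v = 0" and F: "F \<in> vanishing V (N + Suc j) \<xi>" for x v F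
  proof (rule Qa[OF _ x _ v])
    show "F \<in> vanishing V (Suc (N + j)) \<xi>" using F by simp
    show "a (\<xi> x) \<noteq> 0" using hx by (simp add: h'_def)
    show "dd Q (\<xi> x) v = 0" using dG[of j] by (simp add: G'_def)
    show "dd r (\<xi> x) v = 0" if "r \<in> vanishing V (N + j) \<xi>" for r
    proof (rule Gh[OF x v _ _ that])
      show "h (\<xi> x) \<noteq> 0" using hx by (simp add: h'_def)
      show "dd (G i) (\<xi> x) v = 0" if "i < j" for i using dG[of i] that by (simp add: G'_def)
    qed
  qed
  ultimately show ?case by (intro exI[of _ G'] exI[of _ h']) blast
qed

text \<open>The square matrix \<open>A\<close> consists of the \<open>M - N\<close> differentials,
  the \<open>d\<close> rows that read off the coordinates from \<open>s\<close> on, and zero rows.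
  For \<open>d \<le> N\<close> all these rows fit, and the kernel is zero by \<open>inj\<close>: so
  there is no room for a zero row, and for \<open>N = d\<close> every right-hand side can be
  solved.\<close>

lemma tangent_equations_count:
  fixes \<xi> :: "'a \<Rightarrow> 'k::field_char_0 vec"
  assumes x: "\<xi> x \<in> carrier_vec M" and NM: "N \<le> M" "s + d \<le> M"
    and G: "\<And>i. i < M - N \<Longrightarrow> G i \<in> poly_fun M"
    and eqs: "\<And>v. v \<in> carrier_vec M \<Longrightarrow> (\<And>i. i < M - N \<Longrightarrow> dd (G i) (\<xi> x) v = 0) \<Longrightarrow> v \<in> tangent_vectors V M \<xi> x"
    and inj: "\<And>v. v \<in> tangent_vectors V M \<xi> x \<Longrightarrow> (\<And>i. i < d \<Longrightarrow> v $ (s + i) = 0) \<Longrightarrow> v = 0\<^sub>v M"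
  shows "N \<le> d" and "N = d \<Longrightarrow> \<exists>v\<in>tangent_vectors V M \<xi> x. \<forall>i<d. v $ (s + i) = b i"
proof -
  define A where "A = mat M M (\<lambda>(i, j). if i < M - N then dd (G i) (\<xi> x) (unit_vec M j)
    else if i < M - N + d then (if j = s + (i - (M - N)) then 1 else 0) else 0)"
  have A: "A \<in> carrier_mat M M" by (simp add: A_def)
  have Av: "(A *\<^sub>v v) $ i = (\<Sum>j<M. A $$ (i, j) * v $ j)" if "v \<in> carrier_vec M" "i < M" for v i
    using that A by (auto simp: scalar_prod_def lessThan_atLeast0 intro!: sum.cong)
  have AG: "(A *\<^sub>v v) $ i = dd (G i) (\<xi> x) v" if v: "v \<in> carrier_vec M" and i: "i < M - N" for v i
    unfolding dd_linear_combination[OF G[OF i] x v] using i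
    by (subst Av[OF v]) (auto simp: A_def intro!: sum.cong)
  have Aw: "(A *\<^sub>v v) $ (M - N + i) = v $ (s + i)"
    if v: "v \<in> carrier_vec M" and i: "i < d" "M - N + i < M" for v i
  proof -
    have "(A *\<^sub>v v) $ (M - N + i) = (\<Sum>j<M. (if j = s + i then 1 else 0) * v $ j)"
      using i by (subst Av[OF v]) (auto simp: A_def intro!: sum.cong)
    also have "\<dots> = (\<Sum>j\<in>{s + i}. (if j = s + i then 1 else 0) * v $ j)"
      using i NM by (intro sum.mono_neutral_right) auto
    finally show ?thesis by simp
  qed
  show "N \<le> d"
  proof (rule ccontr)
    assume "\<not> N \<le> d"
    \<comment> \<open>The last row of \<open>A\<close> is then zero.\<close>
    hence "M - 1 < M" "M - N + d \<le> M - 1" using NM by auto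
    hence "\<exists>v. v \<in> carrier_vec M \<and> v \<noteq> 0\<^sub>v M \<and> A *\<^sub>v v = 0\<^sub>v M"
      by (intro det_zero_row[OF A, of "M - 1"]) (auto simp: A_def)
    then obtain v where v: "v \<in> carrier_vec M" "v \<noteq> 0\<^sub>v M" "A *\<^sub>v v = 0\<^sub>v M" by blast
    have "v \<in> tangent_vectors V M \<xi> x"
      by (rule eqs[OF v(1)]) (use AG[OF v(1)] v(3) in auto)
    moreover have "v $ (s + i) = 0" if "i < d" for i
      using Aw[OF v(1) that] v(3) that \<open>\<not> N \<le> d\<close> NM by auto
    ultimately show False using inj v(2) by blast
  qed
  show "\<exists>v\<in>tangent_vectors V M \<xi> x. \<forall>i<d. v $ (s + i) = b i" if "N = d"
  proof -
    have injA: "v = 0\<^sub>v M" if v: "v \<in> carrier_vec M" "A *\<^sub>v v = 0\<^sub>v M" for v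
    proof (rule inj)
      show "v \<in> tangent_vectors V M \<xi> x"
        by (rule eqs[OF v(1)]) (use AG[OF v(1)] v(2) in auto)
      show "v $ (s + i) = 0" if "i < d" for i
        using Aw[OF v(1) that] v(2) that \<open>N = d\<close> NM by auto
    qed
    define c where "c = vec M (\<lambda>i. if i < M - N then 0 else b (i - (M - N)))"
    obtain v where v: "v \<in> carrier_vec M" "A *\<^sub>v v = c"
      using mat_mult_vec_solvable[OF A injA, of c] by (auto simp: c_def)
    have "v \<in> tangent_vectors V M \<xi> x"
      by (rule eqs[OF v(1)]) (use AG[OF v(1)] v(2) in \<open>auto simp: c_def\<close>)
    moreover have "v $ (s + i) = b i" if "i < d" for i
    proof -
      have idx: "M - N + i < M" using that \<open>N = d\<close> NM by simp
      have "v $ (s + i) = c $ (M - N + i)" using Aw[OF v(1) that idx] v(2) by simp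
      also have "\<dots> = b i"
        unfolding c_def index_vec[OF idx] by (simp only: not_add_less1 if_False diff_add_inverse)
      finally show ?thesis .
    qed
    ultimately show ?thesis by blast
  qed
qed

section \<open>Krull dimension\<close>

lemma irreducible_space_Int:
  assumes T: "irreducible_space T" and A: "openin T A" "A \<noteq> {}" and B: "openin T B" "B \<noteq> {}"
  shows "A \<inter> B \<noteq> {}"
proof
  assume e: "A \<inter> B = {}"
  have "closedin T (topspace T - A)" "closedin T (topspace T - B)" using A B by auto
  moreover have "(topspace T - A) \<union> (topspace T - B) = topspace T" using e by auto
  ultimately have "topspace T - A = topspace T \<or> topspace T - B = topspace T"
    using T unfolding irreducible_space_def by blast
  thus False using A B openin_subset[OF A(1)] openin_subset[OF B(1)] by blast
qed

definition closed_chain :: "'a topology \<Rightarrow> nat \<Rightarrow> (nat \<Rightarrow> 'a set) \<Rightarrow> bool" where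
  "closed_chain T N C \<longleftrightarrow> (\<forall>i\<le>N. closedin T (C i) \<and> irreducible_space (subtopology T (C i))) \<and>
     (\<forall>i<N. C i \<subset> C (Suc i))"

lemma closed_chainD:
  assumes "closed_chain T N C"
  shows "i \<le> N \<Longrightarrow> closedin T (C i)" "i \<le> N \<Longrightarrow> irreducible_space (subtopology T (C i))"
    "i < N \<Longrightarrow> C i \<subset> C (Suc i)"
  using assms unfolding closed_chain_def by auto

lemma krull_dim_ge: "closed_chain T N C \<Longrightarrow> enat N \<le> krull_dim T"
  unfolding krull_dim_def closed_chain_def by (intro Sup_upper) blast

text \<open>Chains can be truncated, so a supremum of at least \<open>N\<close> gives one of length
  exactly \<open>N\<close>. For \<open>N = 0\<close> this fails on the empty space, where the
  supremum over no chains is 0.\<close>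

lemma krull_dim_chain:
  assumes "enat N \<le> krull_dim T" "N \<ge> 1"
  obtains C where "closed_chain T N C"
proof (rule ccontr)
  assume "\<not> thesis"
  hence none: "\<not> closed_chain T N C" for C using that by blast
  have "krull_dim T \<le> enat (N - 1)"
    unfolding krull_dim_def closed_chain_def[symmetric]
  proof (rule Sup_least)
    fix x assume "x \<in> {enat N |N. \<exists>C. closed_chain T N C}"
    then obtain N' C where N': "x = enat N'" "closed_chain T N' C" by blast
    have "\<not> N \<le> N'"
    proof
      assume "N \<le> N'"
      hence "closed_chain T N C" using N'(2) unfolding closed_chain_def by auto
      thus False using none by blast
    qed
    thus "x \<le> enat (N - 1)" using N' by auto
  qed
  hence "enat N \<le> enat (N - 1)" using assms(1) by (rule order_trans[rotated])
  thus False using assms(2) by simp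
qed

lemma irreducible_zero_product:
  fixes \<xi> :: "'a \<Rightarrow> 'k::field vec"
  assumes c: "chart X V m \<xi>" and C: "C \<subseteq> V"
    and irr: "irreducible_space (subtopology (zar X) C)"
    and p: "p \<in> poly_fun m" "z \<in> C" "p (\<xi> z) \<noteq> 0" and q: "q \<in> poly_fun m" "z' \<in> C" "q (\<xi> z') \<noteq> 0"
  obtains u where "u \<in> C" "p (\<xi> u) \<noteq> 0" "q (\<xi> u) \<noteq> 0"
proof -
  have op: "openin (subtopology (zar X) C) {x \<in> C. r (\<xi> x) \<noteq> 0}" if "r \<in> poly_fun m" for r
    unfolding openin_subtopology using C
    by (intro exI[of _ "{x \<in> V. r (\<xi> x) \<noteq> 0}"] conjI chart_nonzero_openin[OF c that]) auto
  have "{x \<in> C. p (\<xi> x) \<noteq> 0} \<inter> {x \<in> C. q (\<xi> x) \<noteq> 0} \<noteq> {}"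
    by (rule irreducible_space_Int[OF irr op[OF p(1)] _ op[OF q(1)]]) (use p q in auto)
  thus thesis using that by auto
qed

text \<open>Let \<open>f i\<close> vanish on \<open>C i\<close> but not on \<open>C (Suc i)\<close>.
  On \<open>C j\<close> a relation between \<open>f 0\<close>, ..., \<open>f j\<close> reduces to
  the coefficient that is free of \<open>f j\<close>, which is zero by induction. On the irreducible
  set \<open>C (Suc j)\<close> a factor \<open>f j\<close> can then be cancelled from the rest, and
  the argument repeats.\<close>

lemma chain_alg_independent:
  fixes \<xi> :: "'a \<Rightarrow> 'k::field vec"
  assumes swf: "space_with_functions X" and c: "chart X V m \<xi>"
    and ch: "closed_chain (subtopology (zar X) V) N C"
  obtains f where "\<And>i. i < N \<Longrightarrow> f i \<in> poly_fun m" "alg_independent (C N) N (\<lambda>z. vec N (\<lambda>i. f i (\<xi> z)))"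
proof -
  let ?T = "subtopology (zar X) V"
  note V = chart_openin[OF c] and chD = closed_chainD[OF ch]
  have top: "topspace ?T = V" using openin_subset[OF V] by auto
  have CV: "C i \<subseteq> V" if "i \<le> N" for i using closedin_subset[OF chD(1)[OF that]] top by simp
  have sub: "subtopology ?T (C i) = subtopology (zar X) (C i)" if "i \<le> N" for i
    using CV[OF that] by (simp add: subtopology_subtopology Int_absorb1)
  have "\<exists>f\<in>poly_fun m. (\<forall>z\<in>C i. f (\<xi> z) = 0) \<and> (\<exists>z\<in>C (Suc i). f (\<xi> z) \<noteq> 0)" if i: "i < N" for i
  proof -
    obtain x where x: "x \<in> C (Suc i)" "x \<notin> C i" using chD(3)[OF i] by blast
    have "openin ?T (V - C i)" using chD(1)[of i] i top by (metis closedin_def less_imp_le_nat)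
    hence o: "openin (zar X) (V - C i)" using V by (simp add: openin_open_subtopology)
    have xV: "x \<in> V" using x CV[of "Suc i"] i by auto
    obtain q where "q \<in> poly_fun m" "q (\<xi> x) \<noteq> 0" "\<And>z. z \<in> V \<Longrightarrow> q (\<xi> z) \<noteq> 0 \<Longrightarrow> z \<in> V - C i"
      using chart_basis[OF swf c o _ xV] x xV by blast
    thus ?thesis using x CV[of i] i by (intro bexI[of _ q]) auto
  qed
  then obtain f where f: "\<And>i. i < N \<Longrightarrow> f i \<in> poly_fun m" "\<And>i z. i < N \<Longrightarrow> z \<in> C i \<Longrightarrow> f i (\<xi> z) = 0"
    "\<And>i. i < N \<Longrightarrow> \<exists>z\<in>C (Suc i). f i (\<xi> z) \<noteq> 0" by metis
  have "alg_independent (C j) j (\<lambda>z. vec j (\<lambda>i. f i (\<xi> z)))" if "j \<le> N" for j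
    using that
  proof (induction j)
    case 0
    have "topspace (subtopology ?T (C 0)) \<noteq> {}" using chD(2)[of 0] unfolding irreducible_space_def by blast
    then obtain z where z: "z \<in> C 0" by auto
    have "P v = 0" if "P \<in> poly_fun 0" "\<forall>z\<in>C 0. P (vec 0 (\<lambda>i. f i (\<xi> z))) = 0" for P and v :: "'k vec"
      using that z poly_fun_cong[OF that(1), of v "vec 0 (\<lambda>i. f i (\<xi> z))"] by auto
    thus ?case unfolding alg_independent_def by blast
  next
    case (Suc j)
    hence IH: "alg_independent (C j) j (\<lambda>z. vec j (\<lambda>i. f i (\<xi> z)))" and jN: "j < N" by auto
    let ?w = "\<lambda>z. vec (Suc j) (\<lambda>i. f i (\<xi> z))"
    have wpoly: "(\<lambda>u. p (vec (Suc j) (\<lambda>i. f i u))) \<in> poly_fun m" if "p \<in> poly_fun (Suc j)" for p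
      by (rule poly_fun_compose[OF that]) (use jN in \<open>auto intro: f(1)\<close>)
    have w0: "?w z $ j = 0" if "z \<in> C j" for z using f(2)[OF jN that] by simp
    obtain z0 where z0: "z0 \<in> C (Suc j)" "f j (\<xi> z0) \<noteq> 0" using f(3)[OF jN] by blast
    have S: "c i v = 0"
      if "\<And>i. c i \<in> poly_fun j" "\<And>z. z \<in> C (Suc j) \<Longrightarrow> (\<Sum>i<n. c i (?w z) * ?w z $ j ^ i) = 0"
        "i < n" "v \<in> carrier_vec (Suc j)" for n i c v
      using that(1-3)
    proof (induction n arbitrary: c i)
      case 0
      thus ?case by simp
    next
      case (Suc n)
      have c0: "c 0 u = 0" if u: "u \<in> carrier_vec (Suc j)" for u
      proof -
        have "c 0 (vec j (\<lambda>i. f i (\<xi> z))) = 0" if z: "z \<in> C j" for z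
        proof -
          have "z \<in> C (Suc j)" using chD(3)[OF jN] z by blast
          from Suc.prems(2)[OF this] have "c 0 (?w z) = 0"
            unfolding sum.lessThan_Suc_shift w0[OF z] by simp
          moreover have "c 0 (?w z) = c 0 (vec j (\<lambda>i. f i (\<xi> z)))"
            by (rule poly_fun_cong[OF Suc.prems(1)]) auto
          ultimately show ?thesis by simp
        qed
        hence "c 0 (vec j (\<lambda>i. u $ i)) = 0"
          using IH Suc.prems(1)[of 0] unfolding alg_independent_def by (metis vec_carrier)
        moreover have "c 0 u = c 0 (vec j (\<lambda>i. u $ i))"
          by (rule poly_fun_cong[OF Suc.prems(1)]) auto
        ultimately show ?thesis by simp
      qed
      let ?R = "\<lambda>v. \<Sum>i<n. c (Suc i) v * v $ j ^ i"
      have R: "?R \<in> poly_fun (Suc j)"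
        by (intro poly_fun_sum poly_fun.mult poly_fun_power poly_fun.coord poly_fun_mono[OF Suc.prems(1)]) auto
      have Rz: "?R (?w z) = 0" if z: "z \<in> C (Suc j)" for z
      proof (rule ccontr)
        assume nz: "?R (?w z) \<noteq> 0"
        have irr: "irreducible_space (subtopology (zar X) (C (Suc j)))"
          using chD(2)[of "Suc j"] sub[of "Suc j"] jN by simp
        obtain u where u: "u \<in> C (Suc j)" "?R (?w u) \<noteq> 0" "f j (\<xi> u) \<noteq> 0"
          using irreducible_zero_product[OF c CV irr wpoly[OF R] z _ f(1)[OF jN] z0] nz jN by auto
        have "0 = (\<Sum>i<Suc n. c i (?w u) * ?w u $ j ^ i)" using Suc.prems(2)[OF u(1)] by simp
        also have "\<dots> = ?R (?w u) * f j (\<xi> u)"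
          unfolding sum.lessThan_Suc_shift sum_distrib_right using c0[of "?w u"]
          by (auto intro!: sum.cong simp: ac_simps)
        finally show False using u by simp
      qed
      show ?case
      proof (cases i)
        case 0
        thus ?thesis using c0 \<open>v \<in> _\<close> by simp
      next
        case (Suc i')
        thus ?thesis using Suc.IH[of "\<lambda>i. c (Suc i)" i'] Suc.prems Rz by simp
      qed
    qed
    show ?case unfolding alg_independent_def
    proof (intro ballI impI)
      fix P and v :: "'k vec"
      assume P: "P \<in> poly_fun (Suc j)" "\<forall>z\<in>C (Suc j). P (?w z) = 0" and v: "v \<in> carrier_vec (Suc j)"
      obtain n c where c: "\<And>i. c i \<in> poly_fun j" "P = (\<lambda>z. \<Sum>i\<le>n::nat. c i z * z $ j ^ i)"
        using poly_fun_last_var[OF P(1)] by blast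
      have "c i v = 0" if "i < Suc n" for i
        by (rule S[OF c(1) _ that v]) (use P(2) in \<open>auto simp: c(2) lessThan_Suc_atMost\<close>)
      thus "P v = 0" unfolding c(2) by (intro sum.neutral) auto
    qed
  qed
  thus thesis using that[of f] f(1) by blast
qed

section \<open>Coordinates at a fixed point\<close>

lemma der_sum: "der (\<lambda>p. \<Sum>j\<in>J. c j * B j p) U f = (\<Sum>j\<in>J. c j * der (B j) U f)"
  by (simp add: der_def)

text \<open>\<open>dual_basis\<close> is applied with the germs of the chart coordinates as points;
  they separate derivations by \<open>tangent_eq_0\<close>. The functions \<open>u i\<close> are
  linear combinations of the coordinates, hence defined on the whole chart.\<close>

lemma dual_functions:
  fixes X :: "('a, 'k::field_char_0) fspace"
  assumes swf: "space_with_functions X" and c: "chart X V m \<xi>" and x: "x \<in> V"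
    and d: "d = fun_dim (tangent_space X x)"
  obtains B u where "\<And>j. j < d \<Longrightarrow> B j \<in> tangent_space X x" "\<And>i. i < d \<Longrightarrow> regular_on X V (u i)"
    "\<And>i j. i < d \<Longrightarrow> j < d \<Longrightarrow> der (B j) V (u i) = (if i = j then 1 else 0)"
    "\<And>D. D \<in> tangent_space X x \<Longrightarrow> D = (\<lambda>p. \<Sum>j<d. der D V (u j) * B j p)"
proof -
  let ?q = "\<lambda>l. (V, restrict (\<lambda>z. \<xi> z $ l) V)"
  let ?T = "tangent_space X x"
  obtain B \<psi> where B': "\<And>j. j < fun_dim ?T \<Longrightarrow> B j \<in> ?T"
    and sp': "\<And>D. D \<in> ?T \<Longrightarrow> \<exists>c. D = (\<lambda>p. \<Sum>j<fun_dim ?T. c j * B j p)"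
    and \<psi>': "\<And>i j. i < fun_dim ?T \<Longrightarrow> j < fun_dim ?T \<Longrightarrow> (\<Sum>l<m. \<psi> i l * B j (?q l)) = (if i = j then 1 else 0)"
  proof (rule dual_basis[of ?T m ?q])
    show "fun_subspace ?T" by (rule subspace_tangent_space[OF swf])
    show "D = (\<lambda>_. 0)" if "D \<in> ?T" "\<And>l. l < m \<Longrightarrow> D (?q l) = 0" for D
      using tangent_eq_0[OF swf c x that(1)] that(2) by (simp add: der_def)
  qed (rule that)
  note B = B'[folded d] and sp = sp'[folded d] and \<psi> = \<psi>'[folded d]
  define u where "u i = (\<lambda>z. \<Sum>l<m. \<psi> i l * \<xi> z $ l)" for i
  have u: "regular_on X V (u i)" "der D V (u i) = (\<Sum>l<m. \<psi> i l * D (?q l))"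
    if "D \<in> tangent_space X x" for i D
    using tangent_sum[OF swf that chart_openin[OF c] x, of "{..<m}" "\<lambda>l z. \<xi> z $ l" "\<psi> i"] chart_coord[OF c]
    by (simp_all add: u_def der_def[of D V "\<lambda>z. \<xi> z $ _"])
  have dual: "der (B j) V (u i) = (if i = j then 1 else 0)" if "i < d" "j < d" for i j
    using u(2)[OF B[OF that(2)]] \<psi>[OF that] by simp
  have "D = (\<lambda>p. \<Sum>j<d. der D V (u j) * B j p)" if D: "D \<in> tangent_space X x" for D
  proof -
    obtain c where c: "D = (\<lambda>p. \<Sum>j<d. c j * B j p)" using sp[OF D] by blast
    have "der D V (u i) = c i" if "i < d" for i
    proof -
      have "der D V (u i) = (\<Sum>j<d. c j * (if i = j then 1 else 0))"
        unfolding c der_sum using dual that by (intro sum.cong) auto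
      also have "\<dots> = (\<Sum>j\<in>{i}. c j * (if i = j then 1 else 0))"
        using that by (intro sum.mono_neutral_right) auto
      also have "\<dots> = c i" by simp
      finally show ?thesis .
    qed
    thus ?thesis unfolding c by (intro ext sum.cong) auto
  qed
  thus thesis using that[of B u] B dual u(1)[OF B] by blast
qed

text \<open>\<open>E\<close> is the image of \<open>D\<close> under the differential of
  \<open>s\<close>. Germs at \<open>x\<close> pull back to germs at \<open>x\<close> because
  \<open>s\<close> fixes \<open>x\<close>.\<close>

lemma tangent_pullback:
  fixes X :: "('a, 'k::field) fspace"
  assumes swf: "space_with_functions X" and s: "morph_on X (points X) X s" and x: "x \<in> points X" "s x = x"
    and D: "D \<in> tangent_space X x"
  obtains E where "E \<in> tangent_space X x"
    "\<And>U f. regular_on X U f \<Longrightarrow> x \<in> U \<Longrightarrow> der E U f = der D {z \<in> points X. s z \<in> U} (\<lambda>z. f (s z))"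
proof -
  let ?U = "\<lambda>U. {z \<in> points X. s z \<in> U}"
  define E where "E = (\<lambda>(U, f). if (U, f) \<in> local_functions X x then der D (?U U) (\<lambda>z. f (s z)) else 0)"
  have r: "regular_on X (?U U) (\<lambda>z. f (s z))" if "regular_on X U f" for U f
    by (rule morph_on_pullback[OF s that])
  have E: "der E U f = der D (?U U) (\<lambda>z. f (s z))" if "regular_on X U f" "x \<in> U" for U f
  proof -
    have "(U, restrict f U) \<in> local_functions X x"
      using that by (simp add: local_functions_def regular_on_def)
    hence "der E U f = der D (?U U) (\<lambda>z. restrict f U (s z))" by (simp add: E_def der_def)
    also have "\<dots> = der D (?U U) (\<lambda>z. f (s z))" by (rule der_cong) simp
    finally show ?thesis .
  qed
  note TD = tangent_spaceD[OF swf D]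
  have xU: "x \<in> ?U U" if "x \<in> U" for U using x that by simp
  have "E \<in> tangent_space X x"
  proof (rule tangent_spaceI[OF swf], goal_cases)
    case (1 p) thus ?case by (cases p) (simp add: E_def)
  next
    case (2 U V f)
    have V: "regular_on X V f" "x \<in> U" using regular_on_subset[OF swf] 2 by auto
    have "der D (?U V) (\<lambda>z. f (s z)) = der D (?U U) (\<lambda>z. f (s z))"
      by (rule TD(2)[OF r xU]) (use 2 morph_on_vimage[OF s] in auto)
    thus ?case using E[OF V(1)] E[OF 2(1)] V 2 by simp
  next
    case (3 U f g)
    note reg = regular_on_add[OF swf 3(1,2)]
    show ?case unfolding E[OF 3(1,3)] E[OF 3(2,3)] E[OF reg 3(3)]
      by (rule TD(3)[OF r[OF 3(1)] r[OF 3(2)] xU[OF 3(3)]])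
  next
    case (4 U f g)
    note reg = regular_on_mult[OF swf 4(1,2)]
    show ?case unfolding E[OF 4(1,3)] E[OF 4(2,3)] E[OF reg 4(3)]
      using TD(4)[OF r[OF 4(1)] r[OF 4(2)] xU[OF 4(3)]] x(2) by simp
  next
    case (5 U f c)
    note reg = regular_on_mult[OF swf regular_on_const[OF swf regular_onD[OF 5(1)]] 5(1)]
    show ?case unfolding E[OF 5] E[OF reg 5(2)] by (rule TD(5)[OF r[OF 5(1)] xU[OF 5(2)]])
  qed
  thus thesis using that E by blast
qed

text \<open>Averaging functions \<open>u\<close> dual to a basis of the tangent space over \<open>G\<close>, twisted by the tangent
  representation, makes them equivariant and keeps their differentials up to the factor \<open>card G\<close>.\<close>

lemma equivariant_coordinates:
  fixes X :: "('a, 'k::field_char_0) fspace" and G :: "('g, 'n) monoid_scheme"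
  assumes X: "prevariety X" and G: "group G" "finite (carrier G)" and act: "regular_action G X \<sigma>"
    and fix_y: "\<And>g. g \<in> carrier G \<Longrightarrow> \<sigma> g y = y" and c: "chart X V0 m \<xi>" and y: "y \<in> V0"
    and d: "d = fun_dim (tangent_space X y)"
  obtains V w \<alpha> where "openin (zar X) V" "y \<in> V" "V \<subseteq> V0"
    "\<And>g x. g \<in> carrier G \<Longrightarrow> x \<in> V \<Longrightarrow> \<sigma> g x \<in> V"
    "\<And>x. w x \<in> carrier_vec d" "\<And>i. i < d \<Longrightarrow> regular_on X V (\<lambda>x. w x $ i)"
    "\<And>g. \<alpha> g \<in> carrier_mat d d" "\<alpha> \<one>\<^bsub>G\<^esub> = 1\<^sub>m d"
    "\<And>g h. g \<in> carrier G \<Longrightarrow> h \<in> carrier G \<Longrightarrow> \<alpha> (g \<otimes>\<^bsub>G\<^esub> h) = \<alpha> g * \<alpha> h"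
    "\<And>g x. g \<in> carrier G \<Longrightarrow> x \<in> V \<Longrightarrow> w (\<sigma> g x) = \<alpha> g *\<^sub>v w x"
    "\<And>D. D \<in> tangent_space X y \<Longrightarrow> (\<And>i. i < d \<Longrightarrow> der D V (\<lambda>x. w x $ i) = 0) \<Longrightarrow> D = (\<lambda>_. 0)"
proof -
  interpret G: group G by (rule G(1))
  interpret act: group_action G "points X" \<sigma> using act by (simp add: regular_action_def)
  note swf = prevariety_swf[OF X]
  have mor: "morph_on X (points X) X (\<sigma> g)" if "g \<in> carrier G" for g
    using act that unfolding regular_action_def morphism_iff[OF swf] by blast
  note V0 = chart_openin[OF c]
  have V0p: "V0 \<subseteq> points X" by (rule openin_subset[OF V0])
  have yp: "y \<in> points X" using y V0p by blast
  have one: "\<sigma> \<one>\<^bsub>G\<^esub> x = x" if "x \<in> points X" for x using fun_cong[OF act.id_eq_one, of x] that by simp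
  have clo: "\<sigma> g x \<in> points X" if "g \<in> carrier G" "x \<in> points X" for g x using act.element_image that by blast
  obtain B u where B: "\<And>j. j < d \<Longrightarrow> B j \<in> tangent_space X y"
    and u: "\<And>i. i < d \<Longrightarrow> regular_on X V0 (u i)"
    and dual: "\<And>i j. i < d \<Longrightarrow> j < d \<Longrightarrow> der (B j) V0 (u i) = (if i = j then 1 else 0)"
    and exp: "\<And>D. D \<in> tangent_space X y \<Longrightarrow> D = (\<lambda>p. \<Sum>j<d. der D V0 (u j) * B j p)"
    using dual_functions[OF swf c y d] by blast
  define W where "W g = {x \<in> points X. \<sigma> g x \<in> V0}" for g
  have Wo: "openin (zar X) (W g)" if "g \<in> carrier G" for g
    unfolding W_def by (rule morph_on_vimage[OF mor[OF that] V0])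
  have yW: "y \<in> W g" if "g \<in> carrier G" for g using fix_y[OF that] y yp by (simp add: W_def)
  \<comment> \<open>The matrix of the differential of \<open>\<sigma> g\<close> at \<open>y\<close>
    in the basis \<open>B\<close>, computed with the dual functions \<open>u\<close>.\<close>
  define a where "a g i j = der (B j) (W g) (\<lambda>x. u i (\<sigma> g x))" for g i j
  have ru: "regular_on X (W g) (\<lambda>x. u i (\<sigma> g x))" if "g \<in> carrier G" "i < d" for g i
    unfolding W_def by (rule morph_on_pullback[OF mor[OF that(1)] u[OF that(2)]])
  have a1: "a \<one>\<^bsub>G\<^esub> i j = (if i = j then 1 else 0)" if "i < d" "j < d" for i j
  proof -
    have "W \<one>\<^bsub>G\<^esub> = V0" using V0p one by (auto simp: W_def)
    hence "a \<one>\<^bsub>G\<^esub> i j = der (B j) V0 (\<lambda>x. u i (\<sigma> \<one>\<^bsub>G\<^esub> x))" by (simp add: a_def)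
    also have "\<dots> = der (B j) V0 (u i)" using V0p by (intro der_cong) (auto simp: one)
    finally show ?thesis using dual[OF that] by simp
  qed
  have amult: "a (g \<otimes>\<^bsub>G\<^esub> h) l j = (\<Sum>i<d. a g l i * a h i j)"
    if g: "g \<in> carrier G" and h: "h \<in> carrier G" and l: "l < d" and j: "j < d" for g h l j
  proof -
    \<comment> \<open>Chain rule: \<open>E\<close> is the image of \<open>B j\<close> under the
      differential of \<open>\<sigma> h\<close>, and its coordinates in the basis \<open>B\<close>
      are \<open>a h i j\<close>.\<close>
    obtain E where ET: "E \<in> tangent_space X y"
      and E: "\<And>U f. regular_on X U f \<Longrightarrow> y \<in> U \<Longrightarrow> der E U f = der (B j) {z \<in> points X. \<sigma> h z \<in> U} (\<lambda>z. f (\<sigma> h z))"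
      using tangent_pullback[OF swf mor[OF h] yp fix_y[OF h] B[OF j]] by blast
    have Eu: "der E V0 (u i) = a h i j" if "i < d" for i
      using E[OF u[OF that] y] by (simp add: a_def W_def)
    have "W (g \<otimes>\<^bsub>G\<^esub> h) = {z \<in> points X. \<sigma> h z \<in> W g}"
      using act.composition_rule[OF _ g h] clo[OF h] by (auto simp: W_def)
    hence "a (g \<otimes>\<^bsub>G\<^esub> h) l j = der (B j) {z \<in> points X. \<sigma> h z \<in> W g} (\<lambda>x. u l (\<sigma> (g \<otimes>\<^bsub>G\<^esub> h) x))"
      by (simp add: a_def)
    also have "\<dots> = der (B j) {z \<in> points X. \<sigma> h z \<in> W g} (\<lambda>x. u l (\<sigma> g (\<sigma> h x)))"
      by (rule der_cong) (simp add: act.composition_rule[OF _ g h])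
    also have "\<dots> = der E (W g) (\<lambda>x. u l (\<sigma> g x))"
      using E[OF ru[OF g l] yW[OF g]] by simp
    also have "\<dots> = (\<Sum>i<d. der E V0 (u i) * der (B i) (W g) (\<lambda>x. u l (\<sigma> g x)))"
      by (subst exp[OF ET]) (rule der_sum)
    also have "\<dots> = (\<Sum>i<d. a g l i * a h i j)"
      by (intro sum.cong) (auto simp: Eu a_def mult.commute)
    finally show ?thesis .
  qed
  \<comment> \<open>Intersecting all translates of \<open>V0\<close> gives a stable neighbourhood of
    \<open>y\<close>; finiteness of \<open>G\<close> keeps it open.\<close>
  define V where "V = V0 \<inter> ((\<Inter>g\<in>carrier G. W g) \<inter> points X)"
  have Vo: "openin (zar X) V" unfolding V_def
    by (intro openin_Int V0 openin_INT G(2) Wo)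
  have Vp: "V \<subseteq> points X" by (auto simp: V_def)
  have yV: "y \<in> V" using y yW yp by (auto simp: V_def)
  have VW: "V \<subseteq> W g" if "g \<in> carrier G" for g using that by (auto simp: V_def)
  have stable: "\<sigma> g x \<in> V" if g: "g \<in> carrier G" and x: "x \<in> V" for g x
  proof -
    have xp: "x \<in> points X" using x Vp by blast
    have "\<sigma> g x \<in> V0" using VW[OF g] x by (auto simp: W_def)
    moreover have "\<sigma> g x \<in> W h" if h: "h \<in> carrier G" for h
      using act.composition_rule[OF xp h g] VW[OF G.m_closed[OF h g]] x clo[OF g xp] by (auto simp: W_def)
    ultimately show ?thesis using clo[OF g xp] by (auto simp: V_def)
  qed
  let ?I = "carrier G \<times> {..<d}"
  \<comment> \<open>Replacing the summation index \<open>g\<close> by \<open>g h\<close> shows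
    equivariance. At \<open>y\<close> the differential in the basis \<open>B\<close> is the sum of
    the products of the matrices for the inverse of \<open>g\<close> and for \<open>g\<close>, that
    is, \<open>card (carrier G)\<close> times the identity.\<close>
  define w where "w x = vec d (\<lambda>i. \<Sum>(g, l)\<in>?I. a (inv\<^bsub>G\<^esub> g) i l * u l (\<sigma> g x))" for x
  define \<alpha> where "\<alpha> g = mat d d (\<lambda>(i, j). a g i j)" for g
  have ruV: "regular_on X V (\<lambda>x. u (snd gl) (\<sigma> (fst gl) x))" if "gl \<in> ?I" for gl
    using that by (intro regular_on_subset[OF swf ru Vo VW]) auto
  have w_i: "(\<lambda>x. w x $ i) = (\<lambda>x. \<Sum>gl\<in>?I. a (inv\<^bsub>G\<^esub> (fst gl)) i (snd gl) * u (snd gl) (\<sigma> (fst gl) x))" if "i < d" for i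
    using that by (simp add: w_def case_prod_beta)
  have w_der: "regular_on X V (\<lambda>x. w x $ i) \<and> der D V (\<lambda>x. w x $ i) =
      (\<Sum>gl\<in>?I. a (inv\<^bsub>G\<^esub> (fst gl)) i (snd gl) * der D V (\<lambda>x. u (snd gl) (\<sigma> (fst gl) x)))"
    if "i < d" "D \<in> tangent_space X y" for i D
    unfolding w_i[OF that(1)] by (rule tangent_sum[OF swf that(2) Vo yV]) (rule ruV)
  have sum_a: "(\<Sum>l<d. a g i l * a h l j) = a (g \<otimes>\<^bsub>G\<^esub> h) i j"
    if "g \<in> carrier G" "h \<in> carrier G" "i < d" "j < d" for g h i j
    using amult[OF that] by simp
  have wB: "der (B j) V (\<lambda>x. w x $ i) = of_nat (card (carrier G)) * (if i = j then 1 else 0)"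
    if i: "i < d" and j: "j < d" for i j
  proof -
    have "der (B j) V (\<lambda>x. w x $ i) = (\<Sum>gl\<in>?I. a (inv\<^bsub>G\<^esub> (fst gl)) i (snd gl) * a (fst gl) (snd gl) j)"
    proof (subst conjunct2[OF w_der[OF i B[OF j]]], rule sum.cong[OF refl])
      fix gl assume gl: "gl \<in> ?I"
      have "der (B j) V (\<lambda>x. u (snd gl) (\<sigma> (fst gl) x)) = a (fst gl) (snd gl) j"
        unfolding a_def using gl by (intro tangent_spaceD(2)[OF swf B[OF j] ru yV Vo VW]) auto
      thus "a (inv\<^bsub>G\<^esub> (fst gl)) i (snd gl) * der (B j) V (\<lambda>x. u (snd gl) (\<sigma> (fst gl) x)) =
          a (inv\<^bsub>G\<^esub> (fst gl)) i (snd gl) * a (fst gl) (snd gl) j" by simp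
    qed
    also have "\<dots> = (\<Sum>g\<in>carrier G. \<Sum>l<d. a (inv\<^bsub>G\<^esub> g) i l * a g l j)"
      by (simp add: sum.cartesian_product case_prod_beta)
    also have "\<dots> = (\<Sum>g\<in>carrier G. if i = j then 1 else 0)"
      using i j by (intro sum.cong refl) (simp add: sum_a a1)
    finally show ?thesis by simp
  qed
  have cardG: "of_nat (card (carrier G)) \<noteq> (0::'k)"
    using G(2) G.one_closed by (metis card_0_eq empty_iff of_nat_eq_0_iff)
  have J: "D = (\<lambda>_. 0)" if D: "D \<in> tangent_space X y" and D0: "\<And>i. i < d \<Longrightarrow> der D V (\<lambda>x. w x $ i) = 0" for D
  proof -
    have "der D V0 (u i) = 0" if i: "i < d" for i
    proof -
      have "0 = der D V (\<lambda>x. w x $ i)" using D0[OF i] by simp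
      also have "\<dots> = (\<Sum>j<d. der D V0 (u j) * der (B j) V (\<lambda>x. w x $ i))"
        by (subst exp[OF D]) (rule der_sum)
      also have "\<dots> = (\<Sum>j<d. if i = j then of_nat (card (carrier G)) * der D V0 (u j) else 0)"
        by (intro sum.cong refl) (simp add: wB[OF i])
      also have "\<dots> = of_nat (card (carrier G)) * der D V0 (u i)" using i by simp
      finally show ?thesis using cardG by simp
    qed
    thus ?thesis using exp[OF D] by (simp add: fun_eq_iff)
  qed
  have equi: "w (\<sigma> h x) = \<alpha> h *\<^sub>v w x" if h: "h \<in> carrier G" and x: "x \<in> V" for h x
  proof (rule eq_vecI)
    show "dim_vec (w (\<sigma> h x)) = dim_vec (\<alpha> h *\<^sub>v w x)" by (simp add: w_def \<alpha>_def)
    fix i assume "i < dim_vec (\<alpha> h *\<^sub>v w x)"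
    hence i: "i < d" by (simp add: \<alpha>_def)
    have xp: "x \<in> points X" using x Vp by blast
    have "(\<alpha> h *\<^sub>v w x) $ i = (\<Sum>k<d. a h i k * w x $ k)"
      using i by (simp add: \<alpha>_def scalar_prod_def w_def lessThan_atLeast0)
    also have "\<dots> = (\<Sum>k<d. \<Sum>g\<in>carrier G. \<Sum>l<d. a h i k * (a (inv\<^bsub>G\<^esub> g) k l * u l (\<sigma> g x)))"
      by (intro sum.cong refl) (simp add: w_def sum.cartesian_product[symmetric] sum_distrib_left)
    also have "\<dots> = (\<Sum>g\<in>carrier G. \<Sum>k<d. \<Sum>l<d. a h i k * (a (inv\<^bsub>G\<^esub> g) k l * u l (\<sigma> g x)))"
      by (rule sum.swap)
    also have "\<dots> = (\<Sum>g\<in>carrier G. \<Sum>l<d. (\<Sum>k<d. a h i k * a (inv\<^bsub>G\<^esub> g) k l) * u l (\<sigma> g x))"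
    proof (rule sum.cong[OF refl])
      fix g assume "g \<in> carrier G"
      show "(\<Sum>k<d. \<Sum>l<d. a h i k * (a (inv\<^bsub>G\<^esub> g) k l * u l (\<sigma> g x))) =
          (\<Sum>l<d. (\<Sum>k<d. a h i k * a (inv\<^bsub>G\<^esub> g) k l) * u l (\<sigma> g x))"
        unfolding sum_distrib_right by (subst sum.swap) (simp add: mult.assoc)
    qed
    also have "\<dots> = (\<Sum>g\<in>carrier G. \<Sum>l<d. a (h \<otimes>\<^bsub>G\<^esub> inv\<^bsub>G\<^esub> g) i l * u l (\<sigma> g x))"
      using i h by (intro sum.cong refl) (simp add: sum_a)
    also have "\<dots> = (\<Sum>g\<in>carrier G. \<Sum>l<d. a (inv\<^bsub>G\<^esub> g) i l * u l (\<sigma> (g \<otimes>\<^bsub>G\<^esub> h) x))"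
    proof (rule sum.reindex_bij_witness[of _ "\<lambda>g. g \<otimes>\<^bsub>G\<^esub> h" "\<lambda>g. g \<otimes>\<^bsub>G\<^esub> inv\<^bsub>G\<^esub> h"], goal_cases)
      case (5 g)
      have "h \<otimes>\<^bsub>G\<^esub> inv\<^bsub>G\<^esub> g = inv\<^bsub>G\<^esub> (g \<otimes>\<^bsub>G\<^esub> inv\<^bsub>G\<^esub> h)" using 5 h by (simp add: G.inv_mult_group)
      moreover have "g \<otimes>\<^bsub>G\<^esub> inv\<^bsub>G\<^esub> h \<otimes>\<^bsub>G\<^esub> h = g" using 5 h by (simp add: G.m_assoc)
      ultimately show ?case by simp
    qed (use h in \<open>simp_all add: G.m_assoc\<close>)
    also have "\<dots> = w (\<sigma> h x) $ i"
      using i h xp by (simp add: w_def sum.cartesian_product[symmetric] act.composition_rule)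
    finally show "w (\<sigma> h x) $ i = (\<alpha> h *\<^sub>v w x) $ i" by simp
  qed
  have hom: "\<alpha> (g \<otimes>\<^bsub>G\<^esub> h) = \<alpha> g * \<alpha> h" if "g \<in> carrier G" "h \<in> carrier G" for g h
    by (rule eq_matI) (simp_all add: \<alpha>_def amult[OF that] scalar_prod_def lessThan_atLeast0)
  have \<alpha>1: "\<alpha> \<one>\<^bsub>G\<^esub> = 1\<^sub>m d"
    by (rule eq_matI) (simp_all add: \<alpha>_def a1)
  have T0: "(0 :: _ \<Rightarrow> 'k) \<in> tangent_space X y"
    by (rule tangent_spaceI[OF swf]) (simp_all add: der_zero)
  show thesis
  proof (rule that[of V w \<alpha>])
    show "V \<subseteq> V0" by (auto simp: V_def)
    show "w x \<in> carrier_vec d" for x by (simp add: w_def)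
    show "regular_on X V (\<lambda>x. w x $ i)" if "i < d" for i using w_der[OF that T0] by blast
    show "\<alpha> g \<in> carrier_mat d d" for g by (simp add: \<alpha>_def)
  qed (fact Vo yV stable \<alpha>1 hom equi J)+
qed

section \<open>Density, and coordinates with injective differential\<close>

lemma regular_on_density:
  assumes X: "prevariety X" and irr: "irreducible_space (zar X)" and f: "regular_on X V f"
    and O: "openin (zar X) O'" "O' \<noteq> {}" and z: "\<And>x. x \<in> O' \<Longrightarrow> x \<in> V \<Longrightarrow> f x = 0" and x: "x \<in> V"
  shows "f x = 0"
proof (rule ccontr)
  assume "f x \<noteq> 0"
  hence "O' \<inter> {x \<in> V. f x \<noteq> 0} \<noteq> {}"
    using x by (intro irreducible_space_Int[OF irr O regular_on_nonzero_openin[OF X f]]) auto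
  thus False using z by auto
qed

text \<open>Primality of the ideal of the chart, in the form required by
  \<open>generic_tangent_equations\<close>.\<close>

lemma chart_prime:
  fixes \<xi> :: "'a \<Rightarrow> 'k::field vec"
  assumes irr: "irreducible_space (zar X)" and c: "chart X V m \<xi>"
    and p: "p \<in> poly_fun m" "\<exists>z\<in>V. p (\<xi> z) \<noteq> 0" and q: "q \<in> poly_fun m" "\<exists>z\<in>V. q (\<xi> z) \<noteq> 0"
  shows "\<exists>z\<in>V. p (\<xi> z) * q (\<xi> z) \<noteq> 0"
proof -
  have "{z \<in> V. p (\<xi> z) \<noteq> 0} \<inter> {z \<in> V. q (\<xi> z) \<noteq> 0} \<noteq> {}"
    by (rule irreducible_space_Int[OF irr chart_nonzero_openin[OF c p(1)] _ chart_nonzero_openin[OF c q(1)]])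
      (use p q in auto)
  thus ?thesis by auto
qed

text \<open>Polynomials \<open>R l\<close> that agree on the variety with linear combinations of the first \<open>d\<close> coordinates
  and have the coordinate functionals as differentials at \<open>y\<close>. Their difference quotients form
  a matrix that is the identity at \<open>(y, y)\<close>.\<close>

lemma unramified_matrix:
  fixes X :: "('a, 'k::field_char_0) fspace"
  assumes swf: "space_with_functions X" and c: "chart X V m \<xi>" and y: "y \<in> V" and dm: "d \<le> m"
    and J: "\<And>v. v \<in> tangent_vectors V m \<xi> y \<Longrightarrow> (\<And>i. i < d \<Longrightarrow> v $ i = 0) \<Longrightarrow> v = 0\<^sub>v m"
  obtains H where "\<And>l k. l < m \<Longrightarrow> k < m \<Longrightarrow> H l k \<in> poly_fun (m + m)"
    "\<And>l k. l < m \<Longrightarrow> k < m \<Longrightarrow> H l k (\<xi> y @\<^sub>v \<xi> y) = (if l = k then 1 else 0)"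
    "\<And>x z l. x \<in> V \<Longrightarrow> z \<in> V \<Longrightarrow> (\<And>i. i < d \<Longrightarrow> \<xi> x $ i = \<xi> z $ i) \<Longrightarrow> l < m \<Longrightarrow>
       (\<Sum>k<m. H l k (\<xi> x @\<^sub>v \<xi> z) * (\<xi> x $ k - \<xi> z $ k)) = 0"
    "\<And>x v l. x \<in> V \<Longrightarrow> v \<in> tangent_vectors V m \<xi> x \<Longrightarrow> (\<And>i. i < d \<Longrightarrow> v $ i = 0) \<Longrightarrow> l < m \<Longrightarrow>
       (\<Sum>k<m. H l k (\<xi> x @\<^sub>v \<xi> x) * v $ k) = 0"
proof -
  note carr = chart_carrier[OF c]
  let ?lin = "\<lambda>b u. \<Sum>i<d. b i * (u::'k vec) $ i"
  have lin: "?lin b \<in> poly_fun m" for b :: "nat \<Rightarrow> 'k"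
    using dm by (intro poly_fun_sum poly_fun.mult poly_fun.const poly_fun.coord) auto
  have dd_lin: "dd (?lin b) x v = ?lin b v" if "x \<in> carrier_vec m" "v \<in> carrier_vec m" for b x v
  proof -
    have "dd (?lin b) x v = (\<Sum>i<d. dd (\<lambda>u. b i * u $ i) x v)"
      using dm that by (intro dd_sum[of _ _ m]) (auto intro!: poly_fun.intros)
    also have "\<dots> = ?lin b v"
    proof (intro sum.cong refl)
      fix i assume "i \<in> {..<d}"
      hence i: "i < m" using dm by auto
      show "dd (\<lambda>u. b i * u $ i) x v = b i * v $ i"
        using dd_cmult[OF poly_fun.coord[OF i] that] dd_coord[OF that i] by simp
    qed
    finally show ?thesis .
  qed
  define grad where "grad R = (\<lambda>l. if l < m then dd R (\<xi> y) (unit_vec m l) else 0)" for R :: "'k vec \<Rightarrow> 'k"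
  \<comment> \<open>Gradients at \<open>\<xi> y\<close> of all candidates for \<open>R l\<close>. A
    vector annihilated by \<open>L\<close> is tangent (take the linear part zero) and has vanishing
    first \<open>d\<close> coordinates (take \<open>F\<close> zero), so it is zero by
    \<open>J\<close>; therefore \<open>L\<close> contains every unit vector.\<close>
  define L where "L = {grad (\<lambda>u. F u + ?lin b u) | F b. F \<in> vanishing V m \<xi>}"
  have gradI: "grad R = g" if "\<And>l. l < m \<Longrightarrow> dd R (\<xi> y) (unit_vec m l) = g l" "\<And>l. l \<ge> m \<Longrightarrow> g l = 0" for R g
    using that by (auto simp: grad_def fun_eq_iff)
  have Rpoly: "(\<lambda>u. F u + ?lin b u) \<in> poly_fun m" if "F \<in> vanishing V m \<xi>" for F b
    by (intro poly_fun.add vanishing_poly[OF that] lin)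
  have "unit_fun l \<in> L" if l: "l < m" for l
  proof (rule unit_fun_in_subspace[OF _ _ _ l])
    show "fun_subspace L"
    proof (rule fun_subspaceI)
      have "grad (\<lambda>u. 0 + ?lin (\<lambda>_. 0) u) = 0" by (rule gradI) simp_all
      moreover have "(\<lambda>_. 0) \<in> vanishing V m \<xi>" by (auto simp: vanishing_def intro: poly_fun.const)
      ultimately show "0 \<in> L" unfolding L_def
        by (intro CollectI exI2[of _ "\<lambda>_. 0" "\<lambda>_. 0"] conjI) (rule sym)
    next
      fix f g assume "f \<in> L" "g \<in> L"
      then obtain F b F' b' where f: "f = grad (\<lambda>u. F u + ?lin b u)" "F \<in> vanishing V m \<xi>"
        and g: "g = grad (\<lambda>u. F' u + ?lin b' u)" "F' \<in> vanishing V m \<xi>" unfolding L_def by blast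
      have "(\<lambda>u. F u + F' u) \<in> vanishing V m \<xi>"
        using f(2) g(2) by (auto simp: vanishing_def intro: poly_fun.add)
      moreover have "grad (\<lambda>u. (F u + F' u) + ?lin (\<lambda>i. b i + b' i) u) = f + g"
      proof (rule gradI)
        fix l assume l: "l < m"
        have "(\<lambda>u. (F u + F' u) + ?lin (\<lambda>i. b i + b' i) u) = (\<lambda>u. (F u + ?lin b u) + (F' u + ?lin b' u))"
          by (simp add: fun_eq_iff distrib_right sum.distrib algebra_simps)
        thus "dd (\<lambda>u. (F u + F' u) + ?lin (\<lambda>i. b i + b' i) u) (\<xi> y) (unit_vec m l) = (f + g) l"
          using dd_add[OF Rpoly[OF f(2)] Rpoly[OF g(2)] carr[OF y] unit_vec_carrier, of b b' l] l
          by (simp add: f g grad_def)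
      qed (simp add: f g grad_def)
      ultimately show "f + g \<in> L" unfolding L_def by (intro CollectI exI2[of _ "\<lambda>u. F u + F' u" "\<lambda>i. b i + b' i"]) simp
    next
      fix r and f assume "f \<in> L"
      then obtain F b where f: "f = grad (\<lambda>u. F u + ?lin b u)" "F \<in> vanishing V m \<xi>" unfolding L_def by blast
      have "(\<lambda>u. r * F u) \<in> vanishing V m \<xi>"
        using f(2) by (auto simp: vanishing_def intro: poly_fun.intros)
      moreover have "grad (\<lambda>u. r * F u + ?lin (\<lambda>i. r * b i) u) = (\<lambda>p. r * f p)"
      proof (rule gradI)
        fix l assume l: "l < m"
        have "(\<lambda>u. r * F u + ?lin (\<lambda>i. r * b i) u) = (\<lambda>u. r * (F u + ?lin b u))"
          by (simp add: fun_eq_iff distrib_left sum_distrib_left mult.assoc)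
        thus "dd (\<lambda>u. r * F u + ?lin (\<lambda>i. r * b i) u) (\<xi> y) (unit_vec m l) = r * f l"
          using dd_cmult[OF Rpoly[OF f(2)] carr[OF y] unit_vec_carrier, of r b l] l
          by (simp add: f grad_def)
      qed (simp add: f grad_def)
      ultimately show "(\<lambda>p. r * f p) \<in> L" unfolding L_def by (intro CollectI exI2[of _ "\<lambda>u. r * F u" "\<lambda>i. r * b i"]) simp
    qed
    show "f l = 0" if "f \<in> L" "l \<ge> m" for f l using that by (auto simp: L_def grad_def)
    fix v :: "nat \<Rightarrow> 'k" and l
    assume ann: "\<And>f. f \<in> L \<Longrightarrow> (\<Sum>l<m. f l * v l) = 0" and l: "l < m"
    have v: "dd F (\<xi> y) (vec m v) + ?lin b (vec m v) = 0" if F: "F \<in> vanishing V m \<xi>" for F b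
    proof -
      have "grad (\<lambda>u. F u + ?lin b u) \<in> L" unfolding L_def using F by blast
      from ann[OF this] have "(\<Sum>l<m. dd (\<lambda>u. F u + ?lin b u) (\<xi> y) (unit_vec m l) * vec m v $ l) = 0"
        by (simp add: grad_def)
      hence "dd (\<lambda>u. F u + ?lin b u) (\<xi> y) (vec m v) = 0"
        using dd_linear_combination[OF Rpoly[OF F] carr[OF y], of "vec m v" b] by simp
      thus ?thesis
        using dd_add[OF vanishing_poly[OF F] lin carr[OF y], of "vec m v" b] dd_lin[OF carr[OF y], of "vec m v" b] by simp
    qed
    have "vec m v = 0\<^sub>v m"
    proof (rule J)
      show "vec m v \<in> tangent_vectors V m \<xi> y"
        by (rule tangent_vectorsI) (use v[of _ "\<lambda>_. 0"] in simp_all)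
      have "(\<lambda>_. 0) \<in> vanishing V m \<xi>" by (auto simp: vanishing_def intro: poly_fun.const)
      from v[OF this, of "\<lambda>j. if j = i then 1 else 0" for i]
      show "vec m v $ i = 0" if "i < d" for i
      proof -
        have "0 = (\<Sum>j<d. (if j = i then 1 else 0) * vec m v $ j)"
          using v[OF \<open>(\<lambda>_. 0) \<in> vanishing V m \<xi>\<close>, of "\<lambda>j. if j = i then 1 else 0"] by simp
        also have "\<dots> = (\<Sum>j\<in>{i}. (if j = i then 1 else 0) * vec m v $ j)"
          using that by (intro sum.mono_neutral_right) auto
        finally show ?thesis by simp
      qed
    qed
    thus "v l = 0" using l by (metis index_vec index_zero_vec(1))
  qed
  hence "\<forall>l. \<exists>F b. l < m \<longrightarrow> F \<in> vanishing V m \<xi> \<and> unit_fun l = grad (\<lambda>u. F u + ?lin b u)"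
    unfolding L_def by blast
  then obtain F b where F: "\<And>l. l < m \<Longrightarrow> F l \<in> vanishing V m \<xi>"
    and Fb: "\<And>l. l < m \<Longrightarrow> unit_fun l = grad (\<lambda>u. F l u + ?lin (b l) u)" by metis
  define R where "R l = (\<lambda>u. F l u + ?lin (b l) u)" for l
  have R: "R l \<in> poly_fun m" if "l < m" for l unfolding R_def by (rule Rpoly[OF F[OF that]])
  let ?P = "\<lambda>l h. (\<forall>k<m. h k \<in> poly_fun (m + m)) \<and>
    (\<forall>x\<in>carrier_vec m. \<forall>z\<in>carrier_vec m. R l x - R l z = (\<Sum>k<m. h k (x @\<^sub>v z) * (x $ k - z $ k))) \<and>
    (\<forall>x\<in>carrier_vec m. \<forall>v\<in>carrier_vec m. dd (R l) x v = (\<Sum>k<m. h k (x @\<^sub>v x) * v $ k))"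
  have "\<forall>l. \<exists>h. l < m \<longrightarrow> ?P l h"
  proof
    fix l
    show "\<exists>h. l < m \<longrightarrow> ?P l h"
    proof (cases "l < m")
      case True
      show ?thesis by (rule hadamard[OF R[OF True]]) blast
    qed simp
  qed
  from choice[OF this] obtain H where H': "\<forall>l. l < m \<longrightarrow> ?P l (H l)" by (rule exE)
  have H: "?P l (H l)" if "l < m" for l
    by (rule mp[OF spec[of "\<lambda>l. l < m \<longrightarrow> ?P l (H l)" l, OF H'] that])
  have Hdiff: "R l x - R l z = (\<Sum>k<m. H l k (x @\<^sub>v z) * (x $ k - z $ k))"
    if "l < m" "x \<in> carrier_vec m" "z \<in> carrier_vec m" for l x z using H[OF that(1)] that(2,3) by blast
  have Hdd: "dd (R l) x v = (\<Sum>k<m. H l k (x @\<^sub>v x) * v $ k)"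
    if "l < m" "x \<in> carrier_vec m" "v \<in> carrier_vec m" for l x v using H[OF that(1)] that(2,3) by blast
  show thesis
  proof (rule that[of H])
    show "H l k \<in> poly_fun (m + m)" if "l < m" "k < m" for l k using H[OF that(1)] that(2) by blast
    show "H l k (\<xi> y @\<^sub>v \<xi> y) = (if l = k then 1 else 0)" if lk: "l < m" "k < m" for l k
    proof -
      have "dd (R l) (\<xi> y) (unit_vec m k) = unit_fun l k"
        unfolding Fb[OF lk(1)] R_def using lk by (simp add: grad_def)
      moreover have "dd (R l) (\<xi> y) (unit_vec m k) = (\<Sum>j\<in>{k}. H l j (\<xi> y @\<^sub>v \<xi> y) * unit_vec m k $ j)"
        unfolding Hdd[OF lk(1) carr[OF y] unit_vec_carrier] using lk
        by (intro sum.mono_neutral_right) auto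
      ultimately show ?thesis using lk by (auto simp: unit_fun_def)
    qed
    show "(\<Sum>k<m. H l k (\<xi> x @\<^sub>v \<xi> z) * (\<xi> x $ k - \<xi> z $ k)) = 0"
      if x: "x \<in> V" and z: "z \<in> V" and eq: "\<And>i. i < d \<Longrightarrow> \<xi> x $ i = \<xi> z $ i" and l: "l < m" for x z l
    proof -
      have "?lin (b l) (\<xi> x) = ?lin (b l) (\<xi> z)" using eq by (intro sum.cong) auto
      hence "R l (\<xi> x) = R l (\<xi> z)" using vanishing_zero[OF F[OF l]] x z by (simp add: R_def)
      thus ?thesis using Hdiff[OF l carr[OF x] carr[OF z]] by simp
    qed
    show "(\<Sum>k<m. H l k (\<xi> x @\<^sub>v \<xi> x) * v $ k) = 0"
      if x: "x \<in> V" and v: "v \<in> tangent_vectors V m \<xi> x" and eq: "\<And>i. i < d \<Longrightarrow> v $ i = 0" and l: "l < m" for x v l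
    proof -
      note vc = tangent_vectors_carrier[OF v]
      have "dd (R l) (\<xi> x) v = dd (F l) (\<xi> x) v + ?lin (b l) v"
        unfolding R_def using dd_add[OF vanishing_poly[OF F[OF l]] lin carr[OF x] vc] dd_lin[OF carr[OF x] vc] by simp
      also have "\<dots> = 0" using tangent_vectors_dd[OF v F[OF l]] eq by simp
      finally show ?thesis using Hdd[OF l carr[OF x] vc] by simp
    qed
  qed
qed

lemma mat_kernel_trivial:
  fixes f :: "nat \<Rightarrow> nat \<Rightarrow> 'k::field"
  assumes d: "det (mat m m (\<lambda>(l, k). f l k)) \<noteq> 0" and v: "\<And>l. l < m \<Longrightarrow> (\<Sum>k<m. f l k * v k) = 0" and i: "i < m"
  shows "v i = 0"
proof -
  let ?A = "mat m m (\<lambda>(l, k). f l k)"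
  have "?A *\<^sub>v vec m v = 0\<^sub>v m"
    by (rule eq_vecI) (simp_all add: scalar_prod_def v lessThan_atLeast0[symmetric])
  hence "vec m v = 0\<^sub>v m"
    using d det_0_iff_vec_prod_zero_field[OF mat_carrier[of m m "\<lambda>(l, k). f l k"]] vec_carrier[of m v]
    by blast
  thus ?thesis using i by (metis index_vec index_zero_vec(1))
qed

text \<open>Both conclusions come from the determinant \<open>q\<close> of the matrix
  \<open>H\<close>, which is 1 at \<open>(y, y)\<close>. On the diagonal the kernel contains the
  tangent vectors whose first \<open>d\<close> entries vanish; on the graph of \<open>s\<close> it
  contains \<open>\<xi> x - \<xi> (s x)\<close>, because \<open>s\<close> preserves the first
  \<open>d\<close> coordinates.\<close>

lemma unramified_neighbourhood:
  fixes X :: "('a, 'k::field_char_0) fspace"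
  assumes X: "prevariety X" and c: "chart X V m \<xi>" and y: "y \<in> V" and dm: "d \<le> m"
    and J: "\<And>D. D \<in> tangent_space X y \<Longrightarrow> (\<And>i. i < d \<Longrightarrow> der D V (\<lambda>z. \<xi> z $ i) = 0) \<Longrightarrow> D = (\<lambda>_. 0)"
  shows unramified_generic: "\<exists>O'. openin (zar X) O' \<and> y \<in> O' \<and> O' \<subseteq> V \<and>
      (\<forall>x\<in>O'. \<forall>D\<in>tangent_space X x. (\<forall>i<d. der D V (\<lambda>z. \<xi> z $ i) = 0) \<longrightarrow> D = (\<lambda>_. 0))"
    and unramified_rigid: "morph_on X V X s \<Longrightarrow> s \<in> V \<rightarrow> V \<Longrightarrow> s y = y \<Longrightarrow>
      (\<And>x i. x \<in> V \<Longrightarrow> i < d \<Longrightarrow> \<xi> (s x) $ i = \<xi> x $ i) \<Longrightarrow>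
      \<exists>O'. openin (zar X) O' \<and> y \<in> O' \<and> (\<forall>x\<in>O'. s x = x)"
proof -
  note swf = prevariety_swf[OF X] and carr = chart_carrier[OF c]
  have J': "v = 0\<^sub>v m" if v: "v \<in> tangent_vectors V m \<xi> y" and v0: "\<And>i. i < d \<Longrightarrow> v $ i = 0" for v
  proof -
    obtain D where D: "D \<in> tangent_space X y" "\<And>i. i < m \<Longrightarrow> der D V (\<lambda>z. \<xi> z $ i) = v $ i"
      using tangent_vector_derivation[OF swf c y v] by blast
    have "D = (\<lambda>_. 0)" by (rule J[OF D(1)]) (use D(2) v0 dm in auto)
    hence "v $ i = 0" if "i < m" for i using D(2)[OF that] by (simp add: der_def)
    thus ?thesis using tangent_vectors_carrier[OF v] by (intro eq_vecI) auto
  qed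
  obtain H where H: "\<And>l k. l < m \<Longrightarrow> k < m \<Longrightarrow> H l k \<in> poly_fun (m + m)"
    and Hy: "\<And>l k. l < m \<Longrightarrow> k < m \<Longrightarrow> H l k (\<xi> y @\<^sub>v \<xi> y) = (if l = k then 1 else 0)"
    and Hxz: "\<And>x z l. x \<in> V \<Longrightarrow> z \<in> V \<Longrightarrow> (\<And>i. i < d \<Longrightarrow> \<xi> x $ i = \<xi> z $ i) \<Longrightarrow> l < m \<Longrightarrow>
       (\<Sum>k<m. H l k (\<xi> x @\<^sub>v \<xi> z) * (\<xi> x $ k - \<xi> z $ k)) = 0"
    and Hv: "\<And>x v l. x \<in> V \<Longrightarrow> v \<in> tangent_vectors V m \<xi> x \<Longrightarrow> (\<And>i. i < d \<Longrightarrow> v $ i = 0) \<Longrightarrow> l < m \<Longrightarrow>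
       (\<Sum>k<m. H l k (\<xi> x @\<^sub>v \<xi> x) * v $ k) = 0"
  proof (rule unramified_matrix[OF swf c y dm], goal_cases)
    case (1 v) show ?case by (rule J') (fact 1)+
  next
    case (2 H) show ?case by (rule that[of H]) (fact 2)+
  qed
  define q where "q u = det (mat m m (\<lambda>(l, k). H l k u))" for u
  have q: "q \<in> poly_fun (m + m)" unfolding q_def by (rule poly_fun_det[OF H])
  have "mat m m (\<lambda>(l, k). H l k (\<xi> y @\<^sub>v \<xi> y)) = 1\<^sub>m m" by (rule eq_matI) (auto simp: Hy)
  hence qy: "q (\<xi> y @\<^sub>v \<xi> y) = 1" by (simp add: q_def)
  \<comment> \<open>Stated for a general \<open>s\<close>: the identity gives the diagonal, the
    given morphism its graph.\<close>
  have reg: "regular_on X V (\<lambda>x. q (\<xi> x @\<^sub>v \<xi> (s x)))"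
    if s: "s \<in> V \<rightarrow> V" "\<And>i. i < m \<Longrightarrow> regular_on X V (\<lambda>x. \<xi> (s x) $ i)" for s
  proof (rule regular_on_poly[OF swf chart_openin[OF c] q])
    fix i assume i: "i < m + m"
    show "regular_on X V (\<lambda>x. (\<xi> x @\<^sub>v \<xi> (s x)) $ i)"
    proof (cases "i < m")
      case True
      show ?thesis
        by (rule regular_on_eqI[OF chart_coord[OF c True]])
          (rule append_vec_index_left[symmetric, OF carr True carr], use s in auto)
    next
      case False
      hence i': "i - m < m" using i by auto
      show ?thesis
      proof (rule regular_on_eqI[OF s(2)[OF i']])
        fix x assume x: "x \<in> V"
        have "(\<xi> x @\<^sub>v \<xi> (s x)) $ (m + (i - m)) = \<xi> (s x) $ (i - m)"
          by (rule append_vec_index_right[OF carr[OF x] i' carr]) (use s x in auto)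
        thus "\<xi> (s x) $ (i - m) = (\<xi> x @\<^sub>v \<xi> (s x)) $ i" using False by simp
      qed
    qed
  qed
  show "\<exists>O'. openin (zar X) O' \<and> y \<in> O' \<and> O' \<subseteq> V \<and>
      (\<forall>x\<in>O'. \<forall>D\<in>tangent_space X x. (\<forall>i<d. der D V (\<lambda>z. \<xi> z $ i) = 0) \<longrightarrow> D = (\<lambda>_. 0))"
  proof (intro exI conjI ballI impI)
    show "openin (zar X) {x \<in> V. q (\<xi> x @\<^sub>v \<xi> x) \<noteq> 0}"
      using regular_on_nonzero_openin[OF X reg[of "\<lambda>x. x"]] chart_coord[OF c] by simp
    show "y \<in> {x \<in> V. q (\<xi> x @\<^sub>v \<xi> x) \<noteq> 0}" using y qy by simp
    fix x D assume x: "x \<in> {x \<in> V. q (\<xi> x @\<^sub>v \<xi> x) \<noteq> 0}" and D: "D \<in> tangent_space X x"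
      and D0: "\<forall>i<d. der D V (\<lambda>z. \<xi> z $ i) = 0"
    have xV: "x \<in> V" using x by simp
    let ?v = "vec m (\<lambda>i. der D V (\<lambda>z. \<xi> z $ i))"
    show "D = (\<lambda>_. 0)"
    proof (rule tangent_eq_0[OF swf c xV D])
      fix i assume i: "i < m"
      have "?v $ i = 0"
      proof (rule mat_kernel_trivial[where v = "\<lambda>i. ?v $ i", OF _ _ i])
        show "det (mat m m (\<lambda>(l, k). H l k (\<xi> x @\<^sub>v \<xi> x))) \<noteq> 0" using x by (simp add: q_def)
        show "(\<Sum>k<m. H l k (\<xi> x @\<^sub>v \<xi> x) * ?v $ k) = 0" if "l < m" for l
          by (rule Hv[OF xV tangent_coordinates[OF swf c xV D] _ that]) (use D0 dm in simp)
      qed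
      thus "der D V (\<lambda>z. \<xi> z $ i) = 0" using i by simp
    qed
  qed auto
  assume s: "morph_on X V X s" and sV: "s \<in> V \<rightarrow> V" and sy: "s y = y"
    and eq: "\<And>x i. x \<in> V \<Longrightarrow> i < d \<Longrightarrow> \<xi> (s x) $ i = \<xi> x $ i"
  show "\<exists>O'. openin (zar X) O' \<and> y \<in> O' \<and> (\<forall>x\<in>O'. s x = x)"
  proof (intro exI conjI ballI)
    have "{x \<in> V. s x \<in> V} = V" using sV by auto
    hence "regular_on X V (\<lambda>x. \<xi> (s x) $ i)" if "i < m" for i
      using morph_on_pullback[OF s chart_coord[OF c that]] by simp
    from regular_on_nonzero_openin[OF X reg[OF sV this]]
    show "openin (zar X) {x \<in> V. q (\<xi> x @\<^sub>v \<xi> (s x)) \<noteq> 0}" .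
    show "y \<in> {x \<in> V. q (\<xi> x @\<^sub>v \<xi> (s x)) \<noteq> 0}" using y qy sy by simp
    fix x assume x: "x \<in> {x \<in> V. q (\<xi> x @\<^sub>v \<xi> (s x)) \<noteq> 0}"
    hence xV: "x \<in> V" "s x \<in> V" using sV by auto
    have "\<xi> x $ i - \<xi> (s x) $ i = 0" if i: "i < m" for i
    proof (rule mat_kernel_trivial[where v = "\<lambda>i. \<xi> x $ i - \<xi> (s x) $ i", OF _ _ i])
      show "det (mat m m (\<lambda>(l, k). H l k (\<xi> x @\<^sub>v \<xi> (s x)))) \<noteq> 0" using x by (simp add: q_def)
      show "(\<Sum>k<m. H l k (\<xi> x @\<^sub>v \<xi> (s x)) * (\<xi> x $ k - \<xi> (s x) $ k)) = 0" if "l < m" for l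
        by (rule Hxz[OF xV _ that]) (use eq xV in auto)
    qed
    hence "\<xi> (s x) = \<xi> x" using carr[OF xV(1)] carr[OF xV(2)] by (intro eq_vecI) auto
    thus "s x = x" using chart_inj[OF c] xV by (auto dest: inj_onD)
  qed
qed

text \<open>In the chart with coordinates \<open>f\<close>, then \<open>w\<close>, then
  \<open>\<xi>\<close>, independence of \<open>f\<close> lets generic tangent vectors be cut out by
  \<open>M - N\<close> equations, while \<open>J\<close> makes them vanish together with their
  \<open>w\<close>-part. Counting gives \<open>N \<le> d\<close>, and in case of equality every
  prescribed \<open>w\<close>-part occurs.\<close>

lemma alg_independent_count:
  fixes X :: "('a, 'k::field_char_0) fspace"
  assumes X: "prevariety X" and irr: "irreducible_space (zar X)" and c: "chart X V m \<xi>"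
    and w: "\<And>x. x \<in> V \<Longrightarrow> w x \<in> carrier_vec d" and rw: "\<And>i. i < d \<Longrightarrow> regular_on X V (\<lambda>x. w x $ i)"
    and O1: "openin (zar X) O1" "O1 \<noteq> {}" "O1 \<subseteq> V"
    and J: "\<And>x D. x \<in> O1 \<Longrightarrow> D \<in> tangent_space X x \<Longrightarrow> (\<And>i. i < d \<Longrightarrow> der D V (\<lambda>z. w z $ i) = 0) \<Longrightarrow> D = (\<lambda>_. 0)"
    and U: "openin (zar X) U" "U \<noteq> {}" and f: "\<And>x. x \<in> U \<Longrightarrow> f x \<in> carrier_vec N"
    and rf: "\<And>i. i < N \<Longrightarrow> regular_on X U (\<lambda>x. f x $ i)" and ind: "alg_independent U N f"
  shows "N \<le> d" and "N = d \<Longrightarrow> \<exists>O'. openin (zar X) O' \<and> O' \<noteq> {} \<and> O' \<subseteq> O1 \<and>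
     (\<forall>x\<in>O'. \<forall>b. \<exists>D\<in>tangent_space X x. \<forall>i<d. der D V (\<lambda>z. w z $ i) = b i)"
proof -
  note swf = prevariety_swf[OF X] and V = chart_openin[OF c]
  define W where "W = U \<inter> V"
  have W: "openin (zar X) W" "W \<subseteq> U" "W \<subseteq> V" using U V by (auto simp: W_def)
  have O1ne: "V \<noteq> {}" using O1 by blast
  have Wne: "W \<noteq> {}" unfolding W_def by (rule irreducible_space_Int[OF irr U V O1ne])
  define M where "M = N + (d + m)"
  define \<zeta> where "\<zeta> x = f x @\<^sub>v (w x @\<^sub>v \<xi> x)" for x
  have rW: "regular_on X W (\<lambda>x. w x $ i)" if "i < d" for i
    by (rule regular_on_subset[OF swf rw[OF that] W(1,3)])
  have fW: "regular_on X W (\<lambda>x. f x $ i)" if "i < N" for i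
    by (rule regular_on_subset[OF swf rf[OF that] W(1,2)])
  have c\<zeta>: "chart X W M \<zeta>" unfolding M_def \<zeta>_def
    by (intro chart_extend[OF X] chart_subset[OF swf c W(1,3)])
      (use w f W rW fW in auto)
  have \<zeta>f: "\<zeta> x $ i = f x $ i" if "x \<in> W" "i < N" for x i
    unfolding \<zeta>_def by (rule append_vec_index_left[of _ N _ _ "d + m"])
      (use that w f W chart_carrier[OF c] in auto)
  have \<zeta>w: "\<zeta> x $ (N + i) = w x $ i" if "x \<in> W" "i < d" for x i
  proof -
    have 1: "f x \<in> carrier_vec N" "w x \<in> carrier_vec d" "\<xi> x \<in> carrier_vec m"
      using that w f W chart_carrier[OF c] by auto
    have "\<zeta> x $ (N + i) = (w x @\<^sub>v \<xi> x) $ i"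
      unfolding \<zeta>_def by (rule append_vec_index_right[of _ N _ "d + m"]) (use 1 that in auto)
    also have "\<dots> = w x $ i" by (rule append_vec_index_left[OF 1(2) that(2) 1(3)])
    finally show ?thesis .
  qed
  have indW: "alg_independent W N \<zeta>" unfolding alg_independent_def
  proof (intro ballI impI)
    fix P and v :: "'k vec" assume P: "P \<in> poly_fun N" "\<forall>z\<in>W. P (\<zeta> z) = 0" and v: "v \<in> carrier_vec N"
    \<comment> \<open>A relation on the smaller open set \<open>W\<close> extends to
      \<open>U\<close> by density, so shrinking preserves independence.\<close>
    have "P (f z) = 0" if z: "z \<in> U" for z
    proof (rule regular_on_density[OF X irr regular_on_poly[OF swf U(1) P(1) rf] W(1) Wne _ z])
      fix z assume z: "z \<in> W"
      have "P (f z) = P (\<zeta> z)" by (rule poly_fun_cong[OF P(1)]) (simp add: \<zeta>f[OF z])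
      thus "P (f z) = 0" using P(2) z by simp
    qed
    thus "P v = 0" using ind P(1) v unfolding alg_independent_def by blast
  qed
  have "\<exists>G h. h \<in> poly_fun M \<and> (\<exists>z\<in>W. h (\<zeta> z) \<noteq> 0) \<and> (\<forall>i<d + m. G i \<in> vanishing W (N + (d + m)) \<zeta>) \<and>
    (\<forall>x\<in>W. \<forall>v\<in>carrier_vec M. h (\<zeta> x) \<noteq> 0 \<and> (\<forall>i<d + m. dd (G i) (\<zeta> x) v = 0) \<longrightarrow>
       (\<forall>F\<in>vanishing W (N + (d + m)) \<zeta>. dd F (\<zeta> x) v = 0))"
    using chart_prime[OF irr c\<zeta>]
    by (intro generic_tangent_equations[OF chart_carrier[OF c\<zeta>] Wne _ indW]) (simp_all add: M_def)
  then obtain G h where h: "h \<in> poly_fun M" "\<exists>z\<in>W. h (\<zeta> z) \<noteq> 0"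
    and G: "\<forall>i<d + m. G i \<in> vanishing W M \<zeta>"
    and Gh: "\<forall>x\<in>W. \<forall>v\<in>carrier_vec M. h (\<zeta> x) \<noteq> 0 \<and> (\<forall>i<d + m. dd (G i) (\<zeta> x) v = 0) \<longrightarrow>
       (\<forall>F\<in>vanishing W M \<zeta>. dd F (\<zeta> x) v = 0)"
    unfolding M_def[symmetric] by (elim exE conjE)
  define O' where "O' = {x \<in> W. h (\<zeta> x) \<noteq> 0} \<inter> O1"
  have O': "openin (zar X) O'" unfolding O'_def using chart_nonzero_openin[OF c\<zeta> h(1)] O1(1) by auto
  have O'ne: "O' \<noteq> {}" unfolding O'_def
    by (rule irreducible_space_Int[OF irr chart_nonzero_openin[OF c\<zeta> h(1)] _ O1(1,2)]) (use h in auto)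
  have derw: "der D W (\<lambda>z. \<zeta> z $ (N + i)) = der D V (\<lambda>z. w z $ i)"
    if "D \<in> tangent_space X x" "x \<in> W" "i < d" for D x i
  proof -
    have "der D W (\<lambda>z. \<zeta> z $ (N + i)) = der D W (\<lambda>z. w z $ i)"
      using \<zeta>w[OF _ that(3)] by (rule der_cong)
    also have "\<dots> = der D V (\<lambda>z. w z $ i)"
      by (rule tangent_spaceD(2)[OF swf that(1) rw[OF that(3)] that(2) W(1,3)])
    finally show ?thesis .
  qed
  have main: "N \<le> d \<and> (N = d \<longrightarrow> (\<forall>b. \<exists>v\<in>tangent_vectors W M \<zeta> x. \<forall>i<d. v $ (N + i) = b i))"
    if x: "x \<in> O'" for x
  proof -
    have xW: "x \<in> W" and hx: "h (\<zeta> x) \<noteq> 0" and xO1: "x \<in> O1" using x by (auto simp: O'_def)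
    have Gp: "G i \<in> poly_fun M" if "i < M - N" for i using G that by (intro vanishing_poly[of _ W M \<zeta>]) (simp add: M_def)
    have eqs: "v \<in> tangent_vectors W M \<zeta> x"
      if "v \<in> carrier_vec M" "\<And>i. i < M - N \<Longrightarrow> dd (G i) (\<zeta> x) v = 0" for v
    proof (rule tangent_vectorsI[OF that(1)])
      have "\<forall>i<d + m. dd (G i) (\<zeta> x) v = 0" using that(2) by (simp add: M_def)
      thus "dd F (\<zeta> x) v = 0" if "F \<in> vanishing W M \<zeta>" for F
        using Gh xW hx that \<open>v \<in> carrier_vec M\<close> by blast
    qed
    have inj: "v = 0\<^sub>v M" if v: "v \<in> tangent_vectors W M \<zeta> x" and v0: "\<And>i. i < d \<Longrightarrow> v $ (N + i) = 0" for v
    proof -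
      obtain D where D: "D \<in> tangent_space X x" "\<And>i. i < M \<Longrightarrow> der D W (\<lambda>z. \<zeta> z $ i) = v $ i"
        using tangent_vector_derivation[OF swf c\<zeta> xW v] by blast
      have "der D V (\<lambda>z. w z $ i) = 0" if "i < d" for i
        using derw[OF D(1) xW that] D(2)[of "N + i"] v0[OF that] that by (simp add: M_def)
      from J[OF xO1 D(1) this] have "D = (\<lambda>_. 0)" .
      hence "v $ i = 0" if "i < M" for i using D(2)[OF that] by (simp add: der_def)
      thus ?thesis using tangent_vectors_carrier[OF v] by (intro eq_vecI) auto
    qed
    have NM: "N \<le> M" "N + d \<le> M" by (simp_all add: M_def)
    note \<zeta>x = chart_carrier[OF c\<zeta> xW]
    have "N \<le> d"
      by (rule tangent_equations_count(1)[of \<zeta> x M N N d G W]) (fact \<zeta>x NM Gp eqs inj)+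
    moreover have "\<exists>v\<in>tangent_vectors W M \<zeta> x. \<forall>i<d. v $ (N + i) = b i" if "N = d" for b
      by (rule tangent_equations_count(2)[of \<zeta> x M N N d G W]) (fact \<zeta>x NM Gp eqs inj that)+
    ultimately show ?thesis by blast
  qed
  show "N \<le> d" using main O'ne by blast
  show "\<exists>O'. openin (zar X) O' \<and> O' \<noteq> {} \<and> O' \<subseteq> O1 \<and>
     (\<forall>x\<in>O'. \<forall>b. \<exists>D\<in>tangent_space X x. \<forall>i<d. der D V (\<lambda>z. w z $ i) = b i)" if Nd: "N = d"
  proof (intro exI conjI ballI allI)
    show "openin (zar X) O'" "O' \<noteq> {}" by fact+
    show "O' \<subseteq> O1" by (auto simp: O'_def)
    fix x and b :: "nat \<Rightarrow> 'k" assume x: "x \<in> O'"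
    hence xW: "x \<in> W" by (auto simp: O'_def)
    obtain v where v: "v \<in> tangent_vectors W M \<zeta> x" "\<forall>i<d. v $ (N + i) = b i"
      using main[OF x] Nd by blast
    obtain D where D: "D \<in> tangent_space X x" "\<And>i. i < M \<Longrightarrow> der D W (\<lambda>z. \<zeta> z $ i) = v $ i"
      using tangent_vector_derivation[OF swf c\<zeta> xW v(1)] by blast
    have "der D V (\<lambda>z. w z $ i) = b i" if "i < d" for i
      using derw[OF D(1) xW that] D(2)[of "N + i"] v(2) that by (simp add: M_def)
    thus "\<exists>D\<in>tangent_space X x. \<forall>i<d. der D V (\<lambda>z. w z $ i) = b i" using D(1) by blast
  qed
qed

lemma local_dim_le: "openin T U \<Longrightarrow> x \<in> U \<Longrightarrow> local_dim T x \<le> krull_dim (subtopology T U)"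
  unfolding local_dim_def by (intro Inf_lower) blast

text \<open>The dimension of \<open>Y\<close> is not computed here. Instead \<open>d\<close> is
  compared with algebraically independent functions and with chains on arbitrary nonempty open sets,
  since these can be moved through a birational map. The condition \<open>d \<ge> 1\<close> appears
  where chains are extracted by \<open>krull_dim_chain\<close>.\<close>

lemma fixed_point_coordinates:
  fixes Y :: "('b, 'k::field_char_0) fspace" and G :: "('g, 'n) monoid_scheme"
  assumes irrY: "irreducible_variety Y" and sm: "smooth_variety Y"
    and G: "group G" "finite (carrier G)" and act: "regular_action G Y \<sigma>"
    and y: "y \<in> points Y" and fix_y: "\<And>g. g \<in> carrier G \<Longrightarrow> \<sigma> g y = y"
  obtains d V w \<alpha> where "openin (zar Y) V" "V \<noteq> {}" "\<And>g x. g \<in> carrier G \<Longrightarrow> x \<in> V \<Longrightarrow> \<sigma> g x \<in> V"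
    "\<And>x. w x \<in> carrier_vec d" "\<And>i. i < d \<Longrightarrow> regular_on Y V (\<lambda>x. w x $ i)"
    "\<And>g. \<alpha> g \<in> carrier_mat d d" "\<alpha> \<one>\<^bsub>G\<^esub> = 1\<^sub>m d"
    "\<And>g h. g \<in> carrier G \<Longrightarrow> h \<in> carrier G \<Longrightarrow> \<alpha> (g \<otimes>\<^bsub>G\<^esub> h) = \<alpha> g * \<alpha> h"
    "\<And>g x. g \<in> carrier G \<Longrightarrow> x \<in> V \<Longrightarrow> w (\<sigma> g x) = \<alpha> g *\<^sub>v w x"
    "\<And>g. g \<in> carrier G \<Longrightarrow> \<alpha> g = 1\<^sub>m d \<Longrightarrow> \<exists>O'. openin (zar Y) O' \<and> O' \<noteq> {} \<and> (\<forall>x\<in>O'. \<sigma> g x = x)"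
    "\<And>U N f. openin (zar Y) U \<Longrightarrow> U \<noteq> {} \<Longrightarrow> (\<And>x. x \<in> U \<Longrightarrow> f x \<in> carrier_vec N) \<Longrightarrow>
       (\<And>i. i < N \<Longrightarrow> regular_on Y U (\<lambda>x. f x $ i)) \<Longrightarrow> alg_independent U N f \<Longrightarrow> N \<le> d"
    "\<And>U. d \<ge> 1 \<Longrightarrow> openin (zar Y) U \<Longrightarrow> U \<noteq> {} \<Longrightarrow> enat d \<le> krull_dim (subtopology (zar Y) U)"
    "d \<ge> 1 \<Longrightarrow> alg_independent V d w"
proof -
  have X: "prevariety Y" and irr: "irreducible_space (zar Y)"
    using irrY by (auto simp: irreducible_variety_def variety_def)
  note swf = prevariety_swf[OF X]
  obtain V0 m \<xi> where c0: "chart Y V0 m \<xi>" and yV0: "y \<in> V0"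
    using prevariety_chart_fraction[OF X y] by metis
  define d where "d = fun_dim (tangent_space Y y)"
  obtain V w \<alpha> where V: "openin (zar Y) V" "y \<in> V" "V \<subseteq> V0"
    and st: "\<And>g x. g \<in> carrier G \<Longrightarrow> x \<in> V \<Longrightarrow> \<sigma> g x \<in> V"
    and w: "\<And>x. w x \<in> carrier_vec d" and rw: "\<And>i. i < d \<Longrightarrow> regular_on Y V (\<lambda>x. w x $ i)"
    and \<alpha>: "\<And>g. \<alpha> g \<in> carrier_mat d d" "\<alpha> \<one>\<^bsub>G\<^esub> = 1\<^sub>m d"
      "\<And>g h. g \<in> carrier G \<Longrightarrow> h \<in> carrier G \<Longrightarrow> \<alpha> (g \<otimes>\<^bsub>G\<^esub> h) = \<alpha> g * \<alpha> h"
    and eqv: "\<And>g x. g \<in> carrier G \<Longrightarrow> x \<in> V \<Longrightarrow> w (\<sigma> g x) = \<alpha> g *\<^sub>v w x"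
    and J: "\<And>D. D \<in> tangent_space Y y \<Longrightarrow> (\<And>i. i < d \<Longrightarrow> der D V (\<lambda>x. w x $ i) = 0) \<Longrightarrow> D = (\<lambda>_. 0)"
  proof (rule equivariant_coordinates[OF X G act _ c0 yV0 d_def], goal_cases)
    case (1 g) show ?case by (rule fix_y) (fact 1)+
  next
    case (2 V w \<alpha>) show ?case by (rule that[of V w \<alpha>]) (fact 2)+
  qed
  have cV: "chart Y V m \<xi>" by (rule chart_subset[OF swf c0 V(1,3)])
  \<comment> \<open>With \<open>w\<close> in front, the first \<open>d\<close> coordinates of
    \<open>unramified_neighbourhood\<close> are those of \<open>w\<close>.\<close>
  define \<zeta> where "\<zeta> x = w x @\<^sub>v \<xi> x" for x
  have c: "chart Y V (d + m) \<zeta>" unfolding \<zeta>_def by (rule chart_extend[OF X cV w rw])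
  have \<zeta>w: "\<zeta> x $ i = w x $ i" if "x \<in> V" "i < d" for x i
    unfolding \<zeta>_def by (rule append_vec_index_left[OF w that(2) chart_carrier[OF cV that(1)]])
  have der\<zeta>: "der D V (\<lambda>x. \<zeta> x $ i) = der D V (\<lambda>x. w x $ i)" if "i < d" for D i
    by (rule der_cong) (rule \<zeta>w[OF _ that])
  have J\<zeta>: "D = (\<lambda>_. 0)" if "D \<in> tangent_space Y y" "\<And>i. i < d \<Longrightarrow> der D V (\<lambda>x. \<zeta> x $ i) = 0" for D
    by (rule J[OF that(1)]) (use that(2) der\<zeta> in simp)
  have dm: "d \<le> d + m" by simp
  obtain O1 where O1: "openin (zar Y) O1" "y \<in> O1" "O1 \<subseteq> V"
    and O1J: "\<forall>x\<in>O1. \<forall>D\<in>tangent_space Y x. (\<forall>i<d. der D V (\<lambda>z. \<zeta> z $ i) = 0) \<longrightarrow> D = (\<lambda>_. 0)"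
  proof -
    have "\<exists>O'. openin (zar Y) O' \<and> y \<in> O' \<and> O' \<subseteq> V \<and>
      (\<forall>x\<in>O'. \<forall>D\<in>tangent_space Y x. (\<forall>i<d. der D V (\<lambda>z. \<zeta> z $ i) = 0) \<longrightarrow> D = (\<lambda>_. 0))"
      by (rule unramified_generic[OF X c V(2) dm]) (fact J\<zeta>)
    thus thesis using that by (elim exE conjE)
  qed
  have O1w: "D = (\<lambda>_. 0)"
    if "x \<in> O1" "D \<in> tangent_space Y x" "\<And>i. i < d \<Longrightarrow> der D V (\<lambda>z. w z $ i) = 0" for x D
    using O1J that der\<zeta> by simp
  have O1ne: "O1 \<noteq> {}" using O1 by blast
  have wV: "w x \<in> carrier_vec d" if "x \<in> V" for x by (rule w)
  have faithful: "\<exists>O'. openin (zar Y) O' \<and> O' \<noteq> {} \<and> (\<forall>x\<in>O'. \<sigma> g x = x)"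
    if g: "g \<in> carrier G" "\<alpha> g = 1\<^sub>m d" for g
  proof -
    have "morph_on Y (points Y) Y (\<sigma> g)"
      using act g unfolding regular_action_def morphism_iff[OF swf] by blast
    hence mor: "morph_on Y V Y (\<sigma> g)"
      by (rule morph_on_subset[OF swf _ V(1) openin_subset[OF V(1)]])
    have "\<exists>O'. openin (zar Y) O' \<and> y \<in> O' \<and> (\<forall>x\<in>O'. \<sigma> g x = x)"
    proof (rule unramified_rigid[OF X c V(2) dm _ mor])
      show "D = (\<lambda>_. 0)" if "D \<in> tangent_space Y y" "\<And>i. i < d \<Longrightarrow> der D V (\<lambda>x. \<zeta> x $ i) = 0" for D
        by (rule J\<zeta>) (fact that)+
      show "\<sigma> g \<in> V \<rightarrow> V" using st g by blast
      show "\<sigma> g y = y" by (rule fix_y[OF g(1)])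
      show "\<zeta> (\<sigma> g x) $ i = \<zeta> x $ i" if "x \<in> V" "i < d" for x i
        using \<zeta>w[OF st[OF g(1) that(1)] that(2)] \<zeta>w[OF that] eqv[OF g(1) that(1)] g(2) w by simp
    qed
    thus ?thesis by blast
  qed
  have bound: "N \<le> d" if "openin (zar Y) U" "U \<noteq> {}" "\<And>x. x \<in> U \<Longrightarrow> f x \<in> carrier_vec N"
      "\<And>i. i < N \<Longrightarrow> regular_on Y U (\<lambda>x. f x $ i)" "alg_independent U N f" for U N f
    by (rule alg_independent_count(1)[of Y V m \<xi> w d O1 U f N])
      (fact X irr cV wV rw O1(1) O1ne O1(3) O1w that)+
  have generic: "\<exists>O'. openin (zar Y) O' \<and> O' \<noteq> {} \<and> O' \<subseteq> O1 \<and>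
     (\<forall>x\<in>O'. \<forall>b. \<exists>D\<in>tangent_space Y x. \<forall>i<d. der D V (\<lambda>z. w z $ i) = b i)" if d: "d \<ge> 1"
  proof -
    \<comment> \<open>Smoothness at \<open>y\<close> turns the tangent dimension \<open>d\<close>
      into a chain in the chart, and the chain into \<open>d\<close> independent functions, so that
      the count holds with equality.\<close>
    have "enat d = local_dim (zar Y) y" using sm y unfolding smooth_variety_def d_def by blast
    hence "enat d \<le> krull_dim (subtopology (zar Y) V0)"
      using local_dim_le[OF chart_openin[OF c0] yV0] by simp
    then obtain C where C: "closed_chain (subtopology (zar Y) V0) d C" using krull_dim_chain d by blast
    obtain f where f: "\<And>i. i < d \<Longrightarrow> f i \<in> poly_fun m" "alg_independent (C d) d (\<lambda>z. vec d (\<lambda>i. f i (\<xi> z)))"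
      using chain_alg_independent[OF swf c0 C] by blast
    have "C d \<subseteq> V0" using closedin_subset[OF closed_chainD(1)[OF C order_refl]] by auto
    hence ind: "alg_independent V0 d (\<lambda>z. vec d (\<lambda>i. f i (\<xi> z)))"
      using f(2) unfolding alg_independent_def by blast
    have V0ne: "V0 \<noteq> {}" using yV0 by blast
    note V0o = chart_openin[OF c0]
    have reg: "regular_on Y V0 (\<lambda>x. vec d (\<lambda>i. f i (\<xi> x)) $ i)" if "i < d" for i
      using chart_poly[OF swf c0 f(1)[OF that]] that by simp
    show ?thesis
      by (rule alg_independent_count(2)[of Y V m \<xi> w d O1 V0 "\<lambda>z. vec d (\<lambda>i. f i (\<xi> z))" d])
        (fact X irr cV wV rw O1(1) O1ne O1(3) O1w V0o V0ne vec_carrier reg ind refl | rule vec_carrier)+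
  qed
  have krull: "enat d \<le> krull_dim (subtopology (zar Y) U)" if d: "d \<ge> 1" and U: "openin (zar Y) U" "U \<noteq> {}" for U
  proof -
    obtain O' where O': "openin (zar Y) O'" "O' \<noteq> {}" "O' \<subseteq> O1"
      and D: "\<forall>x\<in>O'. \<forall>b. \<exists>D\<in>tangent_space Y x. \<forall>i<d. der D V (\<lambda>z. w z $ i) = b i"
      using generic[OF d] by (elim exE conjE)
    obtain x where x: "x \<in> O'" "x \<in> U" using irreducible_space_Int[OF irr O'(1,2) U] by blast
    have xp: "x \<in> points Y" using x(2) openin_subset[OF U(1)] by blast
    have "\<forall>j. \<exists>E. E \<in> tangent_space Y x \<and> (\<forall>i<d. der E V (\<lambda>z. w z $ i) = (if i = j then 1 else 0))"
    proof
      fix j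
      show "\<exists>E. E \<in> tangent_space Y x \<and> (\<forall>i<d. der E V (\<lambda>z. w z $ i) = (if i = j then 1 else 0))"
        using bspec[OF D x(1), THEN spec[of _ "\<lambda>i. if i = j then 1 else 0"]] by (simp only: Bex_def)
    qed
    from choice[OF this] obtain E where E': "\<forall>j. E j \<in> tangent_space Y x \<and>
      (\<forall>i<d. der (E j) V (\<lambda>z. w z $ i) = (if i = j then 1 else 0))" by (rule exE)
    have E: "E j \<in> tangent_space Y x" "i < d \<Longrightarrow> der (E j) V (\<lambda>z. w z $ i) = (if i = j then 1 else 0)" for i j
      using E' by simp_all
    \<comment> \<open>At a generic point \<open>w\<close> still gives coordinates on the tangent
      space, whose dimension is therefore \<open>d\<close>. Smoothness at \<open>x\<close>, rather
      than at \<open>y\<close>, then bounds the dimension of \<open>U\<close>, which need not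
      contain \<open>y\<close>.\<close>
    have "fun_dim (tangent_space Y x) = d"
    proof (rule dim_eqI[OF subspace_tangent_space[OF swf], where B = E and q = "\<lambda>i. (V, restrict (\<lambda>z. w z $ i) V)"])
      show "E j (V, restrict (\<lambda>z. w z $ i) V) = (if i = j then 1 else 0)" if "i < d" for i j
        using E(2)[OF that] by (simp add: der_def)
      show "F = (\<lambda>_. 0)" if "F \<in> tangent_space Y x" "\<And>i. i < d \<Longrightarrow> F (V, restrict (\<lambda>z. w z $ i) V) = 0" for F
        by (rule O1w[OF _ that(1)]) (use that(2) x O' in \<open>auto simp: der_def\<close>)
    qed (rule E)
    hence "enat d = local_dim (zar Y) x" using sm xp unfolding smooth_variety_def by metis
    thus ?thesis using local_dim_le[OF U(1) x(2)] by simp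
  qed
  have indep: "alg_independent V d w" if d: "d \<ge> 1"
  proof -
    obtain O' where O': "openin (zar Y) O'" "O' \<noteq> {}" "O' \<subseteq> O1"
      and D: "\<forall>x\<in>O'. \<forall>b. \<exists>D\<in>tangent_space Y x. \<forall>i<d. der D V (\<lambda>z. w z $ i) = b i"
      using generic[OF d] by (elim exE conjE)
    \<comment> \<open>The direction \<open>v\<close> is realised by a derivation \<open>E\<close> at
      generic points. Applied to \<open>Q (w z)\<close>, which is zero on \<open>V\<close>, it shows
      that the derivative of a relation is again a relation.\<close>
    have vac: "\<exists>Q'\<in>vanishing V d w. \<forall>x\<in>carrier_vec d. Q' x = dd Q x v"
      if Q: "Q \<in> vanishing V d w" and v: "v \<in> carrier_vec d" for Q v
    proof -
      obtain Q' where Q': "Q' \<in> poly_fun d" "\<And>x. x \<in> carrier_vec d \<Longrightarrow> Q' x = dd Q x v"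
        using dd_poly_fun[OF vanishing_poly[OF Q] v] by blast
      have "Q' (w z) = 0" if z: "z \<in> V" for z
      proof (rule regular_on_density[OF X irr regular_on_poly[OF swf V(1) Q'(1) rw] O'(1,2) _ z])
        fix x assume x: "x \<in> O'" "x \<in> V"
        obtain E where E: "E \<in> tangent_space Y x" "\<forall>i<d. der E V (\<lambda>z. w z $ i) = v $ i"
          using bspec[OF D x(1), THEN spec[of _ "\<lambda>i. v $ i"]] by (elim bexE)
        have "vec d (\<lambda>i. der E V (\<lambda>z. w z $ i)) = v" using E(2) v by (intro eq_vecI) auto
        hence "Q' (w x) = der E V (\<lambda>z. Q (w z))"
          using tangent_poly[OF swf V(1) x(2) w rw E(1) vanishing_poly[OF Q]] Q'(2)[OF w] by simp
        also have "\<dots> = der E V (\<lambda>_. 0)" by (rule der_cong) (rule vanishing_zero[OF Q])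
        also have "\<dots> = 0" by (rule tangent_const[OF swf E(1) V(1) x(2)])
        finally show "Q' (w x) = 0" .
      qed
      hence "Q' \<in> vanishing V d w" by (rule vanishingI[OF Q'(1)])
      thus ?thesis using Q'(2) by blast
    qed
    show ?thesis unfolding alg_independent_def
    proof (intro ballI impI)
      fix P and v :: "'k vec" assume P: "P \<in> poly_fun d" "\<forall>z\<in>V. P (w z) = 0" and v: "v \<in> carrier_vec d"
      show "P v = 0"
      proof (rule poly_fun_eq_0_if_dd_closed[where V = "vanishing V d w" and a = "w y" and m = d])
        show "vanishing V d w \<subseteq> poly_fun d" using vanishing_poly by blast
        show "P \<in> vanishing V d w" using P by (simp add: vanishing_def)
        show "Q (w y) = 0" if "Q \<in> vanishing V d w" for Q using vanishing_zero[OF that V(2)] .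
      qed (fact w v vac)+
    qed
  qed
  have Vne: "V \<noteq> {}" using V(2) by blast
  show thesis
    by (rule that[of V w d \<alpha>]) (fact V(1) Vne st w rw \<alpha> eqv faithful bound krull indep)+
qed

section \<open>Irreducible spaces and transport of chains\<close>

lemma irreducible_spaceI:
  assumes "topspace T \<noteq> {}"
    and int: "\<And>A B. openin T A \<Longrightarrow> openin T B \<Longrightarrow> A \<noteq> {} \<Longrightarrow> B \<noteq> {} \<Longrightarrow> A \<inter> B \<noteq> {}"
  shows "irreducible_space T"
  unfolding irreducible_space_def
proof (intro conjI allI impI)
  show "topspace T \<noteq> {}" by fact
  fix A B assume AB: "closedin T A \<and> closedin T B \<and> A \<union> B = topspace T"
  have "openin T (topspace T - A)" "openin T (topspace T - B)" using AB by auto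
  moreover have "(topspace T - A) \<inter> (topspace T - B) = {}" using AB by auto
  ultimately have "topspace T - A = {} \<or> topspace T - B = {}" using int by blast
  moreover have "A \<subseteq> topspace T" "B \<subseteq> topspace T" using AB by (auto dest: closedin_subset)
  ultimately show "A = topspace T \<or> B = topspace T" by blast
qed

lemma irreducible_subtopologyD:
  assumes irr: "irreducible_space (subtopology T C)" and A: "openin T A" "A \<inter> C \<noteq> {}" and B: "openin T B" "B \<inter> C \<noteq> {}"
  shows "A \<inter> B \<inter> C \<noteq> {}"
proof -
  have "openin (subtopology T C) (A \<inter> C)" "openin (subtopology T C) (B \<inter> C)"
    using A(1) B(1) by (auto simp: openin_subtopology)
  from irreducible_space_Int[OF irr this(1) A(2) this(2) B(2)] show ?thesis by blast
qed

lemma irreducible_subtopologyI: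
  assumes "topspace T \<inter> C \<noteq> {}"
    and "\<And>A B. openin T A \<Longrightarrow> openin T B \<Longrightarrow> A \<inter> C \<noteq> {} \<Longrightarrow> B \<inter> C \<noteq> {} \<Longrightarrow> A \<inter> B \<inter> C \<noteq> {}"
  shows "irreducible_space (subtopology T C)"
proof (rule irreducible_spaceI)
  show "topspace (subtopology T C) \<noteq> {}" using assms(1) by simp
  fix A B assume "openin (subtopology T C) A" "openin (subtopology T C) B" and ne: "A \<noteq> {}" "B \<noteq> {}"
  then obtain A' B' where "openin T A'" "A = A' \<inter> C" "openin T B'" "B = B' \<inter> C"
    unfolding openin_subtopology by blast
  thus "A \<inter> B \<noteq> {}" using assms(2)[of A' B'] ne by blast
qed

lemma closed_chain_nonempty:
  assumes "closed_chain T N C" "i \<le> N"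
  shows "C i \<noteq> {}"
  using closed_chainD(2)[OF assms] unfolding irreducible_space_def by auto

lemma closed_chain_mono:
  assumes ch: "closed_chain T N C" and "i \<le> j" "j \<le> N"
  shows "C i \<subseteq> C j"
  using assms(2,3)
proof (induction j rule: dec_induct)
  case (step j)
  thus ?case using closed_chainD(3)[OF ch, of j] by auto
qed simp

text \<open>Nonempty open parts of an irreducible set are dense in it, so irreducibility is
  inherited and strict inclusions remain strict inside \<open>V\<close>. Meeting \<open>C 0\<close>
  ensures that \<open>V\<close> meets every member.\<close>

lemma closed_chain_restrict:
  assumes ch: "closed_chain T N C" and V: "openin T V" and ne: "C 0 \<inter> V \<noteq> {}"
  shows "closed_chain (subtopology T V) N (\<lambda>i. C i \<inter> V)"
  unfolding closed_chain_def
proof (intro conjI allI impI)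
  note chD = closed_chainD[OF ch]
  have neV: "C i \<inter> V \<noteq> {}" if "i \<le> N" for i using closed_chain_mono[OF ch _ that, of 0] ne by auto
  fix i assume i: "i \<le> N"
  show "closedin (subtopology T V) (C i \<inter> V)" using chD(1)[OF i] by (auto simp: closedin_subtopology)
  have "irreducible_space (subtopology T (C i \<inter> V))"
  proof (rule irreducible_subtopologyI)
    show "topspace T \<inter> (C i \<inter> V) \<noteq> {}" using neV[OF i] openin_subset[OF V] by auto
    fix A B assume "openin T A" "openin T B" "A \<inter> (C i \<inter> V) \<noteq> {}" "B \<inter> (C i \<inter> V) \<noteq> {}"
    hence "(A \<inter> V) \<inter> (B \<inter> V) \<inter> C i \<noteq> {}"
      using V by (intro irreducible_subtopologyD[OF chD(2)[OF i]]) auto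
    thus "A \<inter> B \<inter> (C i \<inter> V) \<noteq> {}" by blast
  qed
  thus "irreducible_space (subtopology (subtopology T V) (C i \<inter> V))"
    by (simp add: subtopology_subtopology Int_absorb1 Int_left_commute)
next
  note chD = closed_chainD[OF ch]
  fix i assume i: "i < N"
  hence i': "i \<le> N" "Suc i \<le> N" by auto
  obtain x where x: "x \<in> C (Suc i)" "x \<notin> C i" using chD(3)[OF i] by blast
  have xT: "x \<in> topspace T" using closedin_subset[OF chD(1)[OF i'(2)]] x(1) by blast
  have neV: "V \<inter> C (Suc i) \<noteq> {}" using closed_chain_mono[OF ch _ i'(2), of 0] ne by auto
  have "openin T (topspace T - C i)" using chD(1)[OF i'(1)] by auto
  hence "(topspace T - C i) \<inter> V \<inter> C (Suc i) \<noteq> {}"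
    using x xT by (intro irreducible_subtopologyD[OF chD(2)[OF i'(2)] _ _ V neV]) auto
  thus "C i \<inter> V \<subset> C (Suc i) \<inter> V" using chD(3)[OF i] by blast
qed

lemma closed_chain_transport:
  assumes ch: "closed_chain (subtopology T V) N C" and V: "openin T V" and U: "openin S U"
    and f: "f \<in> U \<rightarrow> V" "\<And>B. openin T B \<Longrightarrow> openin S {x \<in> U. f x \<in> B}"
    and h: "h \<in> V \<rightarrow> U" "\<And>B. openin S B \<Longrightarrow> openin T {z \<in> V. h z \<in> B}"
    and fh: "\<And>z. z \<in> V \<Longrightarrow> f (h z) = z"
  shows "closed_chain S N (\<lambda>i. S closure_of (h ` C i))"
  unfolding closed_chain_def
proof (intro conjI allI impI)
  note chD = closed_chainD[OF ch]
  have CV: "C i \<subseteq> V" if "i \<le> N" for i using closedin_subset[OF chD(1)[OF that]] by auto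
  have meet: "A \<inter> h ` C i \<noteq> {}" if A: "openin S A" "A \<inter> S closure_of (h ` C i) \<noteq> {}" for A i
  proof -
    obtain x where x: "x \<in> A" "x \<in> S closure_of (h ` C i)" using A(2) by blast
    have "\<exists>y. y \<in> h ` C i \<and> y \<in> A"
      using conjunct2[OF x(2)[unfolded in_closure_of], rule_format, of A] x(1) A(1) by simp
    thus ?thesis by blast
  qed
  have hS: "h ` C i \<subseteq> S closure_of (h ` C i)" if "i \<le> N" for i
    using CV[OF that] h(1) openin_subset[OF U] by (intro closure_of_subset) auto
  fix i assume i: "i \<le> N"
  show "closedin S (S closure_of (h ` C i))" by (rule closedin_closure_of)
  show "irreducible_space (subtopology S (S closure_of (h ` C i)))"
  proof (rule irreducible_subtopologyI)
    have "S closure_of (h ` C i) \<noteq> {}" using hS[OF i] closed_chain_nonempty[OF ch i] by auto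
    thus "topspace S \<inter> S closure_of (h ` C i) \<noteq> {}" using closure_of_subset_topspace[of S "h ` C i"] by blast
    fix A B assume A: "openin S A" "A \<inter> S closure_of (h ` C i) \<noteq> {}" and B: "openin S B" "B \<inter> S closure_of (h ` C i) \<noteq> {}"
    let ?p = "\<lambda>A. {z \<in> V. h z \<in> A}"
    have o: "openin (subtopology T V) (?p A)" if "openin S A" for A
      using h(2)[OF that] V by (auto simp: openin_open_subtopology)
    have "?p A \<inter> C i \<noteq> {}" "?p B \<inter> C i \<noteq> {}"
      using meet[OF A] meet[OF B] CV[OF i] by auto
    hence "?p A \<inter> ?p B \<inter> C i \<noteq> {}"
      by (intro irreducible_subtopologyD[OF chD(2)[OF i]] o A B)
    then obtain z where z: "z \<in> C i" "h z \<in> A" "h z \<in> B" by blast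
    hence "h z \<in> S closure_of (h ` C i)" using hS[OF i] by blast
    thus "A \<inter> B \<inter> S closure_of (h ` C i) \<noteq> {}" using z by blast
  qed
next
  note chD = closed_chainD[OF ch]
  fix i assume i: "i < N"
  hence i': "i \<le> N" "Suc i \<le> N" by auto
  have CV: "C i \<subseteq> V" "C (Suc i) \<subseteq> V" using closedin_subset[OF chD(1)[OF i'(1)]] closedin_subset[OF chD(1)[OF i'(2)]] by auto
  have "S closure_of (h ` C i) \<subseteq> S closure_of (h ` C (Suc i))"
    using chD(3)[OF i] by (intro closure_of_mono) blast
  moreover obtain z where z: "z \<in> C (Suc i)" "z \<notin> C i" using chD(3)[OF i] by blast
  have "h z \<notin> S closure_of (h ` C i)"
  proof
    assume hz: "h z \<in> S closure_of (h ` C i)"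
    have "openin (subtopology T V) (topspace (subtopology T V) - C i)" using chD(1)[OF i'(1)] by blast
    hence "openin T (V - C i)"
      using V openin_subset[OF V] by (simp add: openin_open_subtopology Int_absorb1)
    from f(2)[OF this] have o: "openin S {x \<in> U. f x \<in> V - C i}" .
    have mem: "h z \<in> {x \<in> U. f x \<in> V - C i}" using z CV h(1) fh by auto
    obtain c where "c \<in> C i" "f (h c) \<in> V - C i"
      using mp[OF spec[OF conjunct2[OF hz[unfolded in_closure_of]]] conjI[OF mem o]] by blast
    thus False using fh CV by auto
  qed
  moreover have "h z \<in> S closure_of (h ` C (Suc i))"
  proof -
    have "h ` C (Suc i) \<subseteq> topspace S" using CV(2) h(1) openin_subset[OF U] by auto
    thus ?thesis using closure_of_subset z(1) by blast
  qed
  ultimately show "S closure_of (h ` C i) \<subset> S closure_of (h ` C (Suc i))" by blast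
qed

section \<open>Rational maps\<close>

lemma irreducible_varietyD:
  assumes "irreducible_variety X"
  shows "variety X" "prevariety X" "space_with_functions X" "irreducible_space (zar X)" "points X \<noteq> {}"
  using assms by (auto simp: irreducible_variety_def variety_def prevariety_def irreducible_space_def)

lemma rat_reps_iff:
  assumes "space_with_functions Y"
  shows "(U, f) \<in> rat_reps X Y \<longleftrightarrow> U \<noteq> {} \<and> f \<in> extensional U \<and> morph_on X U Y f"
  unfolding rat_reps_def using morph_on_iff[OF _ assms, of X U f] morph_on_openin[of X U Y f] by auto

lemma rat_reps_restrict:
  assumes "space_with_functions Y" "U \<noteq> {}" "morph_on X U Y f"
  shows "(U, restrict f U) \<in> rat_reps X Y"
  unfolding rat_reps_iff[OF assms(1)] using assms(2) morph_on_eqI[OF assms(3), of "restrict f U"] by simp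

text \<open>\<open>rat_eq\<close> asks for agreement on the whole common domain. Separatedness of
  \<open>Y\<close> makes the locus of disagreement open, and irreducibility of \<open>X\<close>
  leaves no room for it beside \<open>O'\<close>.\<close>

lemma rat_eqI:
  assumes X: "irreducible_variety X" and Y: "irreducible_variety Y"
    and f: "(U, f) \<in> rat_reps X Y" and g: "(V, g) \<in> rat_reps X Y"
    and O: "openin (zar X) O'" "O' \<noteq> {}" and eq: "\<And>x. x \<in> O' \<Longrightarrow> x \<in> U \<Longrightarrow> x \<in> V \<Longrightarrow> f x = g x"
  shows "((U, f), (V, g)) \<in> rat_eq X Y"
proof -
  note XD = irreducible_varietyD[OF X] and YD = irreducible_varietyD[OF Y]
  have f': "morph_on X U Y f" and g': "morph_on X V Y g"
    using f g unfolding rat_reps_iff[OF YD(3)] by auto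
  have UV: "openin (zar X) (U \<inter> V)" using morph_on_openin[OF f'] morph_on_openin[OF g'] by auto
  have "openin (zar X) {x \<in> U \<inter> V. f x \<noteq> g x}"
    by (rule equalizer_openin[OF XD(2) YD(1)]; rule morph_on_subset[OF XD(3) _ UV])
      (use f' g' in auto)
  moreover have "O' \<inter> {x \<in> U \<inter> V. f x \<noteq> g x} = {}" using eq by auto
  ultimately have "{x \<in> U \<inter> V. f x \<noteq> g x} = {}"
    using irreducible_space_Int[OF XD(4) O] by blast
  thus ?thesis using f g unfolding rat_eq_def by blast
qed

lemma rat_eqD: "((U, f), (V, g)) \<in> rat_eq X Y \<Longrightarrow> x \<in> U \<Longrightarrow> x \<in> V \<Longrightarrow> f x = g x"
  and rat_eq_reps: "((U, f), (V, g)) \<in> rat_eq X Y \<Longrightarrow> (U, f) \<in> rat_reps X Y"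
    "((U, f), (V, g)) \<in> rat_eq X Y \<Longrightarrow> (V, g) \<in> rat_reps X Y"
  by (auto simp: rat_eq_def)

lemma rat_reps_openin: "(U, f) \<in> rat_reps X Y \<Longrightarrow> openin (zar X) U"
  and rat_reps_nonempty: "(U, f) \<in> rat_reps X Y \<Longrightarrow> U \<noteq> {}"
  by (auto simp: rat_reps_def)

text \<open>Transitivity is the only real point: the outer maps agree with the middle one on its
  domain, and this suffices by \<open>rat_eqI\<close>.\<close>

lemma equiv_rat_eq:
  assumes X: "irreducible_variety X" and Y: "irreducible_variety Y"
  shows "equiv (rat_reps X Y) (rat_eq X Y)"
proof (rule equivI)
  show "rat_eq X Y \<subseteq> rat_reps X Y \<times> rat_reps X Y" by (auto simp: rat_eq_def)
  show "refl_on (rat_reps X Y) (rat_eq X Y)" by (auto simp: rat_eq_def refl_on_def)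
  show "sym (rat_eq X Y)" by (auto simp: rat_eq_def sym_def)
  show "trans (rat_eq X Y)"
  proof (rule transI)
    fix a b c assume ab: "(a, b) \<in> rat_eq X Y" and bc: "(b, c) \<in> rat_eq X Y"
    obtain U f V g W h where abc: "a = (U, f)" "b = (V, g)" "c = (W, h)" by (metis prod.exhaust)
    note ab' = ab[unfolded abc] and bc' = bc[unfolded abc]
    show "(a, c) \<in> rat_eq X Y"
      unfolding abc
      by (rule rat_eqI[OF X Y rat_eq_reps(1)[OF ab'] rat_eq_reps(2)[OF bc']
            rat_reps_openin[OF rat_eq_reps(2)[OF ab']] rat_reps_nonempty[OF rat_eq_reps(2)[OF ab']]])
        (metis rat_eqD[OF ab'] rat_eqD[OF bc'])
  qed
qed

lemma rational_maps_class:
  assumes X: "irreducible_variety X" and Y: "irreducible_variety Y" and P: "\<Phi> \<in> rational_maps X Y" and a: "a \<in> \<Phi>"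
  shows "\<Phi> = rat_eq X Y `` {a}" "a \<in> rat_reps X Y"
proof -
  note eq = equiv_rat_eq[OF X Y]
  show "a \<in> rat_reps X Y" using P a in_quotient_imp_subset[OF eq] unfolding rational_maps_def by blast
  obtain b where "\<Phi> = rat_eq X Y `` {b}" using P unfolding rational_maps_def by (auto elim: quotientE)
  thus "\<Phi> = rat_eq X Y `` {a}" using a equiv_class_eq[OF eq, of b a] by simp
qed

lemma rational_maps_agree:
  assumes X: "irreducible_variety X" and Y: "irreducible_variety Y" and P: "\<Phi> \<in> rational_maps X Y"
    and "(U, f) \<in> \<Phi>" "(V, g) \<in> \<Phi>" "x \<in> U" "x \<in> V"
  shows "f x = g x"
proof -
  have "((U, f), (V, g)) \<in> rat_eq X Y"
    using rational_maps_class(1)[OF X Y P assms(4)] assms(5) by blast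
  thus ?thesis by (rule rat_eqD) fact+
qed

lemma rat_class_self:
  assumes X: "irreducible_variety X" and Y: "irreducible_variety Y" and a: "a \<in> rat_reps X Y"
  shows "rat_eq X Y `` {a} \<in> rational_maps X Y" "a \<in> rat_eq X Y `` {a}"
  using equiv_class_self[OF equiv_rat_eq[OF X Y] a] a unfolding rational_maps_def by (auto intro: quotientI)

lemma rat_class_eqI:
  assumes X: "irreducible_variety X" and Y: "irreducible_variety Y" and "(a, b) \<in> rat_eq X Y"
  shows "rat_eq X Y `` {a} = rat_eq X Y `` {b}"
  by (rule equiv_class_eq[OF equiv_rat_eq[OF X Y] assms(3)])

lemma compose_rat_reps:
  assumes Y: "space_with_functions Y" and Z: "space_with_functions Z"
    and f: "(U, f) \<in> rat_reps X Y" and g: "(V, g) \<in> rat_reps Y Z" and ne: "{x \<in> U. f x \<in> V} \<noteq> {}"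
  shows "({x \<in> U. f x \<in> V}, compose {x \<in> U. f x \<in> V} g f) \<in> rat_reps X Z"
proof -
  have "morph_on X U Y f" "morph_on Y V Z g" using f g unfolding rat_reps_iff[OF Y] rat_reps_iff[OF Z] by auto
  from rat_reps_restrict[OF Z ne morph_on_compose[OF this]] show ?thesis
    by (simp add: compose_def)
qed

text \<open>The union in \<open>rat_comp\<close> runs over all pairs of representatives. Those with
  a nonempty composite domain give the same class by \<open>rat_eqI\<close>; the others contribute
  the empty set, because \<open>rat_reps\<close> excludes empty domains.\<close>

lemma rat_comp_eq:
  assumes X: "irreducible_variety X" and Y: "irreducible_variety Y" and Z: "irreducible_variety Z"
    and P: "\<Phi> \<in> rational_maps X Y" and Q: "\<Psi> \<in> rational_maps Y Z"
    and f: "(U, f) \<in> \<Phi>" and g: "(V, g) \<in> \<Psi>" and ne: "{x \<in> U. f x \<in> V} \<noteq> {}"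
  shows "rat_comp X Y Z \<Psi> \<Phi> = rat_eq X Z `` {({x \<in> U. f x \<in> V}, compose {x \<in> U. f x \<in> V} g f)}"
proof -
  let ?c = "\<lambda>U f V g. ({x \<in> U. f x \<in> V}, compose {x \<in> U. f x \<in> V} g f)"
  note Ys = irreducible_varietyD(3)[OF Y] and Zs = irreducible_varietyD(3)[OF Z]
  note rep = compose_rat_reps[OF Ys Zs rational_maps_class(2)[OF X Y P] rational_maps_class(2)[OF Y Z Q]]
  have c: "?c U f V g \<in> rat_reps X Z" by (rule rep[OF f g ne])
  have sub: "rat_eq X Z `` {?c U' f' V' g'} \<subseteq> rat_eq X Z `` {?c U f V g}"
    if f': "(U', f') \<in> \<Phi>" and g': "(V', g') \<in> \<Psi>" for U' f' V' g'
  proof (cases "{x \<in> U'. f' x \<in> V'} = {}")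
    case True
    thus ?thesis by (auto simp: rat_eq_def rat_reps_def)
  next
    case False
    note c' = rep[OF f' g' False]
    have "(?c U' f' V' g', ?c U f V g) \<in> rat_eq X Z"
    proof (rule rat_eqI[OF X Z c' c rat_reps_openin[OF c] ne])
      fix x assume x: "x \<in> {x \<in> U'. f' x \<in> V'}" "x \<in> {x \<in> U. f x \<in> V}"
      have "f' x = f x" using rational_maps_agree[OF X Y P f' f] x by auto
      moreover have "g' (f x) = g (f x)" using rational_maps_agree[OF Y Z Q g' g] x calculation by auto
      ultimately show "compose {x \<in> U'. f' x \<in> V'} g' f' x = compose {x \<in> U. f x \<in> V} g f x"
        using x by (simp add: compose_def)
    qed
    thus ?thesis using rat_class_eqI[OF X Z] by blast
  qed
  show ?thesis
  proof
    show "rat_comp X Y Z \<Psi> \<Phi> \<subseteq> rat_eq X Z `` {?c U f V g}"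
      unfolding rat_comp_def using sub by fast
    show "rat_eq X Z `` {?c U f V g} \<subseteq> rat_comp X Y Z \<Psi> \<Phi>"
      unfolding rat_comp_def using f g by fast
  qed
qed

text \<open>A dense image meets every nonempty open set; in this form dominance provides nonempty
  domains for composites.\<close>

lemma dominant_rep:
  assumes "dominant X Y \<Phi>"
  obtains U f where "\<Phi> \<in> rational_maps X Y" "(U, f) \<in> \<Phi>"
    "\<And>V. openin (zar Y) V \<Longrightarrow> V \<noteq> {} \<Longrightarrow> {x \<in> U. f x \<in> V} \<noteq> {}"
proof -
  obtain U f where Uf: "\<Phi> \<in> rational_maps X Y" "(U, f) \<in> \<Phi>" "zar Y closure_of (f ` U) = points Y"
    using assms unfolding dominant_def by blast
  have "{x \<in> U. f x \<in> V} \<noteq> {}" if V: "openin (zar Y) V" "V \<noteq> {}" for V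
  proof -
    obtain z where "z \<in> V" using V by blast
    hence "z \<in> zar Y closure_of (f ` U)" using Uf(3) openin_subset[OF V(1)] by auto
    thus ?thesis using \<open>z \<in> V\<close> V(1) unfolding in_closure_of by blast
  qed
  thus thesis using that Uf by blast
qed

lemma rat_id_rep:
  assumes X: "irreducible_variety X"
  shows "(points X, \<lambda>x\<in>points X. x) \<in> rat_reps X X"
  by (rule rat_reps_restrict[OF irreducible_varietyD(3,5)[OF X]])
    (rule morph_on_id[OF irreducible_varietyD(3)[OF X]], simp)

text \<open>Equal classes have representatives that agree on their whole common domain, so the
  identity holds at every point where the composite is defined.\<close>

lemma rat_comp_id_agree:
  assumes X: "irreducible_variety X" and Y: "irreducible_variety Y"
    and P: "\<Phi> \<in> rational_maps X Y" and Q: "\<Psi> \<in> rational_maps Y X"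
    and f: "(U, f) \<in> \<Phi>" and g: "(V, g) \<in> \<Psi>" and id: "rat_comp X Y X \<Psi> \<Phi> = rat_id X"
    and x: "x \<in> U" "f x \<in> V"
  shows "g (f x) = x"
proof -
  let ?W = "{x \<in> U. f x \<in> V}"
  have ne: "?W \<noteq> {}" using x by blast
  have rep: "(?W, compose ?W g f) \<in> rat_reps X X"
    by (rule compose_rat_reps[OF irreducible_varietyD(3)[OF Y] irreducible_varietyD(3)[OF X]
          rational_maps_class(2)[OF X Y P f] rational_maps_class(2)[OF Y X Q g] ne])
  have "(?W, compose ?W g f) \<in> rat_id X"
    unfolding id[symmetric] rat_comp_eq[OF X Y X P Q f g ne] by (rule rat_class_self(2)[OF X X rep])
  hence "((points X, \<lambda>x\<in>points X. x), (?W, compose ?W g f)) \<in> rat_eq X X"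
    by (simp add: rat_id_def rat_of_morphism_def)
  moreover have "x \<in> points X" using rat_reps_openin[OF rep] x openin_subset by blast
  ultimately show ?thesis using rat_eqD[of "points X" "\<lambda>x\<in>points X. x" ?W "compose ?W g f" X X x] x
    by (simp add: compose_def)
qed

text \<open>Cutting the domains down to \<open>{x \<in> U. f x \<in> W}\<close> and
  \<open>{z \<in> W. h z \<in> U}\<close> makes the two maps inverse bijections, since the
  composites are pointwise the identity wherever they are defined.\<close>

lemma birational_inverse:
  assumes X: "irreducible_variety X" and Y: "irreducible_variety Y" and b: "birational X Y \<Phi>"
  obtains U f V h where "U \<noteq> {}" "V \<noteq> {}" "morph_on X U Y f" "morph_on Y V X h"
    "f \<in> U \<rightarrow> V" "h \<in> V \<rightarrow> U" "\<And>x. x \<in> U \<Longrightarrow> h (f x) = x" "\<And>z. z \<in> V \<Longrightarrow> f (h z) = z"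
    "(U, restrict f U) \<in> \<Phi>" "\<Phi> \<in> rational_maps X Y"
proof -
  obtain \<Psi> where dP: "dominant X Y \<Phi>" and dQ: "dominant Y X \<Psi>"
    and id1: "rat_comp X Y X \<Psi> \<Phi> = rat_id X" and id2: "rat_comp Y X Y \<Phi> \<Psi> = rat_id Y"
    using b unfolding birational_def by blast
  obtain U f where P: "\<Phi> \<in> rational_maps X Y" and f: "(U, f) \<in> \<Phi>"
    and fd: "\<And>V. openin (zar Y) V \<Longrightarrow> V \<noteq> {} \<Longrightarrow> {x \<in> U. f x \<in> V} \<noteq> {}"
    by (rule dominant_rep[OF dP]) blast
  obtain W h where Q: "\<Psi> \<in> rational_maps Y X" and h: "(W, h) \<in> \<Psi>"
    and "\<And>V. openin (zar X) V \<Longrightarrow> V \<noteq> {} \<Longrightarrow> {x \<in> W. h x \<in> V} \<noteq> {}"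
    by (rule dominant_rep[OF dQ]) blast
  note Xs = irreducible_varietyD(3)[OF X] and Ys = irreducible_varietyD(3)[OF Y]
  note fr = rational_maps_class(2)[OF X Y P f] and hr = rational_maps_class(2)[OF Y X Q h]
  have fm: "morph_on X U Y f" using fr unfolding rat_reps_iff[OF Ys] by blast
  have hm: "morph_on Y W X h" using hr unfolding rat_reps_iff[OF Xs] by blast
  have hf: "h (f x) = x" if "x \<in> U" "f x \<in> W" for x by (rule rat_comp_id_agree[OF X Y P Q f h id1 that])
  have fh: "f (h z) = z" if "z \<in> W" "h z \<in> U" for z by (rule rat_comp_id_agree[OF Y X Q P h f id2 that])
  let ?U = "{x \<in> U. f x \<in> W}" and ?V = "{z \<in> W. h z \<in> U}"
  have Uo: "openin (zar X) ?U" by (rule morph_on_vimage[OF fm morph_on_openin[OF hm]])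
  have Vo: "openin (zar Y) ?V" by (rule morph_on_vimage[OF hm morph_on_openin[OF fm]])
  have Une: "?U \<noteq> {}" by (rule fd[OF morph_on_openin[OF hm] rat_reps_nonempty[OF hr]])
  have fUV: "f \<in> ?U \<rightarrow> ?V" using hf by auto
  have fU: "morph_on X ?U Y f" by (rule morph_on_subset[OF Xs fm Uo]) auto
  show thesis
  proof (rule that[of ?U ?V f h])
    show "?V \<noteq> {}" using Une fUV by blast
    show "morph_on Y ?V X h" by (rule morph_on_subset[OF Ys hm Vo]) auto
    show "h \<in> ?V \<rightarrow> ?U" using fh by auto
    have "((U, f), (?U, restrict f ?U)) \<in> rat_eq X Y"
      by (rule rat_eqI[OF X Y fr rat_reps_restrict[OF Ys Une fU] Uo Une]) auto
    thus "(?U, restrict f ?U) \<in> \<Phi>" using rational_maps_class(1)[OF X Y P f] by blast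
    show "h (f x) = x" if "x \<in> ?U" for x using hf that by auto
    show "f (h z) = z" if "z \<in> ?V" for z using fh that by auto
  qed (fact Une fU fUV P)+
qed

lemma irreducible_variety_affine_space:
  "irreducible_variety (affine_space n :: ('k::field_char_0 vec, 'k) fspace)"
  unfolding irreducible_variety_def
proof
  let ?A = "affine_space n :: ('k vec, 'k) fspace"
  show "variety ?A" by (rule variety_affine_space)
  show "irreducible_space (zar ?A)"
  proof (rule irreducible_spaceI)
    show "points ?A \<noteq> {}" by (simp add: points_affine_space_with ex_in_conv[symmetric]) (rule exI[of _ "0\<^sub>v n"], simp)
    fix A B assume A: "openin (zar ?A) A" "A \<noteq> {}" and B: "openin (zar ?A) B" "B \<noteq> {}"
    obtain a b where ab: "a \<in> A" "b \<in> B" using A B by blast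
    obtain p where p: "p \<in> poly_fun n" "p a \<noteq> 0" "{v \<in> carrier_vec n. p v \<noteq> 0} \<subseteq> A"
      using A(1) ab(1) unfolding openin_affine_space_with[OF order_refl] by blast
    obtain q where q: "q \<in> poly_fun n" "q b \<noteq> 0" "{v \<in> carrier_vec n. q v \<noteq> 0} \<subseteq> B"
      using B(1) ab(2) unfolding openin_affine_space_with[OF order_refl] by blast
    have "a \<in> carrier_vec n" "b \<in> carrier_vec n"
      using ab A B unfolding openin_affine_space_with[OF order_refl] by blast+
    then obtain c where "c \<in> carrier_vec n" "p c \<noteq> 0" "q c \<noteq> 0"
      using poly_fun_mult_nonzero[OF p(1) q(1) _ p(2) _ q(2)] by blast
    thus "A \<inter> B \<noteq> {}" using p(3) q(3) by blast
  qed
qed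

section \<open>Linear actions as rational actions\<close>

lemma poly_fun_mult_mat_vec:
  assumes "M \<in> carrier_mat n n" "i < n"
  obtains p where "p \<in> poly_fun n" "\<And>v. v \<in> carrier_vec n \<Longrightarrow> p v = (M *\<^sub>v v) $ i"
proof (rule that[of "\<lambda>v. \<Sum>j<n. M $$ (i, j) * v $ j"])
  show "(\<lambda>v. \<Sum>j<n. M $$ (i, j) * v $ j) \<in> poly_fun n"
    by (intro poly_fun_sum poly_fun.mult poly_fun.const poly_fun.coord) simp
  show "(\<Sum>j<n. M $$ (i, j) * v $ j) = (M *\<^sub>v v) $ i" if "v \<in> carrier_vec n" for v
    using assms that by (auto simp: scalar_prod_def lessThan_atLeast0 intro!: sum.cong)
qed

text \<open>\<open>rational_of_linear\<close> with the matrix itself as argument, so that products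
  and inverses can be taken among matrices.\<close>

definition lin_map :: "nat \<Rightarrow> 'k::field mat \<Rightarrow> ('k vec set \<times> ('k vec \<Rightarrow> 'k vec)) set" where
  "lin_map n M = rat_of_morphism (affine_space n) (affine_space n) (\<lambda>v\<in>carrier_vec n. M *\<^sub>v v)"

lemma openin_affine_all: "openin (zar (affine_space n)) (carrier_vec n)"
  using openin_topspace[of "zar (affine_space n)"] by (simp add: points_affine_space_with)

lemma lin_map_rep:
  fixes M :: "'k::field_char_0 mat"
  assumes M: "M \<in> carrier_mat n n"
  shows "(carrier_vec n, \<lambda>v\<in>carrier_vec n. M *\<^sub>v v) \<in> rat_reps (affine_space n) (affine_space n)"
    and "lin_map n M = rat_eq (affine_space n) (affine_space n) `` {(carrier_vec n, \<lambda>v\<in>carrier_vec n. M *\<^sub>v v)}"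
    and "(carrier_vec n, \<lambda>v\<in>carrier_vec n. M *\<^sub>v v) \<in> lin_map n M"
    and "lin_map n M \<in> rational_maps (affine_space n) (affine_space n)"
proof -
  let ?A = "affine_space n :: ('k vec, 'k) fspace"
  note A = irreducible_variety_affine_space[of n, where 'k = 'k]
  note AD = irreducible_varietyD[OF A]
  have "morph_on ?A (carrier_vec n) ?A (\<lambda>v. M *\<^sub>v v)"
  proof (rule morph_on_affine[OF AD(2) openin_affine_all])
    show "M *\<^sub>v v \<in> carrier_vec n" if "v \<in> carrier_vec n" for v using M that by simp
    show "regular_on ?A (carrier_vec n) (\<lambda>v. (M *\<^sub>v v) $ i)" if i: "i < n" for i
    proof -
      obtain p where "p \<in> poly_fun n" "\<And>v. v \<in> carrier_vec n \<Longrightarrow> p v = (M *\<^sub>v v) $ i"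
        using poly_fun_mult_mat_vec[OF M i] by blast
      thus ?thesis using regular_on_eqI[OF regular_on_affine_poly, of p n "\<lambda>v. (M *\<^sub>v v) $ i"] by blast
    qed
  qed
  from rat_reps_restrict[OF AD(3) _ this]
  show r: "(carrier_vec n, \<lambda>v\<in>carrier_vec n. M *\<^sub>v v) \<in> rat_reps ?A ?A"
    using AD(5) by (simp add: points_affine_space_with)
  show e: "lin_map n M = rat_eq ?A ?A `` {(carrier_vec n, \<lambda>v\<in>carrier_vec n. M *\<^sub>v v)}"
    by (simp add: lin_map_def rat_of_morphism_def points_affine_space_with)
  show "(carrier_vec n, \<lambda>v\<in>carrier_vec n. M *\<^sub>v v) \<in> lin_map n M" "lin_map n M \<in> rational_maps ?A ?A"
    unfolding e using rat_class_self[OF A A r] by auto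
qed

lemma lin_map_comp:
  fixes M N :: "'k::field_char_0 mat"
  assumes M: "M \<in> carrier_mat n n" and N: "N \<in> carrier_mat n n"
  shows "rat_comp (affine_space n) (affine_space n) (affine_space n) (lin_map n M) (lin_map n N) = lin_map n (M * N)"
proof -
  let ?A = "affine_space n :: ('k vec, 'k) fspace"
  let ?L = "\<lambda>M::'k mat. \<lambda>v\<in>carrier_vec n. M *\<^sub>v v"
  note A = irreducible_variety_affine_space[of n, where 'k = 'k]
  have W: "{v \<in> carrier_vec n. ?L N v \<in> carrier_vec n} = carrier_vec n" using N by auto
  have ne: "carrier_vec n \<noteq> ({} :: 'k vec set)" using rat_reps_nonempty[OF lin_map_rep(1)[OF M]] .
  have "compose (carrier_vec n) (?L M) (?L N) = ?L (M * N)"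
    using M N by (auto simp: compose_def fun_eq_iff assoc_mult_mat_vec[of M n n N n])
  thus ?thesis
    using rat_comp_eq[OF A A A lin_map_rep(4)[OF N] lin_map_rep(4)[OF M] lin_map_rep(3)[OF N] lin_map_rep(3)[OF M]] ne
    unfolding W lin_map_rep(2)[OF mult_carrier_mat[OF M N]] by simp
qed

lemma lin_map_one: "lin_map n (1\<^sub>m n :: 'k::field mat) = rat_id (affine_space n)"
proof -
  have "(\<lambda>v\<in>carrier_vec n. 1\<^sub>m n *\<^sub>v v) = (\<lambda>v\<in>carrier_vec n. v :: 'k vec)" by (auto simp: fun_eq_iff)
  thus ?thesis by (simp add: lin_map_def rat_id_def points_affine_space_with)
qed

text \<open>The representatives are defined everywhere, so equal classes agree on the unit
  vectors.\<close>

lemma lin_map_inj: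
  fixes M N :: "'k::field_char_0 mat"
  assumes M: "M \<in> carrier_mat n n" and N: "N \<in> carrier_mat n n" and eq: "lin_map n M = lin_map n N"
  shows "M = N"
proof -
  note A = irreducible_variety_affine_space[of n, where 'k = 'k]
  have "M *\<^sub>v v = N *\<^sub>v v" if "v \<in> carrier_vec n" for v
    using rational_maps_agree[OF A A lin_map_rep(4)[OF M] lin_map_rep(3)[OF M], of "carrier_vec n" "\<lambda>v\<in>carrier_vec n. N *\<^sub>v v" v]
      lin_map_rep(3)[OF N] eq that by simp
  hence eq: "(M *\<^sub>v unit_vec n j) $ i = (N *\<^sub>v unit_vec n j) $ i" for i j by simp
  show ?thesis
  proof (rule eq_matI)
    fix i j assume "i < dim_row N" "j < dim_col N"
    thus "M $$ (i, j) = N $$ (i, j)" using eq[of j i] M N by simp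
  qed (use M N in auto)
qed

lemma lin_map_birational:
  fixes M N :: "'k::field_char_0 mat"
  assumes M: "M \<in> carrier_mat n n" and N: "N \<in> carrier_mat n n" and inv: "M * N = 1\<^sub>m n" "N * M = 1\<^sub>m n"
  shows "birational (affine_space n) (affine_space n) (lin_map n M)"
proof -
  have dom: "dominant (affine_space n) (affine_space n) (lin_map n M)"
    if M: "M \<in> carrier_mat n n" and N: "N \<in> carrier_mat n n" and MN: "M * N = 1\<^sub>m n" for M N :: "'k mat"
  proof -
    let ?L = "\<lambda>v\<in>carrier_vec n. M *\<^sub>v v"
    have "v \<in> ?L ` carrier_vec n" if "v \<in> carrier_vec n" for v
    proof (rule image_eqI)
      show "v = ?L (N *\<^sub>v v)" using that M N MN by (simp add: assoc_mult_mat_vec[symmetric, of M n n N n])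
      show "N *\<^sub>v v \<in> carrier_vec n" using N that by simp
    qed
    hence "?L ` carrier_vec n = carrier_vec n" using M by auto
    hence "zar (affine_space n) closure_of (?L ` carrier_vec n) = points (affine_space n)"
      using closure_of_topspace[of "zar (affine_space n)"] by (simp add: points_affine_space_with)
    thus ?thesis unfolding dominant_def using lin_map_rep(3,4)[OF M] by blast
  qed
  show ?thesis unfolding birational_def
    using dom[OF M N inv(1)] dom[OF N M inv(2)] lin_map_comp[OF M N] lin_map_comp[OF N M] inv lin_map_one[of n]
    by (intro conjI exI[of _ "lin_map n N"]) simp_all
qed

text \<open>The chart is taken around a point of the smallest member \<open>C 0\<close>, so that the
  chain keeps its length when restricted to it.\<close>

lemma krull_dim_alg_independent:
  fixes X :: "('a, 'k::field) fspace"
  assumes X: "irreducible_variety X" and N: "enat N \<le> krull_dim (zar X)" "N \<ge> 1"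
  obtains U F where "openin (zar X) U" "U \<noteq> {}" "\<And>x. F x \<in> carrier_vec N"
    "\<And>i. i < N \<Longrightarrow> regular_on X U (\<lambda>x. F x $ i)" "alg_independent U N F"
proof -
  note XD = irreducible_varietyD[OF X]
  obtain C where C: "closed_chain (zar X) N C" using krull_dim_chain[OF N] by blast
  obtain z where z: "z \<in> C 0" using closed_chain_nonempty[OF C, of 0] by blast
  have "z \<in> points X" using closedin_subset[OF closed_chainD(1)[OF C, of 0]] z by auto
  then obtain V m \<xi> where c: "chart X V m \<xi>" "z \<in> V"
    using prevariety_chart_fraction[OF XD(2)] by metis
  have "closed_chain (subtopology (zar X) V) N (\<lambda>i. C i \<inter> V)"
    using z c(2) by (intro closed_chain_restrict[OF C chart_openin[OF c(1)]]) auto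
  from chain_alg_independent[OF XD(3) c(1) this] obtain f where f: "\<And>i. i < N \<Longrightarrow> f i \<in> poly_fun m"
    and ind: "alg_independent (C N \<inter> V) N (\<lambda>z. vec N (\<lambda>i. f i (\<xi> z)))" by blast
  show thesis
  proof (rule that[of V "\<lambda>z. vec N (\<lambda>i. f i (\<xi> z))"])
    show "V \<noteq> {}" using c(2) by blast
    show "regular_on X V (\<lambda>x. vec N (\<lambda>i. f i (\<xi> x)) $ i)" if "i < N" for i
      using chart_poly[OF XD(3) c(1) f[OF that]] that by simp
    show "alg_independent V N (\<lambda>z. vec N (\<lambda>i. f i (\<xi> z)))"
      using ind unfolding alg_independent_def by blast
  qed (simp_all add: chart_openin[OF c(1)])
qed

text \<open>\<open>\<zeta>\<close> is a root of \<open>1 + z + ... + z ^ (r - 1)\<close>. At 1 this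
  polynomial has the value \<open>r\<close>, which is nonzero in characteristic zero.\<close>

lemma root_of_unity_neq_1:
  assumes "r \<ge> 2"
  obtains \<zeta> :: "'k::{alg_closed_field, field_char_0}" where "\<zeta> ^ r = 1" "\<zeta> \<noteq> 1"
proof -
  obtain \<zeta> :: 'k where z: "(\<Sum>k\<le>r - 1. 1 * \<zeta> ^ k) = 0"
    using alg_closed[of "r - 1" "\<lambda>_. 1 :: 'k"] assms by auto
  have "{..r - 1} = {..<r}" using assms by auto
  hence z': "(\<Sum>k<r. \<zeta> ^ k) = 0" using z by simp
  have "\<zeta> ^ r - 1 = (\<zeta> - 1) * (\<Sum>k<r. \<zeta> ^ k)" by (rule power_diff_1_eq)
  moreover have "\<zeta> \<noteq> 1" using z' assms by auto
  ultimately show thesis using that[of \<zeta>] z' by simp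
qed

text \<open>The norm of a coordinate: \<open>f\<close> is the product over \<open>G\<close> of the
  linear forms \<open>v \<mapsto> (\<alpha> g *\<^sub>v v) $ 0\<close>, which \<open>G\<close>
  permutes. Each form takes the value 1 at a translate of the first unit vector, so the product is
  not the zero function.\<close>

lemma invariant_polynomial:
  fixes \<alpha> :: "'g \<Rightarrow> 'k::field_char_0 mat" and G :: "('g, 'm) monoid_scheme"
  assumes G: "group G" "finite (carrier G)" and n: "n \<ge> 1" and \<alpha>: "\<And>g. \<alpha> g \<in> carrier_mat n n" "\<alpha> \<one>\<^bsub>G\<^esub> = 1\<^sub>m n"
    and hom: "\<And>g h. g \<in> carrier G \<Longrightarrow> h \<in> carrier G \<Longrightarrow> \<alpha> (g \<otimes>\<^bsub>G\<^esub> h) = \<alpha> g * \<alpha> h"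
  obtains f where "f \<in> poly_fun n" "\<And>h v. h \<in> carrier G \<Longrightarrow> v \<in> carrier_vec n \<Longrightarrow> f (\<alpha> h *\<^sub>v v) = f v"
    "\<And>c v. v \<in> carrier_vec n \<Longrightarrow> f (c \<cdot>\<^sub>v v) = c ^ card (carrier G) * f v"
    "\<exists>a\<in>carrier_vec n. f a \<noteq> 0"
proof -
  interpret G: group G by (rule G(1))
  have n0: "0 < n" using n by simp
  have "\<forall>g. \<exists>p. p \<in> poly_fun n \<and> (\<forall>v\<in>carrier_vec n. p v = (\<alpha> g *\<^sub>v v) $ 0)"
    using poly_fun_mult_mat_vec[OF \<alpha>(1) n0] by metis
  then obtain p where p': "\<forall>g. p g \<in> poly_fun n \<and> (\<forall>v\<in>carrier_vec n. p g v = (\<alpha> g *\<^sub>v v) $ 0)"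
    by (elim choice[THEN exE])
  have p: "p g \<in> poly_fun n" "v \<in> carrier_vec n \<Longrightarrow> p g v = (\<alpha> g *\<^sub>v v) $ 0" for g v
    using p' by auto
  show thesis
  proof (rule that[of "\<lambda>v. \<Prod>g\<in>carrier G. p g v"])
    show "(\<lambda>v. \<Prod>g\<in>carrier G. p g v) \<in> poly_fun n" by (intro poly_fun_prod p)
    show "(\<Prod>g\<in>carrier G. p g (\<alpha> h *\<^sub>v v)) = (\<Prod>g\<in>carrier G. p g v)"
      if h: "h \<in> carrier G" and v: "v \<in> carrier_vec n" for h v
    proof (rule prod.reindex_bij_witness[of _ "\<lambda>g. g \<otimes>\<^bsub>G\<^esub> inv\<^bsub>G\<^esub> h" "\<lambda>g. g \<otimes>\<^bsub>G\<^esub> h"], goal_cases)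
      case (5 g)
      have "p (g \<otimes>\<^bsub>G\<^esub> h) v = (\<alpha> g *\<^sub>v (\<alpha> h *\<^sub>v v)) $ 0"
        using p(2)[OF v] hom[OF 5 h] assoc_mult_mat_vec[OF \<alpha>(1) \<alpha>(1) v, of g h] by simp
      also have "\<dots> = p g (\<alpha> h *\<^sub>v v)" by (rule p(2)[symmetric]) (use \<alpha>(1)[of h] v in simp)
      finally show ?case .
    qed (use h in \<open>simp_all add: G.m_assoc\<close>)
    show "(\<Prod>g\<in>carrier G. p g (c \<cdot>\<^sub>v v)) = c ^ card (carrier G) * (\<Prod>g\<in>carrier G. p g v)"
      if v: "v \<in> carrier_vec n" for c v
    proof -
      have "p g (c \<cdot>\<^sub>v v) = c * p g v" for g
        using p(2)[OF v, of g] p(2)[of "c \<cdot>\<^sub>v v" g] v \<alpha>(1)[of g] n0 by (simp add: mult_mat_vec)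
      thus ?thesis by (simp add: prod.distrib)
    qed
    show "\<exists>a\<in>carrier_vec n. (\<Prod>g\<in>carrier G. p g a) \<noteq> 0"
    proof (rule poly_fun_nonzero_linear_prod[OF G(2)])
      fix g assume g: "g \<in> carrier G"
      show "p g \<in> poly_fun n" by (rule p)
      let ?a = "\<alpha> (inv\<^bsub>G\<^esub> g) *\<^sub>v unit_vec n 0"
      have a: "?a \<in> carrier_vec n" using \<alpha>(1)[of "inv\<^bsub>G\<^esub> g"] by simp
      have "\<alpha> g *\<^sub>v ?a = (\<alpha> g * \<alpha> (inv\<^bsub>G\<^esub> g)) *\<^sub>v unit_vec n 0"
        by (rule assoc_mult_mat_vec[OF \<alpha>(1) \<alpha>(1), symmetric]) simp
      also have "\<alpha> g * \<alpha> (inv\<^bsub>G\<^esub> g) = 1\<^sub>m n"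
        unfolding hom[OF g G.inv_closed[OF g], symmetric] G.r_inv[OF g] by (rule \<alpha>(2))
      also have "1\<^sub>m n *\<^sub>v unit_vec n 0 = (unit_vec n 0 :: 'k vec)" by simp
      finally have "p g ?a = 1" using p(2)[OF a, of g] n0 by simp
      thus "\<exists>a\<in>carrier_vec n. p g a \<noteq> 0" using a by (intro bexI[of _ ?a]) auto
    qed
  qed
qed

section \<open>The compression into the linear representation\<close>

theorem theorem2p10:
  fixes G :: "('g, 'm) monoid_scheme"
    and X :: "('a, 'k::{alg_closed_field, field_char_0}) fspace"
    and \<rho> :: "'g \<Rightarrow> ('a set \<times> ('a \<Rightarrow> 'a)) set"
    and n :: nat
  assumes "n \<ge> 1"
    and "group G" and "finite (carrier G)"
    and "irreducible_variety X" and "krull_dim (zar X) = enat n"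
    and "rational_action G X \<rho>"
    and "has_fixed_point TYPE('b) G X \<rho>"
  shows "\<exists>\<alpha> :: 'g \<Rightarrow> 'k mat.
           faithful_linear_action G n \<alpha> \<and>
           nontrivial_base_change G X \<rho> (affine_space n) (rational_of_linear n \<alpha>)"
proof -
  interpret G: group G by fact
  note n1 = assms(1) and Gg = assms(2) and Gf = assms(3) and X = assms(4) and krX = assms(5)
  obtain Y :: "('b, 'k) fspace" and \<sigma> y where reg: "regularization G X \<rho> Y \<sigma>"
    and y: "y \<in> points Y" and fy: "\<And>g. g \<in> carrier G \<Longrightarrow> \<sigma> g y = y"
    using assms(7) unfolding has_fixed_point_def by blast
  obtain \<Phi> where Y: "irreducible_variety Y" and sm: "smooth_variety Y" and act: "regular_action G Y \<sigma>"
    and bir: "birational X Y \<Phi>" and eqv: "equivariant G X \<rho> Y (\<lambda>g. rat_of_morphism Y Y (\<sigma> g)) \<Phi>"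
    using reg unfolding regularization_def by blast
  interpret act: group_action G "points Y" \<sigma> using act by (simp add: regular_action_def)
  note XD = irreducible_varietyD[OF X] and YD = irreducible_varietyD[OF Y]
  have \<rho>hom: "\<rho> \<in> hom G (Bir X)" and \<rho>inj: "inj_on \<rho> (carrier G)"
    using assms(6) by (auto simp: rational_action_def)
  have \<rho>dom: "dominant X X (\<rho> g)" if "g \<in> carrier G" for g
    using hom_in_carrier[OF \<rho>hom that] by (simp add: Bir_def birational_def)
  obtain U f V1 h where Une: "U \<noteq> {}" and V1ne: "V1 \<noteq> {}" and fm: "morph_on X U Y f" and hm: "morph_on Y V1 X h"
    and fUV: "f \<in> U \<rightarrow> V1" and hVU: "h \<in> V1 \<rightarrow> U" and hf: "\<And>x. x \<in> U \<Longrightarrow> h (f x) = x"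
    and fh: "\<And>z. z \<in> V1 \<Longrightarrow> f (h z) = z" and fP: "(U, restrict f U) \<in> \<Phi>" and P: "\<Phi> \<in> rational_maps X Y"
    by (rule birational_inverse[OF X Y bir]) blast
  note Uo = morph_on_openin[OF fm] and V1o = morph_on_openin[OF hm]
  obtain d V w \<alpha> where V: "openin (zar Y) V" "V \<noteq> {}" and st: "\<And>g x. g \<in> carrier G \<Longrightarrow> x \<in> V \<Longrightarrow> \<sigma> g x \<in> V"
    and w: "\<And>x. w x \<in> carrier_vec d" and rw: "\<And>i. i < d \<Longrightarrow> regular_on Y V (\<lambda>x. w x $ i)"
    and \<alpha>c': "\<And>g. \<alpha> g \<in> carrier_mat d d" and \<alpha>1': "\<alpha> \<one>\<^bsub>G\<^esub> = 1\<^sub>m d"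
    and \<alpha>m: "\<And>g h. g \<in> carrier G \<Longrightarrow> h \<in> carrier G \<Longrightarrow> \<alpha> (g \<otimes>\<^bsub>G\<^esub> h) = \<alpha> g * \<alpha> h"
    and weq: "\<And>g x. g \<in> carrier G \<Longrightarrow> x \<in> V \<Longrightarrow> w (\<sigma> g x) = \<alpha> g *\<^sub>v w x"
    and faith': "\<And>g. g \<in> carrier G \<Longrightarrow> \<alpha> g = 1\<^sub>m d \<Longrightarrow> \<exists>O'. openin (zar Y) O' \<and> O' \<noteq> {} \<and> (\<forall>x\<in>O'. \<sigma> g x = x)"
    and bound: "\<And>U N f. openin (zar Y) U \<Longrightarrow> U \<noteq> {} \<Longrightarrow> (\<And>x. x \<in> U \<Longrightarrow> f x \<in> carrier_vec N) \<Longrightarrow>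
       (\<And>i. i < N \<Longrightarrow> regular_on Y U (\<lambda>x. f x $ i)) \<Longrightarrow> alg_independent U N f \<Longrightarrow> N \<le> d"
    and krull: "\<And>U. d \<ge> 1 \<Longrightarrow> openin (zar Y) U \<Longrightarrow> U \<noteq> {} \<Longrightarrow> enat d \<le> krull_dim (subtopology (zar Y) U)"
    and indep': "d \<ge> 1 \<Longrightarrow> alg_independent V d w"
  proof (rule fixed_point_coordinates[OF Y sm Gg Gf act y], goal_cases)
    case (1 g) show ?case by (rule fy) (fact 1)+
  next
    case (2 d V w \<alpha>) show ?case by (rule that[of V w d \<alpha>]) (fact 2)+
  qed
  \<comment> \<open>A chain of length \<open>n\<close> on \<open>X\<close> gives \<open>n\<close>
    independent functions; they are carried to \<open>Y\<close> by \<open>h\<close> and counted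
    there.\<close>
  have "n \<le> d"
  proof -
    have "enat n \<le> krull_dim (zar X)" using krX by simp
    then obtain U' F where U': "openin (zar X) U'" "U' \<noteq> {}" and F: "\<And>x. F x \<in> carrier_vec n"
      "\<And>i. i < n \<Longrightarrow> regular_on X U' (\<lambda>x. F x $ i)" and ind: "alg_independent U' n F"
      using krull_dim_alg_independent[OF X _ n1] by blast
    have UU: "U \<inter> U' \<noteq> {}" by (rule irreducible_space_Int[OF XD(4) Uo Une U'])
    have UUo: "openin (zar X) (U \<inter> U')" using Uo U' by auto
    show ?thesis
    proof (rule bound[of "{z \<in> V1. h z \<in> U'}" "\<lambda>z. F (h z)"])
      show "openin (zar Y) {z \<in> V1. h z \<in> U'}" by (rule morph_on_vimage[OF hm U'(1)])
      obtain x where "x \<in> U" "x \<in> U'" using UU by blast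
      hence "f x \<in> {z \<in> V1. h z \<in> U'}" using hf fUV by auto
      thus "{z \<in> V1. h z \<in> U'} \<noteq> {}" by blast
      show "F (h z) \<in> carrier_vec n" for z by (rule F)
      show "regular_on Y {z \<in> V1. h z \<in> U'} (\<lambda>z. F (h z) $ i)" if "i < n" for i
        by (rule morph_on_pullback[OF hm F(2)[OF that]])
      show "alg_independent {z \<in> V1. h z \<in> U'} n (\<lambda>z. F (h z))"
        unfolding alg_independent_def
      proof (intro ballI impI)
        fix p and v :: "'k vec" assume p: "p \<in> poly_fun n" "\<forall>z\<in>{z \<in> V1. h z \<in> U'}. p (F (h z)) = 0"
          and v: "v \<in> carrier_vec n"
        have "p (F x) = 0" if x: "x \<in> U'" for x
        proof (rule regular_on_density[OF XD(2,4) regular_on_poly[OF XD(3) U'(1) p(1) F(2)] UUo UU _ x])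
          fix x assume "x \<in> U \<inter> U'"
          hence "f x \<in> {z \<in> V1. h z \<in> U'}" "h (f x) = x" using hf fUV by auto
          thus "p (F x) = 0" using p(2) by metis
        qed
        thus "p v = 0" using ind p(1) v unfolding alg_independent_def by blast
      qed
    qed
  qed
  hence d1: "d \<ge> 1" using n1 by simp
  \<comment> \<open>Conversely, a chain of length \<open>d\<close> in the part \<open>V1\<close> of
    \<open>Y\<close> is carried to \<open>X\<close> by \<open>h\<close>.\<close>
  have "d \<le> n"
  proof -
    obtain C where C: "closed_chain (subtopology (zar Y) V1) d C"
      using krull_dim_chain[OF krull[OF d1 V1o V1ne] d1] by blast
    have "closed_chain (zar X) d (\<lambda>i. zar X closure_of (h ` C i))"
      by (rule closed_chain_transport[OF C V1o Uo fUV morph_on_vimage[OF fm] hVU morph_on_vimage[OF hm] fh])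
    from krull_dim_ge[OF this] show ?thesis using krX by simp
  qed
  hence dn: "d = n" using \<open>n \<le> d\<close> by simp
  note \<alpha>c = \<alpha>c'[unfolded dn] and \<alpha>1 = \<alpha>1'[unfolded dn] and faith = faith'[unfolded dn]
    and wc = w[unfolded dn] and rwn = rw[unfolded dn] and indep = indep'[OF d1, unfolded dn]
  let ?A = "affine_space n :: ('k vec, 'k) fspace"
  note A = irreducible_variety_affine_space[of n, where 'k = 'k]
  note AD = irreducible_varietyD[OF A]
  note opA = openin_affine_space_with[of "carrier_vec n" n, OF order_refl]
  have lin: "rational_of_linear n \<alpha> g = lin_map n (\<alpha> g)" for g
    by (simp add: rational_of_linear_def lin_map_def)
  have \<sigma>rep: "(points Y, \<sigma> g) \<in> rat_reps Y Y" if "g \<in> carrier G" for g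
    using act that YD(5) unfolding regular_action_def morphism_iff[OF YD(3)] rat_reps_iff[OF YD(3)] by blast
  \<comment> \<open>On a nonempty open set \<open>Og\<close> the equality of rational maps becomes
    the pointwise identity \<open>f (r x) = \<sigma> g (f x)\<close>. The representative
    \<open>r\<close> and its dominance are exported as well, for forming composites later.\<close>
  have equi: "\<exists>Ug r Og. \<rho> g \<in> rational_maps X X \<and> (Ug, r) \<in> \<rho> g \<and>
      (\<forall>W. openin (zar X) W \<and> W \<noteq> {} \<longrightarrow> {x \<in> Ug. r x \<in> W} \<noteq> {}) \<and>
      openin (zar X) Og \<and> Og \<noteq> {} \<and> Og \<subseteq> U \<and> Og \<subseteq> {x \<in> Ug. r x \<in> U} \<and> (\<forall>x\<in>Og. f (r x) = \<sigma> g (f x))"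
    if g: "g \<in> carrier G" for g
  proof -
    obtain Ug r where R: "\<rho> g \<in> rational_maps X X" and r: "(Ug, r) \<in> \<rho> g"
      and rd: "\<And>W. openin (zar X) W \<Longrightarrow> W \<noteq> {} \<Longrightarrow> {x \<in> Ug. r x \<in> W} \<noteq> {}"
      by (rule dominant_rep[OF \<rho>dom[OF g]]) blast
    let ?W = "{x \<in> Ug. r x \<in> U}" and ?f = "restrict f U"
    have Wne: "?W \<noteq> {}" by (rule rd[OF Uo Une])
    have rrep: "(Ug, r) \<in> rat_reps X X" by (rule rational_maps_class(2)[OF X X R r])
    have Wo: "openin (zar X) ?W"
      using rrep unfolding rat_reps_iff[OF XD(3)] by (intro morph_on_vimage[OF _ Uo]) blast
    have Sclass: "rat_of_morphism Y Y (\<sigma> g) \<in> rational_maps Y Y" "(points Y, \<sigma> g) \<in> rat_of_morphism Y Y (\<sigma> g)"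
      unfolding rat_of_morphism_def using rat_class_self[OF Y Y \<sigma>rep[OF g]] by auto
    have U': "{x \<in> U. ?f x \<in> points Y} = U" using morph_on_in[OF fm] by auto
    have L: "rat_comp X X Y \<Phi> (\<rho> g) = rat_eq X Y `` {(?W, compose ?W ?f r)}"
      by (rule rat_comp_eq[OF X X Y R P r fP Wne])
    have R': "rat_comp X Y Y (rat_of_morphism Y Y (\<sigma> g)) \<Phi> = rat_eq X Y `` {(U, compose U (\<sigma> g) ?f)}"
      using rat_comp_eq[OF X Y Y P Sclass(1) fP Sclass(2)] Une unfolding U' by blast
    have Wrep: "(?W, compose ?W ?f r) \<in> rat_reps X Y"
      by (rule compose_rat_reps[OF XD(3) YD(3) rrep rational_maps_class(2)[OF X Y P fP] Wne])
    have "(?W, compose ?W ?f r) \<in> rat_eq X Y `` {(U, compose U (\<sigma> g) ?f)}"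
      using rat_class_self(2)[OF X Y Wrep] eqv g unfolding equivariant_def L[symmetric] R'[symmetric] by simp
    hence agree: "((U, compose U (\<sigma> g) ?f), (?W, compose ?W ?f r)) \<in> rat_eq X Y" by simp
    have "f (r x) = \<sigma> g (f x)" if "x \<in> ?W \<inter> U" for x
      using rat_eqD[OF agree, of x] that by (simp add: compose_def)
    moreover have "openin (zar X) (?W \<inter> U)" using Wo Uo by auto
    moreover have "?W \<inter> U \<noteq> {}" by (rule irreducible_space_Int[OF XD(4) Wo Wne Uo Une])
    ultimately show ?thesis using R r rd
      by (intro exI[of _ Ug] exI[of _ r] exI[of _ "?W \<inter> U"] conjI) auto
  qed
  \<comment> \<open>\<open>faith\<close> provides an open subset of \<open>Y\<close> on which
    \<open>\<sigma> k\<close> is the identity. Conjugation by \<open>f\<close> brings it to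
    \<open>X\<close>, where agreement with the identity on a nonempty open set is enough.\<close>
  have kernel: "\<rho> k = rat_id X" if k: "k \<in> carrier G" and \<alpha>k: "\<alpha> k = 1\<^sub>m n" for k
  proof -
    obtain O' where O': "openin (zar Y) O'" "O' \<noteq> {}" "\<forall>x\<in>O'. \<sigma> k x = x" using faith[OF k \<alpha>k] by blast
    obtain Uk r Ok where R: "\<rho> k \<in> rational_maps X X" and r: "(Uk, r) \<in> \<rho> k"
      and Ok: "openin (zar X) Ok" "Ok \<noteq> {}" "Ok \<subseteq> U" "Ok \<subseteq> {x \<in> Uk. r x \<in> U}" "\<forall>x\<in>Ok. f (r x) = \<sigma> k (f x)"
      using equi[OF k] by (elim exE conjE)
    have o: "openin (zar X) {x \<in> U. f x \<in> O'}" by (rule morph_on_vimage[OF fm O'(1)])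
    obtain z where z: "z \<in> V1" "z \<in> O'" using irreducible_space_Int[OF YD(4) V1o V1ne O'(1,2)] by blast
    hence "h z \<in> {x \<in> U. f x \<in> O'}" using fh hVU by auto
    hence ne: "{x \<in> U. f x \<in> O'} \<noteq> {}" by blast
    let ?O = "Ok \<inter> {x \<in> U. f x \<in> O'}"
    have rid: "r x = x" if "x \<in> ?O" for x
    proof -
      have "f (r x) = f x" "r x \<in> U" "x \<in> U" using that Ok(3,4,5) O'(3) by auto
      thus ?thesis using hf by metis
    qed
    have Oo: "openin (zar X) ?O" using Ok(1) o by auto
    have One: "?O \<noteq> {}" by (rule irreducible_space_Int[OF XD(4) Ok(1,2) o ne])
    have "((Uk, r), (points X, \<lambda>x\<in>points X. x)) \<in> rat_eq X X"
      by (rule rat_eqI[OF X X rational_maps_class(2)[OF X X R r] rat_id_rep[OF X] Oo One]) (simp add: rid)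
    from rat_class_eqI[OF X X this] show ?thesis
      using rational_maps_class(1)[OF X X R r] by (simp add: rat_id_def rat_of_morphism_def)
  qed
  have \<alpha>inv: "\<alpha> g * \<alpha> (inv\<^bsub>G\<^esub> g) = 1\<^sub>m n" "\<alpha> (inv\<^bsub>G\<^esub> g) * \<alpha> g = 1\<^sub>m n" if "g \<in> carrier G" for g
    using \<alpha>m[OF that G.inv_closed[OF that]] \<alpha>m[OF G.inv_closed[OF that] that] that \<alpha>1 by simp_all
  \<comment> \<open>Faithfulness of \<open>\<alpha>\<close> is inherited from that of
    \<open>\<rho>\<close> through \<open>kernel\<close>.\<close>
  have \<alpha>inj: "inj_on \<alpha> (carrier G)"
  proof (rule inj_onI)
    fix g g' assume g: "g \<in> carrier G" "g' \<in> carrier G" "\<alpha> g = \<alpha> g'"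
    let ?k = "g \<otimes>\<^bsub>G\<^esub> inv\<^bsub>G\<^esub> g'"
    have k: "?k \<in> carrier G" using g by simp
    have "\<alpha> ?k = 1\<^sub>m n" using \<alpha>m[OF g(1) G.inv_closed[OF g(2)]] \<alpha>inv(1)[OF g(2)] g(3) by simp
    hence "\<rho> ?k = \<rho> \<one>\<^bsub>G\<^esub>" using kernel[OF k] kernel[OF G.one_closed \<alpha>1] by simp
    hence "?k = \<one>\<^bsub>G\<^esub>" using \<rho>inj k by (auto dest: inj_onD)
    thus "g = g'" using g by (metis G.inv_equality G.inv_inv G.inv_closed)
  qed
  have faithful: "faithful_linear_action G n \<alpha>"
    unfolding faithful_linear_action_def
  proof
    have "\<alpha> g \<in> Units (ring_mat TYPE('k) n ())" if "g \<in> carrier G" for g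
      unfolding Units_def using \<alpha>c \<alpha>inv[OF that] by (auto simp: ring_mat_def)
    thus "\<alpha> \<in> hom G (GL n)"
      by (intro homI) (auto simp: GL_def units_of_def \<alpha>m ring_mat_def)
  qed (rule \<alpha>inj)
  have ratA: "rational_action G ?A (rational_of_linear n \<alpha>)"
    unfolding rational_action_def
  proof (intro conjI)
    show "irreducible_variety ?A" by (rule A)
    show "rational_of_linear n \<alpha> \<in> hom G (Bir ?A)"
    proof (rule homI)
      show "rational_of_linear n \<alpha> g \<in> carrier (Bir ?A)" if "g \<in> carrier G" for g
        using lin_map_birational[OF \<alpha>c \<alpha>c \<alpha>inv[OF that]] by (simp add: Bir_def lin)
      show "rational_of_linear n \<alpha> (g \<otimes>\<^bsub>G\<^esub> g') = rational_of_linear n \<alpha> g \<otimes>\<^bsub>Bir ?A\<^esub> rational_of_linear n \<alpha> g'"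
        if "g \<in> carrier G" "g' \<in> carrier G" for g g'
        using lin_map_comp[OF \<alpha>c \<alpha>c, of g g'] \<alpha>m[OF that] by (simp add: Bir_def lin)
    qed
    show "inj_on (rational_of_linear n \<alpha>) (carrier G)"
      using \<alpha>inj lin_map_inj[OF \<alpha>c \<alpha>c] unfolding inj_on_def lin by blast
  qed
  obtain f0 where f0: "f0 \<in> poly_fun n" and f0i: "\<And>g v. g \<in> carrier G \<Longrightarrow> v \<in> carrier_vec n \<Longrightarrow> f0 (\<alpha> g *\<^sub>v v) = f0 v"
    and f0h: "\<And>c v. v \<in> carrier_vec n \<Longrightarrow> f0 (c \<cdot>\<^sub>v v) = c ^ card (carrier G) * f0 v"
    and f0n: "\<exists>a\<in>carrier_vec n. f0 a \<noteq> 0"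
    by (rule invariant_polynomial[OF Gg Gf n1 \<alpha>c \<alpha>1 \<alpha>m]) blast+
  \<comment> \<open>Written entrywise rather than as \<open>f0 v \<cdot>\<^sub>v v\<close>, so that
    each entry is literally a polynomial function and the value has dimension \<open>n\<close> for
    every argument.\<close>
  define \<psi> where "\<psi> v = vec n (\<lambda>i. f0 v * v $ i)" for v
  have \<psi>c: "\<psi> v \<in> carrier_vec n" for v by (simp add: \<psi>_def)
  have \<psi>s: "\<psi> v = f0 v \<cdot>\<^sub>v v" if "v \<in> carrier_vec n" for v using that by (auto simp: \<psi>_def)
  have \<psi>p: "(\<lambda>v. f0 v * v $ i) \<in> poly_fun n" if "i < n" for i by (intro poly_fun.mult f0 poly_fun.coord that)
  have \<psi>\<alpha>: "\<psi> (\<alpha> g *\<^sub>v v) = \<alpha> g *\<^sub>v \<psi> v" if "g \<in> carrier G" "v \<in> carrier_vec n" for g v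
  proof -
    have "\<alpha> g *\<^sub>v v \<in> carrier_vec n" using \<alpha>c[of g] that by simp
    thus ?thesis using that \<alpha>c[of g] by (simp add: \<psi>s f0i mult_mat_vec)
  qed
  \<comment> \<open>The degree of \<open>\<psi>\<close>: \<open>card (carrier G)\<close> from
    \<open>f0\<close> and one from \<open>v\<close>.\<close>
  define r where "r = Suc (card (carrier G))"
  have \<psi>scale: "\<psi> (c \<cdot>\<^sub>v v) = (c ^ r * f0 v) \<cdot>\<^sub>v v" if "v \<in> carrier_vec n" for c v
    using that by (simp add: \<psi>s f0h r_def smult_smult_assoc mult_ac)
  define U2 where "U2 = {x \<in> U. f x \<in> V}"
  have U2o: "openin (zar X) U2" unfolding U2_def by (rule morph_on_vimage[OF fm V(1)])
  have VV: "V1 \<inter> V \<noteq> {}" by (rule irreducible_space_Int[OF YD(4) V1o V1ne V])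
  have VVo: "openin (zar Y) (V1 \<inter> V)" using V1o V by auto
  have hU2: "h z \<in> U2" if "z \<in> V1 \<inter> V" for z using that fh hVU by (auto simp: U2_def)
  have U2ne: "U2 \<noteq> {}" using VV hU2 by blast
  have wreg: "regular_on X U2 (\<lambda>x. w (f x) $ i)" if "i < n" for i
    unfolding U2_def by (rule morph_on_pullback[OF fm rwn[OF that]])
  \<comment> \<open>Density is used twice, from \<open>X0\<close> to \<open>U2\<close> in
    \<open>X\<close> and then from \<open>V1 \<inter> V\<close> to \<open>V\<close> in
    \<open>Y\<close>, where the entries of \<open>w\<close> are algebraically independent.\<close>
  have dense: "p v = 0" if X0: "openin (zar X) X0" "X0 \<noteq> {}" and p: "p \<in> poly_fun n"
      and p0: "\<And>x. x \<in> X0 \<Longrightarrow> x \<in> U2 \<Longrightarrow> p (w (f x)) = 0" and v: "v \<in> carrier_vec n" for X0 p v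
  proof -
    have "p (w (f x)) = 0" if "x \<in> U2" for x
      by (rule regular_on_density[OF XD(2,4) regular_on_poly[OF XD(3) U2o p wreg] X0 p0 that])
    hence *: "p (w z) = 0" if "z \<in> V1 \<inter> V" for z using hU2[OF that] fh that by fastforce
    have "p (w z) = 0" if "z \<in> V" for z
      by (rule regular_on_density[OF YD(2,4) regular_on_poly[OF YD(3) V(1) p rwn] VVo VV * that]) simp
    thus ?thesis using indep p v unfolding alg_independent_def by blast
  qed
  define \<tau> where "\<tau> x = \<psi> (w (f x))" for x
  have \<tau>m: "morph_on X U2 ?A \<tau>"
  proof (rule morph_on_affine[OF XD(2) U2o])
    show "\<tau> x \<in> carrier_vec n" for x by (simp add: \<tau>_def \<psi>c)
    show "regular_on X U2 (\<lambda>x. \<tau> x $ i)" if "i < n" for i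
      using regular_on_poly[OF XD(3) U2o \<psi>p[OF that] wreg] that by (simp add: \<tau>_def \<psi>_def)
  qed
  note \<tau>rep = rat_reps_restrict[OF AD(3) U2ne \<tau>m]
  define \<phi> where "\<phi> = rat_eq X ?A `` {(U2, restrict \<tau> U2)}"
  note \<phi>class = rat_class_self[OF X A \<tau>rep, folded \<phi>_def]
  have dom: "dominant X ?A \<phi>"
  proof -
    have "a \<in> zar ?A closure_of (restrict \<tau> U2 ` U2)" if a: "a \<in> carrier_vec n" for a
      unfolding in_closure_of points_affine_space_with[OF order_refl]
    proof (intro conjI allI impI)
      fix T assume T: "a \<in> T \<and> openin (zar ?A) T"
      obtain p where p: "p \<in> poly_fun n" "p a \<noteq> 0" "{v \<in> carrier_vec n. p v \<noteq> 0} \<subseteq> T"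
        using T unfolding opA by blast
      define q where "q v = p (vec n (\<lambda>i. f0 v * v $ i))" for v
      have q: "q \<in> poly_fun n" unfolding q_def by (rule poly_fun_compose[OF p(1) \<psi>p])
      have "\<exists>x\<in>U2. \<tau> x \<in> T"
      proof (rule ccontr)
        assume no: "\<not> (\<exists>x\<in>U2. \<tau> x \<in> T)"
        have "q (w (f x)) = 0" if "x \<in> U2" for x
        proof -
          have "\<tau> x \<notin> T" "\<tau> x \<in> carrier_vec n" using no that by (auto simp: \<tau>_def \<psi>c)
          hence "p (\<tau> x) = 0" using p(3) by blast
          thus ?thesis by (simp add: q_def \<tau>_def \<psi>_def)
        qed
        from dense[OF U2o U2ne q this] have q0: "q v = 0" if "v \<in> carrier_vec n" for v using that by blast
        obtain c where c: "c \<in> carrier_vec n" "p c \<noteq> 0" "f0 c \<noteq> 0"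
          using f0n poly_fun_mult_nonzero[OF p(1) f0 a p(2)] by blast
        \<comment> \<open>Since \<open>s ^ r * f0 c = 1\<close>, the map \<open>\<psi>\<close> sends
          \<open>s c\<close> to \<open>c\<close>, so \<open>q\<close>, which is \<open>p\<close>
          after \<open>\<psi>\<close>, has the nonzero value \<open>p c\<close> at
          \<open>s c\<close>. The root exists because the field is algebraically closed.\<close>
        obtain s where s: "s ^ r = inverse (f0 c)" using nth_root_exists[of r "inverse (f0 c)"] by (auto simp: r_def)
        have "\<psi> (s \<cdot>\<^sub>v c) = c" using c s by (simp add: \<psi>scale)
        hence "q (s \<cdot>\<^sub>v c) = p c" unfolding q_def \<psi>_def by simp
        thus False using q0[of "s \<cdot>\<^sub>v c"] c by simp
      qed
      thus "\<exists>y. y \<in> restrict \<tau> U2 ` U2 \<and> y \<in> T" by auto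
    qed (rule a)
    hence "carrier_vec n \<subseteq> zar ?A closure_of (restrict \<tau> U2 ` U2)" by blast
    hence "zar ?A closure_of (restrict \<tau> U2 ` U2) = points ?A"
      using closure_of_subset_topspace[of "zar ?A" "restrict \<tau> U2 ` U2"]
      unfolding points_affine_space_with[OF order_refl] by (rule subset_antisym[rotated])
    thus ?thesis unfolding dominant_def using \<phi>class by blast
  qed
  have equiv: "equivariant G X \<rho> ?A (rational_of_linear n \<alpha>) \<phi>"
    unfolding equivariant_def
  proof
    fix g assume g: "g \<in> carrier G"
    obtain Ug rg Og where R: "\<rho> g \<in> rational_maps X X" and rg: "(Ug, rg) \<in> \<rho> g"
      and rd: "\<forall>W. openin (zar X) W \<and> W \<noteq> {} \<longrightarrow> {x \<in> Ug. rg x \<in> W} \<noteq> {}"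
      and Og: "openin (zar X) Og" "Og \<noteq> {}" "\<forall>x\<in>Og. f (rg x) = \<sigma> g (f x)"
      using equi[OF g] by (elim exE conjE)
    let ?t = "restrict \<tau> U2" and ?L = "\<lambda>v\<in>carrier_vec n. \<alpha> g *\<^sub>v v"
    let ?W = "{x \<in> Ug. rg x \<in> U2}"
    have Wne: "?W \<noteq> {}" using rd U2o U2ne by blast
    have W2: "{x \<in> U2. ?t x \<in> carrier_vec n} = U2" by (auto simp: \<tau>_def \<psi>c)
    have L: "rat_comp X X ?A \<phi> (\<rho> g) = rat_eq X ?A `` {(?W, compose ?W ?t rg)}"
      by (rule rat_comp_eq[OF X X A R \<phi>class(1) rg \<phi>class(2) Wne])
    have R': "rat_comp X ?A ?A (lin_map n (\<alpha> g)) \<phi> = rat_eq X ?A `` {(U2, compose U2 ?L ?t)}"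
      using rat_comp_eq[OF X A A \<phi>class(1) lin_map_rep(4)[OF \<alpha>c] \<phi>class(2) lin_map_rep(3)[OF \<alpha>c], of g] U2ne
      unfolding W2 by blast
    have rep1: "(?W, compose ?W ?t rg) \<in> rat_reps X ?A"
      by (rule compose_rat_reps[OF XD(3) AD(3) rational_maps_class(2)[OF X X R rg] \<tau>rep Wne])
    have rep2: "(U2, compose U2 ?L ?t) \<in> rat_reps X ?A"
      using compose_rat_reps[OF AD(3) AD(3) \<tau>rep lin_map_rep(1)[OF \<alpha>c[of g]]] U2ne unfolding W2 by blast
    have "((?W, compose ?W ?t rg), (U2, compose U2 ?L ?t)) \<in> rat_eq X ?A"
    proof (rule rat_eqI[OF X A rep1 rep2 Og(1,2)])
      fix x assume x: "x \<in> Og" "x \<in> ?W" "x \<in> U2"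
      have "\<tau> (rg x) = \<psi> (w (\<sigma> g (f x)))" using Og(3) x(1) by (simp add: \<tau>_def)
      also have "\<dots> = \<psi> (\<alpha> g *\<^sub>v w (f x))" using weq[OF g] x(3) by (simp add: U2_def)
      also have "\<dots> = \<alpha> g *\<^sub>v \<tau> x" unfolding \<tau>_def by (rule \<psi>\<alpha>[OF g wc])
      finally show "compose ?W ?t rg x = compose U2 ?L ?t x"
        using x by (simp add: compose_def) (simp add: \<tau>_def \<psi>c)
    qed
    from rat_class_eqI[OF X A this]
    show "rat_comp X X ?A \<phi> (\<rho> g) = rat_comp X ?A ?A (rational_of_linear n \<alpha> g) \<phi>"
      unfolding L lin R' .
  qed
  have notbir: "\<not> birational X ?A \<phi>"
  proof
    assume "birational X ?A \<phi>"
    then obtain U3 t V3 h3 where U3: "U3 \<noteq> {}" "morph_on X U3 ?A t" and h3: "morph_on ?A V3 X h3"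
      and tUV: "t \<in> U3 \<rightarrow> V3" and ht: "\<And>x. x \<in> U3 \<Longrightarrow> h3 (t x) = x" and t\<phi>: "(U3, restrict t U3) \<in> \<phi>"
      by (rule birational_inverse[OF X A]) blast
    let ?X0 = "U2 \<inter> U3"
    have X0o: "openin (zar X) ?X0" using U2o morph_on_openin[OF U3(2)] by auto
    have X0ne: "?X0 \<noteq> {}" by (rule irreducible_space_Int[OF XD(4) U2o U2ne morph_on_openin[OF U3(2)] U3(1)])
    have t\<tau>: "t x = \<tau> x" if "x \<in> ?X0" for x
      using rational_maps_agree[OF X A \<phi>class(1) t\<phi> \<phi>class(2), of x] that by simp
    have \<psi>m: "morph_on ?A (carrier_vec n) ?A \<psi>"
    proof (rule morph_on_affine[OF AD(2) openin_affine_all])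
      show "regular_on ?A (carrier_vec n) (\<lambda>v. \<psi> v $ i)" if "i < n" for i
        using regular_on_affine_poly[OF \<psi>p[OF that]] that by (simp add: \<psi>_def)
    qed (rule \<psi>c)
    let ?E1 = "{v \<in> carrier_vec n. \<psi> v \<in> V3}"
    let ?E = "{v \<in> ?E1. h3 (\<psi> v) \<in> U2}"
    \<comment> \<open>Once \<open>?s\<close> is known to be the identity on the nonempty open set
      \<open>?E\<close>, the map \<open>\<psi>\<close> is injective there; but it identifies
      \<open>v\<close> with \<open>\<zeta> v\<close>.\<close>
    let ?s = "\<lambda>v. w (f (h3 (\<psi> v)))"
    have hm3: "morph_on ?A ?E1 X (\<lambda>v. h3 (\<psi> v))" by (rule morph_on_compose[OF \<psi>m h3])
    have Eo: "openin (zar ?A) ?E" by (rule morph_on_vimage[OF hm3 U2o])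
    have sreg: "regular_on ?A ?E (\<lambda>v. ?s v $ i)" if "i < n" for i
      by (rule morph_on_pullback[OF hm3 wreg[OF that]])
    have E0: "w (f x) \<in> ?E \<and> ?s (w (f x)) = w (f x)" if x: "x \<in> ?X0" for x
    proof -
      have "\<psi> (w (f x)) = t x" using t\<tau>[OF x] by (simp add: \<tau>_def)
      moreover have "t x \<in> V3" "h3 (t x) = x" using x tUV ht by auto
      ultimately show ?thesis using x wc by simp
    qed
    \<comment> \<open>The identity is known at the points \<open>w (f x)\<close> only. These are
      dense by \<open>dense\<close>, and the entries of both sides are regular on \<open>?E\<close>,
      so a disagreement would yield a nonzero polynomial vanishing at all of them.\<close>
    have sid: "?s v = v" if v: "v \<in> ?E" for v
    proof (rule eq_vecI)
      fix i assume "i < dim_vec v"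
      hence i: "i < n" using v by auto
      show "?s v $ i = v $ i"
      proof (rule ccontr)
        assume ne: "?s v $ i \<noteq> v $ i"
        let ?O = "{u \<in> ?E. ?s u $ i + (-1) * u $ i \<noteq> 0}"
        have "regular_on ?A ?E (\<lambda>u. (-1) * u $ i)"
          by (rule regular_on_subset[OF AD(3) regular_on_affine_poly[of _ n] Eo])
            (auto intro!: poly_fun.intros i poly_fun_uminus)
        hence "openin (zar ?A) ?O"
          by (intro regular_on_nonzero_openin[OF AD(2)] regular_on_add[OF AD(3) sreg[OF i]])
        moreover have "v \<in> ?O" using v ne by simp
        ultimately obtain p where p: "p \<in> poly_fun n" "p v \<noteq> 0" "{u \<in> carrier_vec n. p u \<noteq> 0} \<subseteq> ?O"
          unfolding opA by blast
        have pz: "p (w (f x)) = 0" if "x \<in> ?X0" for x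
        proof (rule ccontr)
          assume "p (w (f x)) \<noteq> 0"
          hence "w (f x) \<in> ?O" using p(3) wc by blast
          hence "?s (w (f x)) $ i + (-1) * w (f x) $ i \<noteq> 0" by blast
          thus False using conjunct2[OF E0[OF that]] by simp
        qed
        have vc: "v \<in> carrier_vec n" using v by blast
        have "p v = 0" by (rule dense[OF X0o X0ne p(1) pz vc])
        thus False using p(2) by simp
      qed
    qed (use v wc[of "f (h3 (\<psi> v))"] in auto)
    have "r \<ge> 2" unfolding r_def using Gf G.one_closed by (metis card_gt_0_iff empty_iff Suc_le_mono One_nat_def Suc_leI numeral_2_eq_2)
    then obtain \<zeta> :: 'k where \<zeta>: "\<zeta> ^ r = 1" "\<zeta> \<noteq> 1" by (rule root_of_unity_neq_1)
    have \<zeta>0: "\<zeta> \<noteq> 0" using \<zeta> by (auto simp: r_def)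
    obtain x0 where "x0 \<in> ?X0" using X0ne by blast
    hence a: "w (f x0) \<in> ?E" using E0 by blast
    then obtain p where p: "p \<in> poly_fun n" "p (w (f x0)) \<noteq> 0" "{u \<in> carrier_vec n. p u \<noteq> 0} \<subseteq> ?E"
      using Eo unfolding opA by blast
    \<comment> \<open>\<open>q\<close> is \<open>p\<close> after scaling by \<open>\<zeta>\<close>;
      wherever both are nonzero, \<open>v\<close> and \<open>\<zeta> v\<close> lie in
      \<open>?E\<close>. It is not the zero function because the scaling is invertible.\<close>
    define q where "q v = p (vec n (\<lambda>i. \<zeta> * v $ i))" for v
    have q: "q \<in> poly_fun n" unfolding q_def
      by (rule poly_fun_compose[OF p(1)]) (intro poly_fun.mult poly_fun.const poly_fun.coord)
    have q': "q v = p (\<zeta> \<cdot>\<^sub>v v)" if "v \<in> carrier_vec n" for v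
    proof -
      have "vec n (\<lambda>i. \<zeta> * v $ i) = \<zeta> \<cdot>\<^sub>v v" using that by auto
      thus ?thesis by (simp add: q_def)
    qed
    have "q (inverse \<zeta> \<cdot>\<^sub>v w (f x0)) \<noteq> 0"
      using p(2) \<zeta>0 wc[of "f x0"] by (simp add: q' smult_smult_assoc)
    then obtain v1 where v1: "v1 \<in> carrier_vec n" "p v1 \<noteq> 0" "q v1 \<noteq> 0"
      using poly_fun_mult_nonzero[OF p(1) q wc p(2), of "inverse \<zeta> \<cdot>\<^sub>v w (f x0)"] wc[of "f x0"] by auto
    have n0: "0 < n" using n1 by simp
    have pq: "(\<lambda>v. p v * q v) \<in> poly_fun n" by (intro poly_fun.mult p q)
    \<comment> \<open>A nonzero first entry guarantees that \<open>\<zeta> v\<close> differs from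
      \<open>v\<close>.\<close>
    obtain v where v: "v \<in> carrier_vec n" "p v * q v \<noteq> 0" "v $ 0 \<noteq> 0"
      using poly_fun_mult_nonzero[OF pq poly_fun.coord[OF n0] v1(1) _ unit_vec_carrier[of n 0]] v1 n0 by auto
    have "v \<in> {u \<in> carrier_vec n. p u \<noteq> 0}" "\<zeta> \<cdot>\<^sub>v v \<in> {u \<in> carrier_vec n. p u \<noteq> 0}"
      using v q'[OF v(1)] by auto
    hence vE: "v \<in> ?E" "\<zeta> \<cdot>\<^sub>v v \<in> ?E" using p(3) by (blast dest: subsetD)+
    have "\<psi> (\<zeta> \<cdot>\<^sub>v v) = \<psi> v" using \<psi>scale[OF v(1), of \<zeta>] \<psi>s[OF v(1)] \<zeta>(1) by simp
    hence "\<zeta> \<cdot>\<^sub>v v = v" using sid[OF vE(1)] sid[OF vE(2)] by simp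
    hence "(\<zeta> \<cdot>\<^sub>v v) $ 0 = v $ 0" by simp
    hence "\<zeta> * v $ 0 = v $ 0" using v(1) n0 by simp
    thus False using v(3) \<zeta>(2) by simp
  qed
  have "nontrivial_base_change G X \<rho> ?A (rational_of_linear n \<alpha>)"
    unfolding nontrivial_base_change_def using assms(6) ratA dom equiv notbir by blast
  thus ?thesis using faithful by blast
qed

end
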